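(* Let $s\in(0,1)$, let $\Omega\subset\mathbb{R}^n$ be a bounded smooth domain, let $f\in C^1(\mathbb{R})$ be a strictly convex function, and let $g$ be a measurable exterior datum for which there are constants $\alpha_0\in(\max\{0,2s-1\},s)$ and $C_0>0$ such that $|g(x)-g(z)|\le C_0|x-z|^{\alpha_0}$ for all $x\in\mathbb{R}^n\setminus\Omega$ and all $z\in\partial\Omega$. Then there exists at most one stable $L^1$-weak solution $u$ to $$(-\Delta)^s u=f(u)\ \text{ in }\Omega,\qquad u=g\ \text{ in }\mathbb{R}^n\setminus\Omega,$$ such that $u$ is bounded below and $u\in H^s_\Omega$.
   Context: Fractional Laplacian: $(-\Delta)^s w(x)=c_{n,s}\int_{\mathbb{R}^n}\frac{w(x)-w(y)}{|x-y|^{n+2s}}\,dy$ (principal value), with $c_{n,s}>0$ a normalizing constant. Nonlocal normal derivative: $\mathcal{N}_s w(x)=c_{n,s}\int_\Omega\frac{w(x)-w(y)}{|x-y|^{n+2s}}\,dy$ for $x\in\mathbb{R}^n\setminus\Omega$. Put $d_\Omega=\mathrm{dist}(\cdot,\partial\Omega)$ and $\Omega^c=\mathbb{R}^n\setminus\Omega$. Energy space: $H^s_\Omega=\{w:\mathbb{R}^n\to\mathbb{R}: w\in L^2(\Omega),\ [w]_{H^s_\Omega}<+\infty\}$, where $[w]^2_{H^s_\Omega}=\frac{c_{n,s}}{2}\iint_{\mathbb{R}^{2n}\setminus(\Omega^c\times\Omega^c)}\frac{|w(x)-w(y)|^2}{|x-y|^{n+2s}}\,dx\,dy$. $L^1$-weak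 solution: $u$ is an $L^1$-weak solution to $(-\Delta)^su=f(u)$ in $\Omega$, $u=g$ in $\mathbb{R}^n\setminus\Omega$, if $u\in L^1(\Omega)$, $f(u)\in L^1(\Omega,d_\Omega^s\,dx)$, $u=g$ in $\mathbb{R}^n\setminus\Omega$, and $\int_\Omega u(-\Delta)^s\varphi\,dx+\int_{\mathbb{R}^n\setminus\Omega}g\,\mathcal{N}_s\varphi\,dx=\int_\Omega f(u)\varphi\,dx$ for every $\varphi$ such that $\varphi$ and $(-\Delta)^s\varphi$ are bounded in $\Omega$ and $\varphi\equiv0$ in $\mathbb{R}^n\setminus\Omega$. Stability: such a solution $u$ is stable in $\Omega$ if $f'(u)\in L^1_{\mathrm{loc}}(\Omega)$ and $\int_\Omega f'(u)\xi^2\,dx\le[\xi]^2_{H^s_\Omega}$ for every $\xi\in C^\infty_c(\Omega)$. *)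

theory Defs
  imports "HOL-Analysis.Analysis"
begin

section \<open>Smooth functions, smooth domains, strict convexity\<close>

text \<open>\<open>C^k\<close> and \<open>C^\<infinity>\<close> on an \<^emph>\<open>open\<close> set: all directional derivatives are \<open>C^(k-1)\<close>.\<close>

primrec Ck_on :: "nat \<Rightarrow> 'a::euclidean_space set \<Rightarrow> ('a \<Rightarrow> real) \<Rightarrow> bool" where
  "Ck_on 0 U h \<longleftrightarrow> continuous_on U h"
| "Ck_on (Suc k) U h \<longleftrightarrow>
     (\<forall>x\<in>U. h differentiable (at x)) \<and>
     (\<forall>v. Ck_on k U (\<lambda>x. frechet_derivative h (at x) v))"

definition Cinf_on :: "'a::euclidean_space set \<Rightarrow> ('a \<Rightarrow> real) \<Rightarrow> bool" where
  "Cinf_on U h \<longleftrightarrow> (\<forall>k. Ck_on k U h)"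

definition Cinf_compact_support :: "'a::euclidean_space set \<Rightarrow> ('a \<Rightarrow> real) \<Rightarrow> bool" where
  "Cinf_compact_support \<Omega> \<xi> \<longleftrightarrow>
     Cinf_on UNIV \<xi> \<and> compact (closure {x. \<xi> x \<noteq> 0}) \<and> closure {x. \<xi> x \<noteq> 0} \<subseteq> \<Omega>"

text \<open>Near each boundary point, \<open>\<Omega>\<close> is the region above the graph of a smooth function
  over the hyperplane orthogonal to a unit vector \<open>e\<close>; the vector \<open>x - (x \<bullet> e) *\<^sub>R e\<close> is
  the orthogonal projection of \<open>x\<close> to that hyperplane, so only the restriction of \<open>\<gamma>\<close> to
  the hyperplane matters.\<close>

definition bounded_smooth_domain :: "'a::euclidean_space set \<Rightarrow> bool" where
  "bounded_smooth_domain \<Omega> \<longleftrightarrow>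
     open \<Omega> \<and> connected \<Omega> \<and> \<Omega> \<noteq> {} \<and> bounded \<Omega> \<and>
     (\<forall>z\<in>frontier \<Omega>. \<exists>r>0. \<exists>e \<gamma>. norm e = 1 \<and> Cinf_on UNIV \<gamma> \<and>
        \<Omega> \<inter> ball z r = {x \<in> ball z r. \<gamma> (x - (x \<bullet> e) *\<^sub>R e) < x \<bullet> e})"

definition strictly_convex :: "(real \<Rightarrow> real) \<Rightarrow> bool" where
  "strictly_convex f \<longleftrightarrow>
     (\<forall>a b t. a \<noteq> b \<longrightarrow> 0 < t \<longrightarrow> t < 1 \<longrightarrow>
        f ((1 - t) * a + t * b) < (1 - t) * f a + t * f b)"

section \<open>Fractional Laplacian and nonlocal normal derivative\<close>

text \<open>Throughout, \<open>c\<close> is the normalizing constant \<open>c_{n,s}\<close> and \<open>n = DIM('a)\<close>.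
  The integrands below vanish on the diagonal \<open>x = y\<close>, because \<open>0 / 0 = 0\<close>.\<close>

definition diff_quot :: "real \<Rightarrow> ('a::euclidean_space \<Rightarrow> real) \<Rightarrow> 'a \<Rightarrow> 'a \<Rightarrow> real" where
  "diff_quot s w x y = (w x - w y) / norm (x - y) powr (real DIM('a) + 2 * s)"

text \<open>The principal value at \<open>x\<close> exists and equals \<open>l\<close>.\<close>

definition has_frac_laplacian ::
    "real \<Rightarrow> real \<Rightarrow> ('a::euclidean_space \<Rightarrow> real) \<Rightarrow> 'a \<Rightarrow> real \<Rightarrow> bool" where
  "has_frac_laplacian c s w x l \<longleftrightarrow>
     (\<forall>\<epsilon>>0. set_integrable lebesgue {y. \<epsilon> < dist x y} (diff_quot s w x)) \<and>
     ((\<lambda>\<epsilon>. c * set_lebesgue_integral lebesgue {y. \<epsilon> < dist x y} (diff_quot s w x))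
        \<longlongrightarrow> l) (at_right 0)"

definition frac_laplacian ::
    "real \<Rightarrow> real \<Rightarrow> ('a::euclidean_space \<Rightarrow> real) \<Rightarrow> 'a \<Rightarrow> real" where
  "frac_laplacian c s w x = (THE l. has_frac_laplacian c s w x l)"

definition nonlocal_normal_deriv ::
    "real \<Rightarrow> real \<Rightarrow> 'a::euclidean_space set \<Rightarrow> ('a \<Rightarrow> real) \<Rightarrow> 'a \<Rightarrow> real" where
  "nonlocal_normal_deriv c s \<Omega> w x =
     c * set_lebesgue_integral lebesgue \<Omega> (diff_quot s w x)"

section \<open>Energy space\<close>

text \<open>The squared seminorm, with value in \<open>[0, \<infinity>]\<close>; the integral is over \<open>R^{2n}\<close>, realised
  as the Euclidean space \<open>'a \<times> 'a\<close>.\<close>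

definition Hs_seminorm_sq ::
    "real \<Rightarrow> real \<Rightarrow> 'a::euclidean_space set \<Rightarrow> ('a \<Rightarrow> real) \<Rightarrow> ennreal" where
  "Hs_seminorm_sq c s \<Omega> w =
     ennreal (c / 2) *
     (\<integral>\<^sup>+ p. ennreal (\<bar>w (fst p) - w (snd p)\<bar>\<^sup>2 /
                  norm (fst p - snd p) powr (real DIM('a) + 2 * s)) *
            indicator (- ((- \<Omega>) \<times> (- \<Omega>))) p
       \<partial>(lebesgue :: ('a \<times> 'a) measure))"

definition Hs_space ::
    "real \<Rightarrow> real \<Rightarrow> 'a::euclidean_space set \<Rightarrow> ('a \<Rightarrow> real) set" where
  "Hs_space c s \<Omega> =
     {w. w \<in> borel_measurable lebesgue \<and>
         set_integrable lebesgue \<Omega> (\<lambda>x. (w x)\<^sup>2) \<and>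
         Hs_seminorm_sq c s \<Omega> w < \<infinity>}"

section \<open>Weak solutions and stability\<close>

definition admissible_test ::
    "real \<Rightarrow> real \<Rightarrow> 'a::euclidean_space set \<Rightarrow> ('a \<Rightarrow> real) \<Rightarrow> bool" where
  "admissible_test c s \<Omega> \<phi> \<longleftrightarrow>
     \<phi> \<in> borel_measurable lebesgue \<and>
     (\<forall>x. x \<notin> \<Omega> \<longrightarrow> \<phi> x = 0) \<and>
     bounded (\<phi> ` \<Omega>) \<and>
     (\<forall>x\<in>\<Omega>. \<exists>l. has_frac_laplacian c s \<phi> x l) \<and>
     bounded (frac_laplacian c s \<phi> ` \<Omega>)"

text \<open>The Bochner integral is \<open>0\<close> on non-integrable functions. The integrability clauses for
  each \<open>\<phi>\<close> say that the two integrals of the weak formulation converge; the remaining one does,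
  as \<open>u\<close> is integrable and the fractional Laplacian of \<open>\<phi>\<close> is bounded.\<close>

definition L1_weak_solution ::
    "real \<Rightarrow> real \<Rightarrow> 'a::euclidean_space set \<Rightarrow> (real \<Rightarrow> real) \<Rightarrow> ('a \<Rightarrow> real) \<Rightarrow>
     ('a \<Rightarrow> real) \<Rightarrow> bool" where
  "L1_weak_solution c s \<Omega> f g u \<longleftrightarrow>
     set_integrable lebesgue \<Omega> u \<and>
     set_integrable lebesgue \<Omega> (\<lambda>x. f (u x) * infdist x (frontier \<Omega>) powr s) \<and>
     (AE x in lebesgue. x \<notin> \<Omega> \<longrightarrow> u x = g x) \<and>
     (\<forall>\<phi>. admissible_test c s \<Omega> \<phi> \<longrightarrow>
        set_integrable lebesgue (- \<Omega>) (\<lambda>x. g x * nonlocal_normal_deriv c s \<Omega> \<phi> x) \<and>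
        set_integrable lebesgue \<Omega> (\<lambda>x. f (u x) * \<phi> x) \<and>
        (LINT x:\<Omega>|lebesgue. u x * frac_laplacian c s \<phi> x) +
        (LINT x:(- \<Omega>)|lebesgue. g x * nonlocal_normal_deriv c s \<Omega> \<phi> x) =
        (LINT x:\<Omega>|lebesgue. f (u x) * \<phi> x))"

text \<open>In the stability inequality, \<open>ennreal\<close> sends a negative left-hand side to \<open>0\<close>; the
  inequality is then trivially true, as it should be.\<close>

definition stable_L1_weak_solution ::
    "real \<Rightarrow> real \<Rightarrow> 'a::euclidean_space set \<Rightarrow> (real \<Rightarrow> real) \<Rightarrow> ('a \<Rightarrow> real) \<Rightarrow>
     ('a \<Rightarrow> real) \<Rightarrow> bool" where
  "stable_L1_weak_solution c s \<Omega> f g u \<longleftrightarrow>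
     L1_weak_solution c s \<Omega> f g u \<and>
     (\<forall>K. compact K \<and> K \<subseteq> \<Omega> \<longrightarrow> set_integrable lebesgue K (\<lambda>x. deriv f (u x))) \<and>
     (\<forall>\<xi>. Cinf_compact_support \<Omega> \<xi> \<longrightarrow>
        ennreal (LINT x:\<Omega>|lebesgue. deriv f (u x) * (\<xi> x)\<^sup>2) \<le> Hs_seminorm_sq c s \<Omega> \<xi>)"

definition essentially_bounded_below :: "'a::euclidean_space set \<Rightarrow> ('a \<Rightarrow> real) \<Rightarrow> bool" where
  "essentially_bounded_below \<Omega> u \<longleftrightarrow> (\<exists>m. AE x in lebesgue. x \<in> \<Omega> \<longrightarrow> m \<le> u x)"

end

theory Submission
  imports Defs
begin

text \<open>Put \<open>w = u - v\<close>, which vanishes outside \<open>\<Omega>\<close> and has finite Gagliardo energy on the whole space.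
  Such functions, and in particular the positive part \<open>z\<close> of \<open>w\<close>, are energy limits of functions in
  \<open>C_c^\<infinity>(\<Omega>)\<close>. Testing with \<open>\<phi> \<in> C_c^\<infinity>(\<Omega>)\<close> and subtracting the two weak equations cancels the
  exterior datum and gives \<open>E(w, \<phi>) = \<integral> (f u - f v) \<phi>\<close> for the energy form \<open>E\<close>. Stability, which by
  Fatou extends to energy limits because \<open>f' u\<close> and \<open>f' v\<close> are bounded below, bounds the weights
  \<open>f' u\<close> and \<open>f' v\<close> by the energy; since \<open>|f u - f v| \<le> (|f' u| + |f' v|) |w|\<close>, this allows the test
  function \<open>z\<close> in the equation. Then \<open>\<integral> f' u z^2 \<le> E(z, z) \<le> E(w, z) = \<integral> (f u - f v) z\<close>, whereas
  strict convexity makes \<open>f u - f v < f' u (u - v)\<close> wherever \<open>u > v\<close>. Hence \<open>u \<le> v\<close>, and by symmetry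
  \<open>u = v\<close>.\<close>

text \<open>The obstacle is that \<open>w\<close> is not an admissible test function, and that
  \<open>(f u - f v) w\<close> is not known to be integrable: \<open>f u\<close> is controlled only
  with the weight \<open>infdist x (frontier \<Omega>) powr s\<close>. Stability of both solutions
  repairs this. It puts \<open>sqrt (f' u + M) z\<close> and \<open>sqrt (f' v + N) z\<close> into
  \<open>L^2\<close> for every energy function \<open>z\<close>, and the tangent inequalities at
  \<open>u\<close> and at \<open>v\<close> then dominate \<open>(f u - f v) z\<close> by a product
  of two \<open>L^2\<close> functions. Stability must reach the energy space with its exact
  constant, because in the end two energy terms have to cancel; this is why Young inequalities with
  a factor \<open>1 + \<delta>\<close> appear where the factor 2 would be simpler. The positive part
  is needed because the tangent inequality at \<open>u\<close> has one sign, and multiplying it by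
  \<open>w\<close> would reverse it where \<open>u < v\<close>. The lower bound on \<open>u\<close>
  acts through the monotonicity of \<open>f'\<close>. The definitions integrate against the
  completed measure, whereas Tonelli and translations are used for \<open>lborel\<close>, so
  solutions are replaced by Borel representatives before any double integral is formed.\<close>

section \<open>Test functions and mollifiers\<close>

text \<open>The functions \<open>exp (- 1 / t) / t ^ m\<close> on \<open>t > 0\<close> are closed under differentiation up to linear
  combinations; this makes \<open>smooth_alg\<close> below an algebra of smooth functions containing bumps.\<close>

definition exp_inv :: "nat \<Rightarrow> real \<Rightarrow> real" where
  "exp_inv m t = (if t \<le> 0 then 0 else exp (- (1 / t)) / t ^ m)"

lemma exp_inv_nonneg: "0 \<le> exp_inv m t"
  by (simp add: exp_inv_def)

lemma exp_inv_0_pos: "0 < exp_inv 0 t \<longleftrightarrow> 0 < t"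
  by (simp add: exp_inv_def)

lemma power_le_fact_mult_exp:
  fixes y :: real
  assumes "0 \<le> y"
  shows "y ^ n \<le> fact n * exp y"
proof -
  have "(\<Sum>k\<in>{n}. y ^ k /\<^sub>R fact k) \<le> (\<Sum>k. y ^ k /\<^sub>R fact k)"
    by (rule sum_le_suminf) (use assms summable_exp_generic[of y] in auto)
  then have "y ^ n /\<^sub>R fact n \<le> exp y" by (simp add: exp_def)
  then show ?thesis by (simp add: field_simps)
qed

text \<open>The order \<open>m + 2\<close> of the exponential series absorbs the pole
  \<open>t ^ m\<close> and leaves a factor \<open>t\<^sup>2\<close>. A quadratic bound is what makes
  the difference quotient at 0 tend to 0.\<close>

lemma exp_inv_le: "exp_inv m t \<le> fact (m + 2) * t\<^sup>2"
proof (cases "t \<le> 0")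
  case False
  then have t: "0 < t" by simp
  have "(1 / t) ^ (m + 2) \<le> fact (m + 2) * exp (1 / t)"
    by (rule power_le_fact_mult_exp) (use t in auto)
  then have "1 \<le> fact (m + 2) * exp (1 / t) * t ^ (m + 2)"
    using t by (simp add: power_one_over field_simps)
  then have "exp (- (1 / t)) * 1 \<le> exp (- (1 / t)) * (fact (m + 2) * exp (1 / t) * t ^ (m + 2))"
    by (intro mult_left_mono) auto
  also have "\<dots> = fact (m + 2) * (exp (- (1 / t)) * exp (1 / t)) * t ^ (m + 2)" by (simp only: ac_simps)
  also have "exp (- (1 / t)) * exp (1 / t) = 1" by (simp flip: exp_add)
  finally have "exp (- (1 / t)) \<le> (fact (m + 2) * t\<^sup>2) * t ^ m"
    by (simp add: power_add mult_ac del: fact_Suc add_2_eq_Suc')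
  then show ?thesis using t by (simp add: exp_inv_def field_simps del: fact_Suc)
qed (simp add: exp_inv_def)

lemma DERIV_exp_inv:
  "(exp_inv m has_real_derivative exp_inv (m + 2) t - real m * exp_inv (m + 1) t) (at t)"
proof -
  consider "t < 0" | "t > 0" | "t = 0" by linarith
  then show ?thesis
  proof cases
    case 1
    have "((\<lambda>_. 0) has_real_derivative 0) (at t)" by simp
    then have "(exp_inv m has_real_derivative 0) (at t)"
      by (rule has_field_derivative_transform_within_open[where S="{..<0}"])
        (use 1 in \<open>auto simp: exp_inv_def\<close>)
    then show ?thesis using 1 by (simp add: exp_inv_def)
  next
    case 2
    have "((\<lambda>t. exp (- (1 / t)) / t ^ m) has_real_derivative
        exp_inv (m + 2) t - real m * exp_inv (m + 1) t) (at t)"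
    \<comment> \<open>The exponent \<open>m - 1\<close> in the derivative of \<open>t ^ m\<close> is
      a truncated subtraction, so \<open>m = 0\<close> is computed apart.\<close>
    proof (cases m)
      case 0
      then show ?thesis using 2
        by (auto intro!: derivative_eq_intros simp: exp_inv_def field_simps power2_eq_square)
    next
      case (Suc k)
      have "((\<lambda>t. exp (- (1 / t)) / t ^ m) has_real_derivative
          (exp (- (1 / t)) * (1 / t\<^sup>2) * t ^ m - exp (- (1 / t)) * (real m * t ^ k)) / (t ^ m * t ^ m)) (at t)"
        unfolding Suc using 2
        by (auto intro!: derivative_eq_intros simp: power2_eq_square simp del: power_Suc)
      also have "(exp (- (1 / t)) * (1 / t\<^sup>2) * t ^ m - exp (- (1 / t)) * (real m * t ^ k)) / (t ^ m * t ^ m)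
          = exp_inv (m + 2) t - real m * exp_inv (m + 1) t"
        using 2 by (simp add: exp_inv_def Suc field_simps power2_eq_square)
      finally show ?thesis .
    qed
    then show ?thesis
      by (rule has_field_derivative_transform_within_open[where S="{0<..}"])
        (use 2 in \<open>auto simp: exp_inv_def\<close>)
  next
    case 3
    have "((\<lambda>h. exp_inv m h / h) \<longlongrightarrow> 0) (at 0)"
    proof (rule Lim_null_comparison)
      show "\<forall>\<^sub>F h in at 0. norm (exp_inv m h / h) \<le> fact (m + 2) * \<bar>h\<bar>"
      proof (rule always_eventually, rule allI)
        fix h :: real
        show "norm (exp_inv m h / h) \<le> fact (m + 2) * \<bar>h\<bar>"
        proof (cases "h = 0")
          case False
          then have "\<bar>exp_inv m h\<bar> \<le> (fact (m + 2) * \<bar>h\<bar>) * \<bar>h\<bar>"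
            using exp_inv_le[of m h] exp_inv_nonneg[of m h]
            by (simp add: power2_eq_square mult.assoc del: fact_Suc)
          then show ?thesis using False by (simp add: pos_divide_le_eq del: fact_Suc)
        qed simp
      qed
      show "((\<lambda>h::real. fact (m + 2) * \<bar>h\<bar>) \<longlongrightarrow> 0) (at 0)"
        by (auto intro!: tendsto_eq_intros)
    qed
    then show ?thesis unfolding 3 by (simp add: DERIV_def exp_inv_def)
  qed
qed

inductive_set smooth_alg :: "('a::euclidean_space \<Rightarrow> real) set" where
  const: "(\<lambda>_. c) \<in> smooth_alg"
| inner: "(\<lambda>x. x \<bullet> v) \<in> smooth_alg"
| inner_self: "(\<lambda>x. x \<bullet> x) \<in> smooth_alg"
| add: "p \<in> smooth_alg \<Longrightarrow> q \<in> smooth_alg \<Longrightarrow> (\<lambda>x. p x + q x) \<in> smooth_alg"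
| mult: "p \<in> smooth_alg \<Longrightarrow> q \<in> smooth_alg \<Longrightarrow> (\<lambda>x. p x * q x) \<in> smooth_alg"
| exp_inv: "p \<in> smooth_alg \<Longrightarrow> (\<lambda>x. exp_inv m (p x)) \<in> smooth_alg"

text \<open>The class is closed under directional derivatives, so a single differentiation step
  iterates to every order. In the case of \<open>exp_inv\<close>, the derivative of
  \<open>exp_inv m\<close> is a combination of the same functions with larger
  \<open>m\<close>.\<close>

lemma smooth_alg_has_derivative:
  assumes "p \<in> smooth_alg"
  shows "\<exists>q. (\<forall>x. (p has_derivative (\<lambda>v. q v x)) (at x)) \<and> (\<forall>v. q v \<in> smooth_alg)"
  using assms
proof induction
  case (const c)
  show ?case by (rule exI[of _ "\<lambda>v x. 0"]) (auto intro: smooth_alg.const)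
next
  case (inner v)
  show ?case by (rule exI[of _ "\<lambda>w x. w \<bullet> v"]) (auto intro!: smooth_alg.const derivative_eq_intros)
next
  case inner_self
  show ?case
  proof (rule exI[of _ "\<lambda>w x. x \<bullet> w + x \<bullet> w"], intro conjI allI)
    fix x :: 'a
    show "((\<lambda>x. x \<bullet> x) has_derivative (\<lambda>v. x \<bullet> v + x \<bullet> v)) (at x)"
      by (auto intro!: derivative_eq_intros simp: inner_commute)
  qed (intro smooth_alg.add smooth_alg.inner)
next
  case (add p q)
  then obtain p' q' where "\<And>x. (p has_derivative (\<lambda>v. p' v x)) (at x)" "\<And>v. p' v \<in> smooth_alg"
      "\<And>x. (q has_derivative (\<lambda>v. q' v x)) (at x)" "\<And>v. q' v \<in> smooth_alg" by metis
  then show ?case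
    by (intro exI[of _ "\<lambda>v x. p' v x + q' v x"]) (auto intro!: smooth_alg.add has_derivative_add)
next
  case (mult p q)
  then obtain p' q' where "\<And>x. (p has_derivative (\<lambda>v. p' v x)) (at x)" "\<And>v. p' v \<in> smooth_alg"
      "\<And>x. (q has_derivative (\<lambda>v. q' v x)) (at x)" "\<And>v. q' v \<in> smooth_alg" by metis
  with mult show ?case
    by (intro exI[of _ "\<lambda>v x. p x * q' v x + p' v x * q x"])
      (auto intro!: smooth_alg.add smooth_alg.mult has_derivative_mult)
next
  case (exp_inv p m)
  then obtain p' where p': "\<And>x. (p has_derivative (\<lambda>v. p' v x)) (at x)" "\<And>v. p' v \<in> smooth_alg"
    by metis
  have "((\<lambda>x. exp_inv m (p x)) has_derivative
      (\<lambda>v. p' v x * (exp_inv (m + 2) (p x) + (- real m) * exp_inv (m + 1) (p x)))) (at x)" for x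
    using has_derivative_compose[OF p'(1)[of x]
        DERIV_exp_inv[of m "p x", unfolded has_field_derivative_def]]
    by (simp add: mult_ac)
  moreover have "(\<lambda>x. p' v x * (exp_inv (m + 2) (p x) + (- real m) * exp_inv (m + 1) (p x)))
      \<in> smooth_alg" for v
    by (intro smooth_alg.mult smooth_alg.add smooth_alg.const smooth_alg.exp_inv p'(2) exp_inv.hyps)
  ultimately show ?case
    by (intro exI[of _ "\<lambda>v x. p' v x * (exp_inv (m + 2) (p x) + (- real m) * exp_inv (m + 1) (p x))"])
      blast
qed

lemma smooth_alg_Cinf: "p \<in> smooth_alg \<Longrightarrow> Cinf_on UNIV p"
proof -
  have "\<forall>p::'a \<Rightarrow> real. p \<in> smooth_alg \<longrightarrow> Ck_on k UNIV p" for k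
  proof (induction k)
    case 0
    show ?case
    proof (intro allI impI)
      fix p :: "'a \<Rightarrow> real" assume "p \<in> smooth_alg"
      then have "isCont p x" for x
        using smooth_alg_has_derivative has_derivative_continuous by blast
      then show "Ck_on 0 UNIV p" by (simp add: continuous_at_imp_continuous_on)
    qed
  next
    case (Suc k)
    show ?case
    proof (intro allI impI)
      fix p :: "'a \<Rightarrow> real" assume "p \<in> smooth_alg"
      then obtain q where q: "\<And>x. (p has_derivative (\<lambda>v. q v x)) (at x)" "\<And>v. q v \<in> smooth_alg"
        using smooth_alg_has_derivative by metis
      have "frechet_derivative p (at x) = (\<lambda>v. q v x)" for x
        using frechet_derivative_at[OF q(1)] by simp
      with q Suc show "Ck_on (Suc k) UNIV p" by (auto simp: differentiable_def)
    qed
  qed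
  then show "p \<in> smooth_alg \<Longrightarrow> Cinf_on UNIV p" by (simp add: Cinf_on_def)
qed

section \<open>Calculus of smooth and of compactly supported smooth functions\<close>

lemma Cinf_on_differentiable: "Cinf_on U h \<Longrightarrow> x \<in> U \<Longrightarrow> h differentiable (at x)"
  unfolding Cinf_on_def by (metis Ck_on.simps(2))

lemma Cinf_on_continuous_on: "Cinf_on U h \<Longrightarrow> continuous_on U h"
  unfolding Cinf_on_def by (metis Ck_on.simps(1))

lemma Cinf_on_frechet_derivative: "Cinf_on U h \<Longrightarrow> Cinf_on U (\<lambda>x. frechet_derivative h (at x) v)"
  unfolding Cinf_on_def by (metis Ck_on.simps(2))

lemma Cinf_on_has_derivative:
  "Cinf_on U h \<Longrightarrow> x \<in> U \<Longrightarrow> (h has_derivative frechet_derivative h (at x)) (at x)"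
  using Cinf_on_differentiable frechet_derivative_works by blast

lemma Ck_on_add:
  "Ck_on k U p \<Longrightarrow> Ck_on k U q \<Longrightarrow> open U \<Longrightarrow> Ck_on k U (\<lambda>x. p x + q x)"
proof (induction k arbitrary: p q)
  case 0
  then show ?case by (auto intro: continuous_on_add)
next
  case (Suc k)
  have *: "frechet_derivative (\<lambda>x. p x + q x) (at x) v =
      frechet_derivative p (at x) v + frechet_derivative q (at x) v" if "x \<in> U" for x v
  proof -
    have "((\<lambda>x. p x + q x) has_derivative
        (\<lambda>v. frechet_derivative p (at x) v + frechet_derivative q (at x) v)) (at x)"
      using Suc.prems that by (intro has_derivative_add) (auto simp flip: frechet_derivative_works)
    then show ?thesis by (simp add: frechet_derivative_at[symmetric])
  qed
  \<comment> \<open>The derivative of the sum is identified only at points of \<open>U\<close>, not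
    as a function on the whole space. The induction therefore needs that \<open>Ck_on\<close>
    depends only on the values in the open set \<open>U\<close>.\<close>
  have cong: "Ck_on k U a \<longleftrightarrow> Ck_on k U b" if "\<And>x. x \<in> U \<Longrightarrow> a x = b x" for a b :: "'a \<Rightarrow> real" and k
    using that
  proof (induction k arbitrary: a b)
    case 0
    then show ?case by (simp cong: continuous_on_cong)
  next
    case (Suc k)
    have d: "(a has_derivative D) (at x) \<longleftrightarrow> (b has_derivative D) (at x)" if "x \<in> U" for x D
      using has_derivative_transform_within_open[of a D x UNIV U b]
        has_derivative_transform_within_open[of b D x UNIV U a] Suc.prems \<open>open U\<close> that by auto
    then have "frechet_derivative a (at x) = frechet_derivative b (at x)" if "x \<in> U" for x
      using that by (simp add: frechet_derivative_def)
    then have "Ck_on k U (\<lambda>x. frechet_derivative a (at x) v) \<longleftrightarrow>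
        Ck_on k U (\<lambda>x. frechet_derivative b (at x) v)" for v
      by (intro Suc.IH) simp
    with d show ?case by (auto simp: differentiable_def)
  qed
  have "Ck_on k U (\<lambda>x. frechet_derivative (\<lambda>x. p x + q x) (at x) v)" for v
    using cong[OF *] Suc by simp
  with Suc.prems show ?case by auto
qed

lemma Cinf_on_UNIV_add:
  "Cinf_on UNIV p \<Longrightarrow> Cinf_on UNIV q \<Longrightarrow> Cinf_on UNIV (\<lambda>x. p x + q x)"
  by (simp add: Cinf_on_def Ck_on_add)

lemma Cinf_compact_supportI:
  assumes "Cinf_on UNIV p" "compact K" "K \<subseteq> U" "\<And>x. x \<notin> K \<Longrightarrow> p x = 0"
  shows "Cinf_compact_support U p"
proof -
  have "closure {x. p x \<noteq> 0} \<subseteq> K"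
    using assms by (intro closure_minimal) (auto simp: compact_imp_closed)
  moreover from this have "compact (closure {x. p x \<noteq> 0})"
    using assms(2) by (meson bounded_subset closed_closure compact_eq_bounded_closed)
  ultimately show ?thesis using assms by (auto simp: Cinf_compact_support_def)
qed

lemma Cinf_compact_supportE:
  assumes "Cinf_compact_support U p"
  obtains K where "Cinf_on UNIV p" "compact K" "K \<subseteq> U" "\<And>x. x \<notin> K \<Longrightarrow> p x = 0"
proof (rule that)
  show "p x = 0" if "x \<notin> closure {x. p x \<noteq> 0}" for x
    using that closure_subset[of "{x. p x \<noteq> 0}"] by blast
qed (use assms in \<open>simp_all add: Cinf_compact_support_def\<close>)

lemma Cinf_compact_support_add:
  assumes "Cinf_compact_support U p" "Cinf_compact_support U q"
  shows "Cinf_compact_support U (\<lambda>x. p x + q x)"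
proof -
  obtain K where K: "Cinf_on UNIV p" "compact K" "K \<subseteq> U" "\<And>x. x \<notin> K \<Longrightarrow> p x = 0"
    using assms(1) by (rule Cinf_compact_supportE) blast
  obtain L where L: "Cinf_on UNIV q" "compact L" "L \<subseteq> U" "\<And>x. x \<notin> L \<Longrightarrow> q x = 0"
    using assms(2) by (rule Cinf_compact_supportE) blast
  show ?thesis
    by (rule Cinf_compact_supportI[where K="K \<union> L"]) (use K L in \<open>auto intro: Cinf_on_UNIV_add\<close>)
qed

lemma Cinf_compact_support_frechet_derivative:
  assumes "Cinf_compact_support U p"
  shows "Cinf_compact_support U (\<lambda>x. frechet_derivative p (at x) v)"
proof -
  obtain K where K: "Cinf_on UNIV p" "compact K" "K \<subseteq> U" "\<And>x. x \<notin> K \<Longrightarrow> p x = 0"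
    using assms by (rule Cinf_compact_supportE) blast
  have "frechet_derivative p (at x) v = 0" if "x \<notin> K" for x
  proof -
    have "((\<lambda>_. 0) has_derivative (\<lambda>_. 0)) (at x)" by simp
    then have "(p has_derivative (\<lambda>_. 0)) (at x)"
      by (rule has_derivative_transform_within_open[where s="- K"])
        (use that K compact_imp_closed in auto)
    then show ?thesis by (simp add: frechet_derivative_at[symmetric])
  qed
  with K show ?thesis
    by (intro Cinf_compact_supportI[where K=K] Cinf_on_frechet_derivative)
qed

lemma Cinf_compact_support_bounded:
  assumes "Cinf_compact_support U p"
  obtains B where "0 \<le> B" "\<And>x. \<bar>p x\<bar> \<le> B"
proof -
  let ?K = "closure {x. p x \<noteq> 0}"
  have "compact (p ` ?K)"
    using assms by (intro compact_continuous_image)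
      (auto simp: Cinf_compact_support_def dest: Cinf_on_continuous_on intro: continuous_on_subset)
  then obtain B where B: "\<And>x. x \<in> ?K \<Longrightarrow> \<bar>p x\<bar> \<le> B"
    using compact_imp_bounded bounded_iff by (metis imageI real_norm_def)
  have "\<bar>p x\<bar> \<le> \<bar>B\<bar>" for x
  proof (cases "p x = 0")
    case False
    then have "x \<in> ?K" using closure_subset by fastforce
    then show ?thesis using B[of x] by simp
  qed simp
  then show ?thesis using that[of "\<bar>B\<bar>"] by simp
qed

text \<open>Bounds on the partial derivatives bound the operator norm of the derivative, and the
  mean value inequality applies on a convex set. The set is a parameter because test functions are
  treated on the whole space, but a boundary graph function only on a ball.\<close>

lemma Cinf_lipschitz_on_convex:
  fixes p :: "'a::euclidean_space \<Rightarrow> real"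
  assumes p: "Cinf_on UNIV p" and "convex S"
    and bd: "\<And>b. b \<in> Basis \<Longrightarrow> \<exists>B. \<forall>x\<in>S. \<bar>frechet_derivative p (at x) b\<bar> \<le> B"
  obtains L where "0 \<le> L" "\<And>x y. x \<in> S \<Longrightarrow> y \<in> S \<Longrightarrow> \<bar>p x - p y\<bar> \<le> L * norm (x - y)"
proof -
  obtain B where B: "\<And>b x. b \<in> Basis \<Longrightarrow> x \<in> S \<Longrightarrow> \<bar>frechet_derivative p (at x) b\<bar> \<le> B b"
    using bd by metis
  define L where "L = (\<Sum>b\<in>Basis. \<bar>B b\<bar>)"
  have d: "(p has_derivative frechet_derivative p (at x)) (at x)" for x
    using Cinf_on_has_derivative[OF p] by simp
  have on: "onorm (frechet_derivative p (at x)) \<le> L" if "x \<in> S" for x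
  proof (rule onorm_bound)
    show "0 \<le> L" by (simp add: L_def sum_nonneg)
    fix v :: 'a
    have lin: "linear (frechet_derivative p (at x))" using d has_derivative_linear by blast
    have "frechet_derivative p (at x) v =
        (\<Sum>b\<in>Basis. (v \<bullet> b) * frechet_derivative p (at x) b)"
      by (subst euclidean_representation[of v, symmetric])
        (simp add: linear_sum[OF lin] linear_scale[OF lin] inner_sum_left)
    also have "norm \<dots> \<le> (\<Sum>b\<in>Basis. norm v * \<bar>B b\<bar>)"
      by (rule order_trans[OF norm_sum], rule sum_mono)
        (use B[OF _ that] Basis_le_norm in \<open>force simp: abs_mult intro!: mult_mono\<close>)
    finally show "norm (frechet_derivative p (at x) v) \<le> L * norm v"
      by (simp add: L_def sum_distrib_left mult.commute)
  qed
  show ?thesis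
  proof (rule that[of L])
    show "0 \<le> L" by (simp add: L_def sum_nonneg)
    fix x y assume "x \<in> S" "y \<in> S"
    then show "\<bar>p x - p y\<bar> \<le> L * norm (x - y)"
      using differentiable_bound[OF \<open>convex S\<close> has_derivative_at_withinI[OF d] on, of x y] by simp
  qed
qed

lemma Cinf_compact_support_lipschitz:
  assumes "Cinf_compact_support U p"
  obtains L where "0 \<le> L" "\<And>x y. \<bar>p x - p y\<bar> \<le> L * norm (x - y)"
proof -
  have "\<exists>B. \<forall>x\<in>UNIV. \<bar>frechet_derivative p (at x) b\<bar> \<le> B" for b
    using Cinf_compact_support_bounded[OF Cinf_compact_support_frechet_derivative[OF assms]] by metis
  then obtain L where "0 \<le> L" "\<And>x y. x \<in> UNIV \<Longrightarrow> y \<in> UNIV \<Longrightarrow> \<bar>p x - p y\<bar> \<le> L * norm (x - y)"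
    using Cinf_lipschitz_on_convex[OF _ convex_UNIV, of p] assms
    unfolding Cinf_compact_support_def by metis
  then show ?thesis using that by simp
qed

text \<open>The partial derivatives are again test functions, hence Lipschitz. The mean value
  theorem on the segment from \<open>x\<close> to \<open>x + h\<close> compares the increment with
  the derivative at an intermediate point, at distance at most \<open>norm h\<close>. The constant
  is uniform in \<open>x\<close>.\<close>

lemma Cinf_compact_support_taylor:
  fixes p :: "'a::euclidean_space \<Rightarrow> real"
  assumes p: "Cinf_compact_support U p"
  obtains C where "0 \<le> C"
    "\<And>x h. \<bar>p (x + h) - p x - frechet_derivative p (at x) h\<bar> \<le> C * (norm h)\<^sup>2"
proof -
  let ?D = "\<lambda>x. frechet_derivative p (at x)"
  have "\<exists>L. 0 \<le> L \<and> (\<forall>x y. \<bar>?D x b - ?D y b\<bar> \<le> L * norm (x - y))" for b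
    using Cinf_compact_support_lipschitz[OF Cinf_compact_support_frechet_derivative[OF p, of b]]
    by metis
  then obtain L where L0: "\<And>b. 0 \<le> L b" and L: "\<And>b x y. \<bar>?D x b - ?D y b\<bar> \<le> L b * norm (x - y)"
    by metis
  define C where "C = (\<Sum>b\<in>Basis. L b)"
  have d: "(p has_derivative ?D x) (at x)" for x
    using p Cinf_on_has_derivative by (auto simp: Cinf_compact_support_def)
  have C: "\<bar>?D x h - ?D y h\<bar> \<le> C * norm (x - y) * norm h" for x y h
  proof -
    have lin: "linear (?D x)" for x using d has_derivative_linear by blast
    have e: "?D x h = (\<Sum>b\<in>Basis. (h \<bullet> b) * ?D x b)" for x
      by (subst euclidean_representation[of h, symmetric])
        (simp add: linear_sum[OF lin] linear_scale[OF lin] inner_sum_left)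
    have "?D x h - ?D y h = (\<Sum>b\<in>Basis. (h \<bullet> b) * (?D x b - ?D y b))"
      unfolding e by (simp add: sum_subtractf right_diff_distrib)
    also have "\<bar>\<dots>\<bar> \<le> (\<Sum>b\<in>Basis. norm h * (L b * norm (x - y)))"
      by (rule order_trans[OF sum_abs], rule sum_mono)
        (use L Basis_le_norm in \<open>force simp: abs_mult intro!: mult_mono\<close>)
    finally show ?thesis by (simp add: C_def sum_distrib_left sum_distrib_right mult_ac)
  qed
  have C0: "0 \<le> C" using L0 by (simp add: C_def sum_nonneg)
  show ?thesis
  proof (rule that[OF C0])
    fix x h :: 'a
    have "((\<lambda>t. p (x + t *\<^sub>R h)) has_derivative (\<lambda>r. ?D (x + t *\<^sub>R h) (r *\<^sub>R h))) (at t within T)" for t T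
      by (rule has_derivative_compose[where f="\<lambda>t. x + t *\<^sub>R h", OF _ d])
        (auto intro!: derivative_eq_intros)
    then have "\<exists>t\<in>{0<..<1}. p (x + 1 *\<^sub>R h) - p (x + 0 *\<^sub>R h) = ?D (x + t *\<^sub>R h) ((1 - 0) *\<^sub>R h)"
      by (intro mvt_simple) auto
    then obtain t where t: "0 < t" "t < 1" and e: "p (x + h) - p x = ?D (x + t *\<^sub>R h) h" by auto
    have "\<bar>?D (x + t *\<^sub>R h) h - ?D x h\<bar> \<le> C * norm ((x + t *\<^sub>R h) - x) * norm h" by (rule C)
    also have "\<dots> \<le> C * norm h * norm h"
      using t C0 by (intro mult_right_mono mult_left_mono) (auto simp: mult_left_le_one_le)
    finally show "\<bar>p (x + h) - p x - ?D x h\<bar> \<le> C * (norm h)\<^sup>2"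
      using e by (simp add: power2_eq_square mult.assoc)
  qed
qed

section \<open>Mollifiers and convolution\<close>

lemma exists_smooth_mollifier:
  fixes z :: "'a::euclidean_space"
  assumes "0 < \<delta>"
  obtains \<rho> where "Cinf_compact_support UNIV \<rho>" "\<And>x. 0 \<le> \<rho> x" "\<And>x. x \<notin> cball z \<delta> \<Longrightarrow> \<rho> x = 0"
    "integrable lborel \<rho>" "integral\<^sup>L lborel \<rho> = 1"
proof -
  \<comment> \<open>The argument is \<open>\<delta>\<^sup>2 - (dist z x)\<^sup>2\<close>, expanded
    so that it is visibly built from the generators of \<open>smooth_alg\<close>.\<close>
  define r where "r = (\<lambda>x::'a. exp_inv 0 (\<delta>\<^sup>2 + ((- 1) * (x \<bullet> x) + (x \<bullet> (2 *\<^sub>R z) + - (z \<bullet> z)))))"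
  have r: "r x = exp_inv 0 (\<delta>\<^sup>2 - (dist z x)\<^sup>2)" for x
    by (simp add: r_def dist_norm power2_norm_eq_inner inner_diff_left inner_diff_right inner_commute
        algebra_simps)
  have pos: "0 < r x \<longleftrightarrow> x \<in> ball z \<delta>" for x
    using \<open>0 < \<delta>\<close> by (auto simp: r exp_inv_0_pos intro: power2_less_imp_less power_strict_mono)
  have nn: "0 \<le> r x" for x by (simp add: r_def exp_inv_nonneg)
  have smooth: "(\<lambda>x. k * r x) \<in> smooth_alg" for k unfolding r_def by (intro smooth_alg.intros)
  have zero: "r x = 0" if "x \<notin> ball z \<delta>" for x using pos[of x] nn[of x] that by auto
  have cont: "continuous_on UNIV r"
    using Cinf_on_continuous_on[OF smooth_alg_Cinf[OF smooth[of 1]]] by simp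
  have int: "integrable lborel r"
  proof -
    have "integrable lborel (\<lambda>x. indicator (cball z \<delta>) x *\<^sub>R r x)"
      by (rule borel_integrable_compact) (auto intro: continuous_on_subset[OF cont])
    also have "(\<lambda>x. indicator (cball z \<delta>) x *\<^sub>R r x) = r"
      by (auto simp: fun_eq_iff indicator_def zero)
    finally show ?thesis .
  qed
  define m where "m = integral\<^sup>L lborel r"
  have "m \<noteq> 0"
  proof
    assume "m = 0"
    then have "AE x in lborel. r x = 0"
      using integral_nonneg_eq_0_iff_AE[OF int] nn by (simp add: m_def)
    then have "AE x in lborel. x \<notin> ball z \<delta>" by eventually_elim (use pos in force)
    then have "ball z \<delta> \<in> null_sets lborel"
      by (subst AE_iff_null_sets) auto
    then have "negligible (ball z \<delta>)"
      by (simp add: negligible_iff_null_sets null_sets_completionI)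
    then show False using \<open>0 < \<delta>\<close> open_not_negligible[of "ball z \<delta>"] by simp
  qed
  moreover have "0 \<le> m" unfolding m_def by (rule Bochner_Integration.integral_nonneg) (simp add: nn)
  ultimately have "0 < m" by simp
  define \<rho> where "\<rho> = (\<lambda>x. (1 / m) * r x)"
  have "Cinf_on UNIV \<rho>" unfolding \<rho>_def by (intro smooth_alg_Cinf smooth)
  then have "Cinf_compact_support UNIV \<rho>"
    by (rule Cinf_compact_supportI[where K="cball z \<delta>"]) (use zero in \<open>auto simp: \<rho>_def\<close>)
  then show ?thesis
  proof (rule that)
    show "integrable lborel \<rho>" unfolding \<rho>_def using int by simp
    show "integral\<^sup>L lborel \<rho> = 1" using \<open>m \<noteq> 0\<close> by (simp add: \<rho>_def m_def)
  qed (use nn \<open>0 < m\<close> zero in \<open>auto simp: \<rho>_def\<close>)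
qed

text \<open>Every derivative falls on the smooth factor, so an induction that quantifies over all
  test functions gives every order. Differentiation under the integral is direct: the Taylor
  remainder is at most \<open>C (norm h)\<^sup>2\<close> uniformly in the base point, and integrates
  against \<open>|k|\<close>.\<close>

lemma Cinf_compact_support_convolution:
  fixes \<rho> k :: "'a::euclidean_space \<Rightarrow> real"
  assumes \<rho>: "Cinf_compact_support UNIV \<rho>" and k: "integrable lborel k"
  shows "Cinf_on UNIV (\<lambda>x. \<integral>y. \<rho> (x - y) * k y \<partial>lborel)"
proof -
  have meas: "q \<in> borel_measurable borel" if "Cinf_compact_support UNIV q" for q :: "'a \<Rightarrow> real"
    using that by (auto simp: Cinf_compact_support_def dest!: Cinf_on_continuous_on intro: borel_measurable_continuous_onI)
  have [measurable]: "k \<in> borel_measurable borel" using k by auto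
  have int: "integrable lborel (\<lambda>y. q (x - y) * k y)" if q: "Cinf_compact_support UNIV q"
    for q :: "'a \<Rightarrow> real" and x
  proof -
    obtain B where B: "\<And>x. \<bar>q x\<bar> \<le> B" using Cinf_compact_support_bounded[OF q] by blast
    note [measurable] = meas[OF q]
    show ?thesis
      by (rule Bochner_Integration.integrable_bound[OF integrable_mult_right[OF k, of B]])
        (use B order_trans[OF abs_ge_zero B] in \<open>auto simp: abs_mult intro!: mult_right_mono\<close>)
  qed
  have der: "((\<lambda>x. \<integral>y. q (x - y) * k y \<partial>lborel) has_derivative
      (\<lambda>h. \<integral>y. frechet_derivative q (at (x - y)) h * k y \<partial>lborel)) (at x)"
    if q: "Cinf_compact_support UNIV q" for q :: "'a \<Rightarrow> real" and x
  proof -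
    let ?D = "\<lambda>x. frechet_derivative q (at x)"
    let ?L = "\<lambda>h. \<integral>y. ?D (x - y) h * k y \<partial>lborel"
    have d: "(q has_derivative ?D x) (at x)" for x
      using q Cinf_on_has_derivative by (auto simp: Cinf_compact_support_def)
    have lin: "linear (?D x)" for x using d has_derivative_linear by blast
    note iD = int[OF Cinf_compact_support_frechet_derivative[OF q]]
    obtain C where C: "0 \<le> C" "\<And>x h. \<bar>q (x + h) - q x - ?D x h\<bar> \<le> C * (norm h)\<^sup>2"
      using Cinf_compact_support_taylor[OF q] by blast
    define M where "M = C * (\<integral>y. \<bar>k y\<bar> \<partial>lborel)"
    have M0: "0 \<le> M" unfolding M_def using C(1) by (intro mult_nonneg_nonneg) auto
    have est: "\<bar>(\<integral>y. q (x + h - y) * k y \<partial>lborel) - (\<integral>y. q (x - y) * k y \<partial>lborel) - ?L h\<bar>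
        \<le> M * (norm h)\<^sup>2" for h
    proof -
      have eq: "(\<integral>y. q (x + h - y) * k y \<partial>lborel) - (\<integral>y. q (x - y) * k y \<partial>lborel) - ?L h =
          (\<integral>y. (q (x + h - y) - q (x - y) - ?D (x - y) h) * k y \<partial>lborel)"
        using int[OF q, of "x + h"] int[OF q, of x] iD[of x h] by (simp add: left_diff_distrib)
      have "norm (\<integral>y. (q (x + h - y) - q (x - y) - ?D (x - y) h) * k y \<partial>lborel)
          \<le> (\<integral>y. norm ((q (x + h - y) - q (x - y) - ?D (x - y) h) * k y) \<partial>lborel)"
        by (rule integral_norm_bound)
      also have "\<dots> \<le> (\<integral>y. C * (norm h)\<^sup>2 * \<bar>k y\<bar> \<partial>lborel)"
      proof (rule integral_mono)
        show "integrable lborel (\<lambda>y. norm ((q (x + h - y) - q (x - y) - ?D (x - y) h) * k y))"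
          using int[OF q, of "x + h"] int[OF q, of x] iD[of x h]
          by (intro integrable_norm) (simp add: left_diff_distrib)
        show "integrable lborel (\<lambda>y. C * (norm h)\<^sup>2 * \<bar>k y\<bar>)" using k by simp
        show "norm ((q (x + h - y) - q (x - y) - ?D (x - y) h) * k y) \<le> C * (norm h)\<^sup>2 * \<bar>k y\<bar>" for y
          using C(2)[of "x - y" h] by (auto simp: abs_mult diff_add_eq intro!: mult_right_mono)
      qed
      finally show ?thesis unfolding eq by (simp add: M_def mult_ac)
    qed
    have bl: "bounded_linear ?L"
    proof (rule linear_conv_bounded_linear[THEN iffD1], rule linearI)
      show "?L (a + b) = ?L a + ?L b" for a b
        using iD[of x a] iD[of x b] by (simp add: linear_add[OF lin] distrib_right)
      show "?L (c *\<^sub>R a) = c *\<^sub>R ?L a" for c a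
        by (simp add: linear_scale[OF lin] mult.assoc)
    qed
    show ?thesis
    proof (rule has_derivativeI_sandwich[of 1, OF _ bl])
      fix y assume "y \<noteq> x" "dist y x < 1"
      then show "norm ((\<integral>z. q (y - z) * k z \<partial>lborel) - (\<integral>z. q (x - z) * k z \<partial>lborel) - ?L (y - x))
          / norm (y - x) \<le> M * norm (y - x)"
        using est[of "y - x"] by (simp add: power2_eq_square pos_divide_le_eq mult.assoc)
    next
      show "((\<lambda>y. M * norm (y - x)) \<longlongrightarrow> 0) (at x)"
        by (auto intro!: tendsto_eq_intros)
    qed simp
  qed
  have "\<forall>q::'a \<Rightarrow> real. Cinf_compact_support UNIV q \<longrightarrow>
      Ck_on n UNIV (\<lambda>x. \<integral>y. q (x - y) * k y \<partial>lborel)" for n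
  proof (induction n)
    case 0
    show ?case
      using has_derivative_continuous[OF der] by (simp add: continuous_at_imp_continuous_on)
  next
    case (Suc n)
    show ?case
    proof (intro allI impI)
      fix q :: "'a \<Rightarrow> real" assume q: "Cinf_compact_support UNIV q"
      have "frechet_derivative (\<lambda>x. \<integral>y. q (x - y) * k y \<partial>lborel) (at x) =
          (\<lambda>h. \<integral>y. frechet_derivative q (at (x - y)) h * k y \<partial>lborel)" for x
        using frechet_derivative_at[OF der[OF q]] by simp
      then show "Ck_on (Suc n) UNIV (\<lambda>x. \<integral>y. q (x - y) * k y \<partial>lborel)"
        using der[OF q] Suc Cinf_compact_support_frechet_derivative[OF q]
        by (auto simp: differentiable_def)
    qed
  qed
  with \<rho> show ?thesis by (simp add: Cinf_on_def)
qed

section \<open>Continuity of translations\<close>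

lemma nn_integral_lborel_affine:
  fixes t :: "'a::euclidean_space"
  assumes [measurable]: "f \<in> borel_measurable borel" and "c \<noteq> 0"
  shows "(\<integral>\<^sup>+x. f x \<partial>lborel) = \<bar>c\<bar> ^ DIM('a) * (\<integral>\<^sup>+x. f (t + c *\<^sub>R x) \<partial>lborel)"
  by (subst lborel_affine[OF \<open>c \<noteq> 0\<close>, of t])
    (simp add: nn_integral_density nn_integral_distr nn_integral_cmult ennreal_power)

lemma nn_integral_lborel_translate:
  fixes t :: "'a::euclidean_space"
  assumes "f \<in> borel_measurable borel"
  shows "(\<integral>\<^sup>+x. f (x + t) \<partial>lborel) = (\<integral>\<^sup>+x. f x \<partial>lborel)"
  using nn_integral_lborel_affine[OF assms, of 1 t] by (simp add: add.commute)

lemma nn_integral_lborel_reflect: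
  fixes t :: "'a::euclidean_space"
  assumes "f \<in> borel_measurable borel"
  shows "(\<integral>\<^sup>+x. f (t - x) \<partial>lborel) = (\<integral>\<^sup>+x. f x \<partial>lborel)"
  using nn_integral_lborel_affine[OF assms, of "-1" t] by simp

text \<open>Continuity of translations in \<open>L^1\<close>, written with the nonnegative integral
  so that it makes sense without integrability of the differences. The shift is \<open>x - h\<close>
  because this is the form in which convolutions produce it.\<close>

definition translation_continuous :: "('a::euclidean_space \<Rightarrow> real) \<Rightarrow> bool" where
  "translation_continuous F \<longleftrightarrow> (\<forall>\<epsilon>>0. \<exists>\<delta>>0. \<forall>h. norm h < \<delta> \<longrightarrow>
     (\<integral>\<^sup>+x. \<bar>F (x - h) - F x\<bar> \<partial>lborel) \<le> ennreal \<epsilon>)"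

lemma nn_integral_lborel_translate_minus:
  fixes t :: "'a::euclidean_space"
  assumes "f \<in> borel_measurable borel"
  shows "(\<integral>\<^sup>+x. f (x - t) \<partial>lborel) = (\<integral>\<^sup>+x. f x \<partial>lborel)"
  using nn_integral_lborel_translate[OF assms, of "- t"] by simp

text \<open>An \<open>\<epsilon> / 3\<close> argument: translations preserve the \<open>L^1\<close>
  distance, so the property passes to \<open>L^1\<close> limits.\<close>

lemma translation_continuous_approx:
  fixes F :: "'a::euclidean_space \<Rightarrow> real"
  assumes [measurable]: "F \<in> borel_measurable borel"
    and approx: "\<And>\<epsilon>. 0 < \<epsilon> \<Longrightarrow> \<exists>G\<in>borel_measurable borel. translation_continuous G \<and>
      (\<integral>\<^sup>+x. \<bar>F x - G x\<bar> \<partial>lborel) \<le> ennreal \<epsilon>"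
  shows "translation_continuous F"
  unfolding translation_continuous_def
proof (intro allI impI)
  fix \<epsilon> :: real assume \<epsilon>: "0 < \<epsilon>"
  obtain G where [measurable]: "G \<in> borel_measurable borel" and "translation_continuous G"
    and FG: "(\<integral>\<^sup>+x. \<bar>F x - G x\<bar> \<partial>lborel) \<le> ennreal (\<epsilon> / 3)"
    using approx[of "\<epsilon> / 3"] \<epsilon> by auto
  then obtain \<delta> where \<delta>: "0 < \<delta>"
    "\<And>h. norm h < \<delta> \<Longrightarrow> (\<integral>\<^sup>+x. \<bar>G (x - h) - G x\<bar> \<partial>lborel) \<le> ennreal (\<epsilon> / 3)"
    using \<epsilon> unfolding translation_continuous_def by (metis zero_less_divide_iff zero_less_numeral)
  show "\<exists>\<delta>>0. \<forall>h. norm h < \<delta> \<longrightarrow> (\<integral>\<^sup>+x. \<bar>F (x - h) - F x\<bar> \<partial>lborel) \<le> ennreal \<epsilon>"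
  proof (intro exI conjI allI impI)
    fix h :: 'a assume h: "norm h < \<delta>"
    have "(\<integral>\<^sup>+x. \<bar>F (x - h) - F x\<bar> \<partial>lborel) \<le>
        (\<integral>\<^sup>+x. (ennreal \<bar>F (x - h) - G (x - h)\<bar> + (ennreal \<bar>G (x - h) - G x\<bar> + ennreal \<bar>F x - G x\<bar>)) \<partial>lborel)"
      by (intro nn_integral_mono) (simp flip: ennreal_plus)
    also have "\<dots> = (\<integral>\<^sup>+x. ennreal \<bar>F (x - h) - G (x - h)\<bar> \<partial>lborel) +
        ((\<integral>\<^sup>+x. ennreal \<bar>G (x - h) - G x\<bar> \<partial>lborel) + (\<integral>\<^sup>+x. ennreal \<bar>F x - G x\<bar> \<partial>lborel))"
      by (simp add: nn_integral_add)
    also have "(\<integral>\<^sup>+x. ennreal \<bar>F (x - h) - G (x - h)\<bar> \<partial>lborel) = (\<integral>\<^sup>+x. ennreal \<bar>F x - G x\<bar> \<partial>lborel)"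
      by (rule nn_integral_lborel_translate_minus[of "\<lambda>x. ennreal \<bar>F x - G x\<bar>"]) simp
    also have "(\<integral>\<^sup>+x. ennreal \<bar>F x - G x\<bar> \<partial>lborel) + ((\<integral>\<^sup>+x. ennreal \<bar>G (x - h) - G x\<bar> \<partial>lborel) +
        (\<integral>\<^sup>+x. ennreal \<bar>F x - G x\<bar> \<partial>lborel)) \<le> ennreal (\<epsilon> / 3) + (ennreal (\<epsilon> / 3) + ennreal (\<epsilon> / 3))"
      by (intro add_mono FG \<delta>(2) h)
    also have "\<dots> = ennreal \<epsilon>" using \<epsilon> by (simp flip: ennreal_plus)
    finally show "(\<integral>\<^sup>+x. \<bar>F (x - h) - F x\<bar> \<partial>lborel) \<le> ennreal \<epsilon>" .
  qed (rule \<delta>(1))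
qed

lemma translation_continuous_lipschitz:
  fixes F :: "'a::euclidean_space \<Rightarrow> real"
  assumes lip: "\<And>x y. \<bar>F x - F y\<bar> \<le> L * norm (x - y)" and supp: "\<And>x. x \<notin> ball 0 R \<Longrightarrow> F x = 0"
  shows "translation_continuous F"
  unfolding translation_continuous_def
proof (intro allI impI)
  fix \<epsilon> :: real assume \<epsilon>: "0 < \<epsilon>"
  define m where "m = measure lborel (ball (0::'a) (R + 1))"
  \<comment> \<open>The difference is at most \<open>(\<bar>L\<bar> + 1) * \<delta>\<close> and, as
    \<open>norm h < 1\<close>, lives in the ball of radius \<open>R + 1\<close>, whose measure is
    \<open>m\<close>. The summands 1 keep the denominator positive.\<close>
  define \<delta> where "\<delta> = min 1 (\<epsilon> / ((\<bar>L\<bar> + 1) * (m + 1)))"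
  have m0: "0 \<le> m" by (simp add: m_def)
  then have d: "0 < (\<bar>L\<bar> + 1) * (m + 1)" by (intro mult_pos_pos) auto
  show "\<exists>\<delta>>0. \<forall>h. norm h < \<delta> \<longrightarrow> (\<integral>\<^sup>+x. \<bar>F (x - h) - F x\<bar> \<partial>lborel) \<le> ennreal \<epsilon>"
  proof (intro exI conjI allI impI)
    show "0 < \<delta>" using \<epsilon> d by (simp add: \<delta>_def)
    fix h :: 'a assume h: "norm h < \<delta>"
    have le: "\<bar>F (x - h) - F x\<bar> \<le> (\<bar>L\<bar> + 1) * \<delta> * indicator (ball 0 (R + 1)) x" for x
    proof (cases "x \<in> ball 0 (R + 1)")
      case True
      have "\<bar>F (x - h) - F x\<bar> \<le> L * norm h" using lip[of "x - h" x] by simp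
      also have "\<dots> \<le> (\<bar>L\<bar> + 1) * \<delta>" using h by (intro mult_mono) auto
      finally show ?thesis using True by simp
    next
      case False
      have "norm h < 1" using h by (simp add: \<delta>_def)
      then have "x - h \<notin> ball 0 R" "x \<notin> ball 0 R"
        using False norm_triangle_ineq4[of x h] norm_triangle_ineq2[of x h] by auto
      then show ?thesis using supp False by simp
    qed
    have "(\<integral>\<^sup>+x. \<bar>F (x - h) - F x\<bar> \<partial>lborel) \<le>
        (\<integral>\<^sup>+x. ennreal ((\<bar>L\<bar> + 1) * \<delta>) * indicator (ball (0::'a) (R + 1)) x \<partial>lborel)"
    proof (rule nn_integral_mono)
      fix x :: 'a
      show "ennreal \<bar>F (x - h) - F x\<bar> \<le> ennreal ((\<bar>L\<bar> + 1) * \<delta>) * indicator (ball 0 (R + 1)) x"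
        using ennreal_leI[OF le[of x]] by (cases "x \<in> ball 0 (R + 1)") auto
    qed
    also have "\<dots> = ennreal ((\<bar>L\<bar> + 1) * \<delta>) * ennreal m"
      using emeasure_lborel_ball_finite[of "0::'a" "R + 1"]
      by (subst nn_integral_cmult_indicator) (auto simp: m_def emeasure_eq_ennreal_measure)
    also have "\<dots> = ennreal ((\<bar>L\<bar> + 1) * \<delta> * m)" using m0 by (simp add: ennreal_mult'')
    also have "\<dots> \<le> ennreal \<epsilon>"
    proof (rule ennreal_leI)
      have "\<delta> * ((\<bar>L\<bar> + 1) * (m + 1)) \<le> \<epsilon>"
        using d by (simp add: \<delta>_def pos_le_divide_eq[symmetric])
      moreover have "(\<bar>L\<bar> + 1) * \<delta> * m \<le> \<delta> * ((\<bar>L\<bar> + 1) * (m + 1))"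
        using \<open>0 < \<delta>\<close> by (simp add: algebra_simps)
      ultimately show "(\<bar>L\<bar> + 1) * \<delta> * m \<le> \<epsilon>" by linarith
    qed
    finally show "(\<integral>\<^sup>+x. \<bar>F (x - h) - F x\<bar> \<partial>lborel) \<le> ennreal \<epsilon>" .
  qed
qed

lemma translation_continuous_indicator_open:
  fixes U :: "'a::euclidean_space set"
  assumes U: "open U" and fin: "emeasure lborel U < \<infinity>"
  shows "translation_continuous (\<lambda>x. c * indicator U x)"
proof (rule translation_continuous_approx)
  have [measurable]: "U \<in> sets borel" using U by simp
  show "(\<lambda>x. c * indicator U x) \<in> borel_measurable borel" by simp
  fix \<epsilon> :: real assume \<epsilon>: "0 < \<epsilon>"
  \<comment> \<open>Lipschitz cutoffs that converge pointwise to the indicator of \<open>U\<close>.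
    Intersecting with a ball makes their support bounded even when \<open>U\<close> is not.\<close>
  define F where "F = (\<lambda>(k::nat) (x::'a). min 1 (k * infdist x (- (U \<inter> ball 0 k))))"
  have lip1: "\<bar>F k x - F k y\<bar> \<le> real k * norm (x - y)" for k x y
  proof -
    have "\<bar>F k x - F k y\<bar> \<le> \<bar>k * infdist x (- (U \<inter> ball 0 k)) - k * infdist y (- (U \<inter> ball 0 k))\<bar>"
      unfolding F_def by linarith
    also have "\<dots> = k * \<bar>infdist x (- (U \<inter> ball 0 k)) - infdist y (- (U \<inter> ball 0 k))\<bar>"
      by (simp add: abs_mult flip: right_diff_distrib)
    also have "\<dots> \<le> real k * norm (x - y)"
      by (intro mult_left_mono) (auto simp: infdist_triangle_abs simp flip: dist_norm)
    finally show ?thesis .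
  qed
  have [measurable]: "F k \<in> borel_measurable borel" for k
    unfolding F_def by (intro borel_measurable_continuous_onI continuous_intros)
  have F0: "F k x = 0" if "x \<notin> U \<inter> ball 0 k" for k x
    using that by (simp add: F_def)
  have F01: "0 \<le> F k x" "F k x \<le> 1" for k x by (auto simp: F_def infdist_nonneg)
  have lim: "(\<lambda>k. F k x) \<longlonglongrightarrow> indicator U x" for x
  proof (cases "x \<in> U")
    case True
    then obtain r where r: "0 < r" "ball x r \<subseteq> U" using U openE by blast
    obtain N :: nat where N: "norm x + r < N" "1 / r < N"
      using reals_Archimedean2[of "max (norm x + r) (1 / r)"] by auto
    have "F k x = 1" if k: "N \<le> k" for k
    proof -
      have sub: "ball x r \<subseteq> U \<inter> ball 0 k"
      proof
        fix y assume y: "y \<in> ball x r"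
        have "norm y \<le> norm x + dist x y" using norm_triangle_sub[of y x] by (simp add: dist_norm norm_minus_commute)
        also have "\<dots> < N" using y N(1) by simp
        also have "\<dots> \<le> k" using k by simp
        finally show "y \<in> U \<inter> ball 0 k" using y r(2) by auto
      qed
      \<comment> \<open>The distance to the empty set is 0 by convention, so the lower bound on
        \<open>infdist\<close> would fail if the complement were empty.\<close>
      have ne: "- (U \<inter> ball 0 (real k)) \<noteq> {}"
      proof
        assume "- (U \<inter> ball 0 (real k)) = {}"
        then have "(UNIV :: 'a set) \<subseteq> ball 0 (real k)" by auto
        then show False using bounded_subset[OF bounded_ball] not_bounded_UNIV by metis
      qed
      have "r \<le> infdist x (- (U \<inter> ball 0 k))"
        unfolding infdist_notempty[OF ne]
      proof (rule cINF_greatest[OF ne])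
        fix y assume "y \<in> - (U \<inter> ball 0 (real k))"
        then have "y \<notin> ball x r" using sub by blast
        then show "r \<le> dist x y" by simp
      qed
      then have "k * r \<le> k * infdist x (- (U \<inter> ball 0 k))" by (intro mult_left_mono) auto
      moreover have "1 \<le> k * r"
      proof -
        have "1 \<le> N * r" using N(2) r by (simp add: pos_divide_less_eq)
        also have "\<dots> \<le> k * r" using k r by (intro mult_right_mono) auto
        finally show ?thesis .
      qed
      ultimately show ?thesis by (simp add: F_def)
    qed
    then have "\<forall>\<^sub>F k in sequentially. F k x = indicator U x"
      using True by (auto simp: eventually_sequentially)
    then show ?thesis by (rule tendsto_eventually)
  next
    case False
    then show ?thesis by (simp add: F0)
  qed
  have "(\<lambda>k. \<integral>\<^sup>+x. ennreal \<bar>c * indicator U x - c * F k x\<bar> \<partial>lborel) \<longlonglongrightarrow> (\<integral>\<^sup>+x. (0::ennreal) \<partial>(lborel :: 'a measure))"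
  proof (rule nn_integral_dominated_convergence[where w="\<lambda>x. ennreal \<bar>c\<bar> * indicator U x"])
    show "AE x in lborel. ennreal \<bar>c * indicator U x - c * F k x\<bar> \<le> ennreal \<bar>c\<bar> * indicator U x" for k
    proof (rule AE_I2)
      fix x
      have "\<bar>indicator U x - F k x\<bar> \<le> indicator U x"
        using F01[of k x] F0[of x k] by (auto simp: indicator_def)
      then have "\<bar>c\<bar> * \<bar>indicator U x - F k x\<bar> \<le> \<bar>c\<bar> * indicator U x" by (intro mult_left_mono) auto
      then have "\<bar>c * indicator U x - c * F k x\<bar> \<le> \<bar>c\<bar> * indicator U x"
        by (simp add: abs_mult flip: right_diff_distrib)
      then show "ennreal \<bar>c * indicator U x - c * F k x\<bar> \<le> ennreal \<bar>c\<bar> * indicator U x"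
        by (cases "x \<in> U") (auto simp: ennreal_leI)
    qed
    show "(\<integral>\<^sup>+x. ennreal \<bar>c\<bar> * indicator U x \<partial>lborel) < \<infinity>"
      using fin by (simp add: nn_integral_cmult_indicator ennreal_mult_less_top)
    show "AE x in lborel. (\<lambda>k. ennreal \<bar>c * indicator U x - c * F k x\<bar>) \<longlonglongrightarrow> 0"
    proof (rule AE_I2)
      fix x
      have "(\<lambda>k. \<bar>c * indicator U x - c * F k x\<bar>) \<longlonglongrightarrow> \<bar>c * indicator U x - c * indicator U x\<bar>"
        by (intro tendsto_intros lim)
      then have "(\<lambda>k. ennreal \<bar>c * indicator U x - c * F k x\<bar>) \<longlonglongrightarrow> ennreal 0"
        by (intro tendsto_ennrealI) simp
      then show "(\<lambda>k. ennreal \<bar>c * indicator U x - c * F k x\<bar>) \<longlonglongrightarrow> 0" by simp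
    qed
  qed auto
  then have "\<forall>\<^sub>F k in sequentially. (\<integral>\<^sup>+x. ennreal \<bar>c * indicator U x - c * F k x\<bar> \<partial>lborel) < ennreal \<epsilon>"
    by (rule order_tendstoD) (use \<epsilon> in simp)
  then obtain k where k: "(\<integral>\<^sup>+x. ennreal \<bar>c * indicator U x - c * F k x\<bar> \<partial>lborel) < ennreal \<epsilon>"
    using eventually_sequentially by auto
  have "translation_continuous (\<lambda>x. c * F k x)"
  proof (rule translation_continuous_lipschitz)
    show "\<bar>c * F k x - c * F k y\<bar> \<le> \<bar>c\<bar> * real k * norm (x - y)" for x y
      using mult_left_mono[OF lip1[of k x y], of "\<bar>c\<bar>"] by (simp add: abs_mult mult.assoc flip: right_diff_distrib)
    show "c * F k x = 0" if "x \<notin> ball 0 (real k)" for x using that F0 by simp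
  qed
  then show "\<exists>G\<in>borel_measurable borel. translation_continuous G \<and>
      (\<integral>\<^sup>+x. \<bar>c * indicator U x - G x\<bar> \<partial>lborel) \<le> ennreal \<epsilon>"
    using k by (intro bexI[of _ "\<lambda>x. c * F k x"]) auto
qed

text \<open>Approximation in \<open>L^1\<close> at each stage: outer regularity passes from open
  sets to Borel sets, sums are split, and dominated convergence handles limits.\<close>

lemma translation_continuous_integrable:
  fixes F :: "'a::euclidean_space \<Rightarrow> real"
  assumes "integrable lborel F"
  shows "translation_continuous F"
  using assms
proof (induction rule: integrable_induct)
  case (base A c)
  show ?case
  proof (rule translation_continuous_approx)
    have [measurable]: "A \<in> sets borel" using base by simp
    show "(\<lambda>x. indicator A x *\<^sub>R c) \<in> borel_measurable borel" by simp
    fix \<epsilon> :: real assume \<epsilon>: "0 < \<epsilon>"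
    then have "0 < \<epsilon> / (\<bar>c\<bar> + 1)" by (simp add: add_nonneg_pos)
    then obtain U where U: "open U" "A \<subseteq> U" "emeasure lborel (U - A) < ennreal (\<epsilon> / (\<bar>c\<bar> + 1))"
      using outer_regular_lborel[of A] by auto
    have [measurable]: "U \<in> sets borel" using U by simp
    have "emeasure lborel U \<le> emeasure lborel A + emeasure lborel (U - A)"
      using emeasure_subadditive[of A lborel "U - A"] U(2) by (simp add: Un_absorb1)
    also have "\<dots> < \<infinity>" using base order_less_trans[OF U(3) ennreal_less_top] by simp
    finally have "translation_continuous (\<lambda>x. c * indicator U x)"
      by (intro translation_continuous_indicator_open U(1))
    moreover have "(\<integral>\<^sup>+x. ennreal \<bar>indicator A x *\<^sub>R c - c * indicator U x\<bar> \<partial>lborel) \<le> ennreal \<epsilon>"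
    proof -
      have "(\<integral>\<^sup>+x. ennreal \<bar>indicator A x *\<^sub>R c - c * indicator U x\<bar> \<partial>lborel) =
          (\<integral>\<^sup>+x. ennreal \<bar>c\<bar> * indicator (U - A) x \<partial>lborel)"
        using U(2) by (intro nn_integral_cong) (auto simp: indicator_def)
      also have "\<dots> = ennreal \<bar>c\<bar> * emeasure lborel (U - A)" by (simp add: nn_integral_cmult_indicator)
      also have "\<dots> \<le> ennreal \<bar>c\<bar> * ennreal (\<epsilon> / (\<bar>c\<bar> + 1))" using U(3) by (intro mult_left_mono) auto
      also have "\<dots> = ennreal (\<bar>c\<bar> * (\<epsilon> / (\<bar>c\<bar> + 1)))" by (rule ennreal_mult'[symmetric]) (use \<epsilon> in auto)
      also have "\<dots> \<le> ennreal \<epsilon>" using \<epsilon> by (intro ennreal_leI) (simp add: field_simps add_nonneg_pos)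
      finally show ?thesis .
    qed
    ultimately show "\<exists>G\<in>borel_measurable borel. translation_continuous G \<and>
      (\<integral>\<^sup>+x. \<bar>indicator A x *\<^sub>R c - G x\<bar> \<partial>lborel) \<le> ennreal \<epsilon>"
      by (intro bexI[of _ "\<lambda>x. c * indicator U x"]) auto
  qed
next
  case (add f g)
  have [measurable]: "f \<in> borel_measurable borel" "g \<in> borel_measurable borel" using add by auto
  show ?case unfolding translation_continuous_def
  proof (intro allI impI)
    fix \<epsilon> :: real assume \<epsilon>: "0 < \<epsilon>"
    obtain d where d: "0 < d" "\<And>h. norm h < d \<Longrightarrow> (\<integral>\<^sup>+x. \<bar>f (x - h) - f x\<bar> \<partial>lborel) \<le> ennreal (\<epsilon> / 2)"
      using add \<epsilon> unfolding translation_continuous_def by (metis half_gt_zero)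
    obtain d' where d': "0 < d'" "\<And>h. norm h < d' \<Longrightarrow> (\<integral>\<^sup>+x. \<bar>g (x - h) - g x\<bar> \<partial>lborel) \<le> ennreal (\<epsilon> / 2)"
      using add \<epsilon> unfolding translation_continuous_def by (metis half_gt_zero)
    show "\<exists>\<delta>>0. \<forall>h. norm h < \<delta> \<longrightarrow> (\<integral>\<^sup>+x. \<bar>f (x - h) + g (x - h) - (f x + g x)\<bar> \<partial>lborel) \<le> ennreal \<epsilon>"
    proof (intro exI conjI allI impI)
      fix h :: 'a assume h: "norm h < min d d'"
      have "(\<integral>\<^sup>+x. \<bar>f (x - h) + g (x - h) - (f x + g x)\<bar> \<partial>lborel) \<le>
          (\<integral>\<^sup>+x. ennreal \<bar>f (x - h) - f x\<bar> + ennreal \<bar>g (x - h) - g x\<bar> \<partial>lborel)"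
        by (intro nn_integral_mono) (simp flip: ennreal_plus)
      also have "\<dots> = (\<integral>\<^sup>+x. \<bar>f (x - h) - f x\<bar> \<partial>lborel) + (\<integral>\<^sup>+x. \<bar>g (x - h) - g x\<bar> \<partial>lborel)"
        by (simp add: nn_integral_add)
      also have "\<dots> \<le> ennreal (\<epsilon> / 2) + ennreal (\<epsilon> / 2)" using h by (intro add_mono d(2) d'(2)) auto
      also have "\<dots> = ennreal \<epsilon>" using \<epsilon> by (simp flip: ennreal_plus)
      finally show "(\<integral>\<^sup>+x. \<bar>f (x - h) + g (x - h) - (f x + g x)\<bar> \<partial>lborel) \<le> ennreal \<epsilon>" .
    qed (use d d' in auto)
  qed
next
  case (lim f t)
  have [measurable]: "f \<in> borel_measurable borel" "\<And>i. t i \<in> borel_measurable borel" using lim by auto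
  show ?case
  proof (rule translation_continuous_approx)
    fix \<epsilon> :: real assume \<epsilon>: "0 < \<epsilon>"
    have "(\<lambda>i. \<integral>\<^sup>+x. ennreal \<bar>f x - t i x\<bar> \<partial>lborel) \<longlonglongrightarrow> (\<integral>\<^sup>+x. (0::ennreal) \<partial>(lborel :: 'a measure))"
    \<comment> \<open>The induction principle supplies approximants bounded by
      \<open>2 * \<bar>f x\<bar>\<close>, so their distance to \<open>f\<close> is at most
      \<open>3 * \<bar>f x\<bar>\<close>.\<close>
    proof (rule nn_integral_dominated_convergence[where w="\<lambda>x. ennreal (3 * \<bar>f x\<bar>)"])
      show "AE x in lborel. ennreal \<bar>f x - t k x\<bar> \<le> ennreal (3 * \<bar>f x\<bar>)" for k
      proof (rule AE_I2)
        fix x show "ennreal \<bar>f x - t k x\<bar> \<le> ennreal (3 * \<bar>f x\<bar>)"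
          using lim(3)[of x k] by (intro ennreal_leI) (auto simp: abs_le_iff)
      qed
      show "(\<integral>\<^sup>+x. ennreal (3 * \<bar>f x\<bar>) \<partial>lborel) < \<infinity>"
        using lim(4) by (simp add: ennreal_mult' nn_integral_cmult ennreal_mult_less_top integrable_iff_bounded)
      show "AE x in lborel. (\<lambda>i. ennreal \<bar>f x - t i x\<bar>) \<longlonglongrightarrow> 0"
      proof (rule AE_I2)
        fix x
        have "(\<lambda>i. \<bar>f x - t i x\<bar>) \<longlonglongrightarrow> \<bar>f x - f x\<bar>" using lim(2)[of x] by (intro tendsto_intros) auto
        then have "(\<lambda>i. ennreal \<bar>f x - t i x\<bar>) \<longlonglongrightarrow> ennreal 0" by (intro tendsto_ennrealI) simp
        then show "(\<lambda>i. ennreal \<bar>f x - t i x\<bar>) \<longlonglongrightarrow> 0" by simp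
      qed
    qed auto
    then have "\<forall>\<^sub>F i in sequentially. (\<integral>\<^sup>+x. ennreal \<bar>f x - t i x\<bar> \<partial>lborel) < ennreal \<epsilon>"
      by (rule order_tendstoD) (use \<epsilon> in simp)
    then obtain i where "(\<integral>\<^sup>+x. ennreal \<bar>f x - t i x\<bar> \<partial>lborel) < ennreal \<epsilon>"
      using eventually_sequentially by auto
    then show "\<exists>G\<in>borel_measurable borel. translation_continuous G \<and> (\<integral>\<^sup>+x. \<bar>f x - G x\<bar> \<partial>lborel) \<le> ennreal \<epsilon>"
      using lim(5) by (intro bexI[of _ "t i"]) auto
  qed simp
qed

text \<open>Reduces \<open>L\<^sup>2\<close>-continuity of translations of \<open>F\<close> to \<open>L\<^sup>1\<close>-continuity for \<open>F \<bar>F\<bar>\<close>.\<close>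

lemma diff_sq_le_signed_sq:
  fixes a b :: real
  shows "(a - b)\<^sup>2 \<le> 2 * \<bar>a * \<bar>a\<bar> - b * \<bar>b\<bar>\<bar>"
proof -
  have *: "(a - b)\<^sup>2 \<le> 2 * \<bar>a * \<bar>a\<bar> - b * \<bar>b\<bar>\<bar>" if "\<bar>b\<bar> \<le> a" for a b :: real
  proof (cases "0 \<le> b")
    case True
    have "(a - b) * (a - b) \<le> 2 * ((a - b) * (a + b))" using that True
      by (subst mult.left_commute, intro mult_left_mono) auto
    moreover have "a * a - b * b = (a - b) * (a + b)" by (simp add: algebra_simps)
    ultimately show ?thesis using that True by (simp add: power2_eq_square)
  next
    case False
    have "(a - b) * (a - b) \<le> 2 * (a * a + b * b)"
      using zero_le_square[of "a + b"] by (simp add: algebra_simps)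
    then show ?thesis using that False by (simp add: power2_eq_square)
  qed
  have "\<bar>b\<bar> \<le> \<bar>a\<bar> \<or> \<bar>a\<bar> \<le> \<bar>b\<bar>" by (rule linear)
  \<comment> \<open>Both sides are invariant under exchanging \<open>a\<close> and \<open>b\<close>
    and under negating both, which reduces the last three cases to the first.\<close>
  then consider "\<bar>b\<bar> \<le> a" | "\<bar>b\<bar> \<le> - a" | "\<bar>a\<bar> \<le> b" | "\<bar>a\<bar> \<le> - b"
    by (metis abs_of_nonneg abs_of_nonpos linear)
  then show ?thesis
  proof cases
    case 2
    have "(- a) * \<bar>- a\<bar> - (- b) * \<bar>- b\<bar> = - (a * \<bar>a\<bar> - b * \<bar>b\<bar>)" by simp
    then show ?thesis using *[of "- b" "- a"] 2 by (simp only: abs_minus_cancel) (simp add: power2_commute)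
  next
    case 3
    then show ?thesis using *[of a b] by (simp add: power2_commute abs_minus_commute)
  next
    case 4
    have "(- b) * \<bar>- b\<bar> - (- a) * \<bar>- a\<bar> = a * \<bar>a\<bar> - b * \<bar>b\<bar>" by simp
    then show ?thesis using *[of "- a" "- b"] 4 by (simp only: abs_minus_cancel) (simp add: power2_commute)
  qed (rule *)
qed

lemma square_integrable_translation_continuous:
  fixes F :: "'a::euclidean_space \<Rightarrow> real"
  assumes [measurable]: "F \<in> borel_measurable borel" and int: "integrable lborel (\<lambda>x. (F x)\<^sup>2)" and "0 < \<epsilon>"
  obtains \<delta> where "0 < \<delta>" "\<And>h. norm h < \<delta> \<Longrightarrow> (\<integral>\<^sup>+x. ennreal ((F (x - h) - F x)\<^sup>2) \<partial>lborel) \<le> ennreal \<epsilon>"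
proof -
  define G where "G = (\<lambda>x. F x * \<bar>F x\<bar>)"
  have [measurable]: "G \<in> borel_measurable borel" unfolding G_def by measurable
  have "integrable lborel G"
    by (rule Bochner_Integration.integrable_bound[OF int]) (auto simp: G_def abs_mult power2_eq_square)
  then obtain \<delta> where \<delta>: "0 < \<delta>" "\<And>h. norm h < \<delta> \<Longrightarrow> (\<integral>\<^sup>+x. \<bar>G (x - h) - G x\<bar> \<partial>lborel) \<le> ennreal (\<epsilon> / 2)"
    using translation_continuous_integrable \<open>0 < \<epsilon>\<close> unfolding translation_continuous_def
    by (metis half_gt_zero)
  show ?thesis
  proof (rule that[OF \<delta>(1)])
    fix h :: 'a assume h: "norm h < \<delta>"
    have "(\<integral>\<^sup>+x. ennreal ((F (x - h) - F x)\<^sup>2) \<partial>lborel) \<le> (\<integral>\<^sup>+x. ennreal 2 * ennreal \<bar>G (x - h) - G x\<bar> \<partial>lborel)"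
    proof (rule nn_integral_mono)
      fix x
      show "ennreal ((F (x - h) - F x)\<^sup>2) \<le> ennreal 2 * ennreal \<bar>G (x - h) - G x\<bar>"
        using ennreal_leI[OF diff_sq_le_signed_sq[of "F (x - h)" "F x"]] by (simp add: G_def ennreal_mult')
    qed
    also have "\<dots> = ennreal 2 * (\<integral>\<^sup>+x. \<bar>G (x - h) - G x\<bar> \<partial>lborel)"
      by (rule nn_integral_cmult) simp
    also have "\<dots> \<le> ennreal 2 * ennreal (\<epsilon> / 2)" by (intro mult_left_mono \<delta>(2) h) simp
    also have "\<dots> = ennreal (2 * (\<epsilon> / 2))" by (rule ennreal_mult'[symmetric]) simp
    also have "\<dots> = ennreal \<epsilon>" by simp
    finally show "(\<integral>\<^sup>+x. ennreal ((F (x - h) - F x)\<^sup>2) \<partial>lborel) \<le> ennreal \<epsilon>" .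
  qed
qed

text \<open>Jensen's inequality for the square: the variance of \<open>G\<close> under the
  probability density \<open>\<rho>\<close> is nonnegative.\<close>

lemma weighted_mean_sq_le:
  fixes \<rho> G :: "'a \<Rightarrow> real"
  assumes \<rho>: "integrable M \<rho>" "\<And>h. 0 \<le> \<rho> h" "integral\<^sup>L M \<rho> = 1"
    and G: "G \<in> borel_measurable M" "integrable M (\<lambda>h. \<rho> h * G h)"
  shows "ennreal ((\<integral>h. \<rho> h * G h \<partial>M)\<^sup>2) \<le> (\<integral>\<^sup>+h. ennreal (\<rho> h * (G h)\<^sup>2) \<partial>M)"
proof (cases "(\<integral>\<^sup>+h. ennreal (\<rho> h * (G h)\<^sup>2) \<partial>M) = \<infinity>")
  case False
  define m where "m = (\<integral>h. \<rho> h * G h \<partial>M)"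
  have int: "integrable M (\<lambda>h. \<rho> h * (G h)\<^sup>2)"
    using False \<rho> G by (intro integrableI_nonneg) (auto simp: less_top)
  have "0 \<le> (\<integral>h. \<rho> h * (G h - m)\<^sup>2 \<partial>M)"
    by (rule Bochner_Integration.integral_nonneg) (use \<rho> in auto)
  also have "(\<lambda>h. \<rho> h * (G h - m)\<^sup>2) = (\<lambda>h. \<rho> h * (G h)\<^sup>2 - 2 * m * (\<rho> h * G h) + m\<^sup>2 * \<rho> h)"
    by (auto simp: fun_eq_iff power2_eq_square algebra_simps)
  also have "integral\<^sup>L M \<dots> = (\<integral>h. \<rho> h * (G h)\<^sup>2 \<partial>M) - 2 * m * m + m\<^sup>2"
    using int G \<rho> by (simp add: m_def)
  finally have "m\<^sup>2 \<le> (\<integral>h. \<rho> h * (G h)\<^sup>2 \<partial>M)" by (simp add: power2_eq_square)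
  then have "ennreal (m\<^sup>2) \<le> ennreal (\<integral>h. \<rho> h * (G h)\<^sup>2 \<partial>M)" by (rule ennreal_leI)
  also have "\<dots> = (\<integral>\<^sup>+h. ennreal (\<rho> h * (G h)\<^sup>2) \<partial>M)"
    by (rule nn_integral_eq_integral[symmetric, OF int]) (use \<rho> in auto)
  finally show ?thesis by (simp add: m_def)
qed simp

text \<open>Jensen inside, then Tonelli. The map \<open>J\<close> is the identity for the function
  itself and the diagonal \<open>h \<mapsto> (h, h)\<close> for its difference quotient on the
  product space, so that both parts of the energy are covered at once.\<close>

lemma nn_integral_averaged_translates_le:
  fixes F :: "'b::euclidean_space \<Rightarrow> real" and J :: "'a::euclidean_space \<Rightarrow> 'b"
  assumes [measurable]: "F \<in> borel_measurable borel" "J \<in> borel_measurable borel"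
    and \<rho>: "integrable lborel \<rho>" "\<And>h. 0 \<le> \<rho> h" "integral\<^sup>L lborel \<rho> = 1"
    and int: "\<And>p. integrable lborel (\<lambda>h. \<rho> h * F (p - J h))"
    and \<epsilon>: "\<And>h. \<rho> h \<noteq> 0 \<Longrightarrow> (\<integral>\<^sup>+p. ennreal ((F (p - J h) - F p)\<^sup>2) \<partial>lborel) \<le> \<epsilon>"
  shows "(\<integral>\<^sup>+p. ennreal (((\<integral>h. \<rho> h * F (p - J h) \<partial>lborel) - F p)\<^sup>2) \<partial>lborel) \<le> \<epsilon>"
proof -
  have [measurable]: "\<rho> \<in> borel_measurable borel" using \<rho>(1) by auto
  have "ennreal (((\<integral>h. \<rho> h * F (p - J h) \<partial>lborel) - F p)\<^sup>2) \<le>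
      (\<integral>\<^sup>+h. ennreal (\<rho> h * (F (p - J h) - F p)\<^sup>2) \<partial>lborel)" for p
  proof -
    have "(\<integral>h. \<rho> h * F (p - J h) \<partial>lborel) - F p = (\<integral>h. \<rho> h * (F (p - J h) - F p) \<partial>lborel)"
      using int[of p] \<rho> by (simp add: right_diff_distrib)
    moreover have "integrable lborel (\<lambda>h. \<rho> h * (F (p - J h) - F p))"
      using int[of p] \<rho> by (simp add: right_diff_distrib)
    ultimately show ?thesis using weighted_mean_sq_le[OF \<rho>, of "\<lambda>h. F (p - J h) - F p"] by simp
  qed
  then have "(\<integral>\<^sup>+p. ennreal (((\<integral>h. \<rho> h * F (p - J h) \<partial>lborel) - F p)\<^sup>2) \<partial>lborel) \<le>
      (\<integral>\<^sup>+p. (\<integral>\<^sup>+h. ennreal (\<rho> h * (F (p - J h) - F p)\<^sup>2) \<partial>lborel) \<partial>lborel)"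
    by (rule nn_integral_mono)
  also have "\<dots> = (\<integral>\<^sup>+h. (\<integral>\<^sup>+p. ennreal (\<rho> h * (F (p - J h) - F p)\<^sup>2) \<partial>lborel) \<partial>lborel)"
    by (rule lborel_pair.Fubini'[symmetric]) measurable
  also have "\<dots> = (\<integral>\<^sup>+h. ennreal (\<rho> h) * (\<integral>\<^sup>+p. ennreal ((F (p - J h) - F p)\<^sup>2) \<partial>lborel) \<partial>lborel)"
    using \<rho>(2) by (simp add: ennreal_mult' nn_integral_cmult)
  also have "\<dots> \<le> (\<integral>\<^sup>+h. ennreal (\<rho> h) * \<epsilon> \<partial>lborel)"
  proof (rule nn_integral_mono)
    fix h show "ennreal (\<rho> h) * (\<integral>\<^sup>+p. ennreal ((F (p - J h) - F p)\<^sup>2) \<partial>lborel) \<le> ennreal (\<rho> h) * \<epsilon>"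
      by (cases "\<rho> h = 0") (use \<epsilon>[of h] in \<open>auto intro: mult_left_mono\<close>)
  qed
  also have "\<dots> = (\<integral>\<^sup>+h. ennreal (\<rho> h) \<partial>lborel) * \<epsilon>" by (rule nn_integral_multc) simp
  also have "(\<integral>\<^sup>+h. ennreal (\<rho> h) \<partial>lborel) = 1"
    using nn_integral_eq_integral[OF \<rho>(1)] \<rho> by simp
  finally show ?thesis by simp
qed

section \<open>The energy space\<close>

text \<open>The common integrable majorant: squared increments of bounded Lipschitz functions and
  second differences of test functions are both at most a constant times
  \<open>min 1 ((norm h)\<^sup>2)\<close>.\<close>

definition sq_cap_kernel :: "real \<Rightarrow> 'a::euclidean_space \<Rightarrow> real" where
  "sq_cap_kernel s h = min 1 ((norm h)\<^sup>2) / norm h powr (real DIM('a) + 2 * s)"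

lemma sq_cap_kernel_nonneg: "0 \<le> sq_cap_kernel s h"
  by (simp add: sq_cap_kernel_def)

lemma sq_cap_kernel_measurable [measurable]: "sq_cap_kernel s \<in> borel_measurable borel"
  unfolding sq_cap_kernel_def by measurable

lemma sq_cap_kernel_minus [simp]: "sq_cap_kernel s (x - y) = sq_cap_kernel s (y - x)"
  by (simp add: sq_cap_kernel_def norm_minus_commute)

lemma exists_dyadic_ge_1:
  fixes r :: real
  assumes "1 \<le> r"
  obtains k :: nat where "2 ^ k \<le> r" "r < 2 ^ Suc k"
proof -
  define k where "k = (LEAST k. r < 2 ^ Suc k)"
  obtain m :: nat where "r < 2 ^ m" using real_arch_pow[of 2 r] by auto
  then have "r < 2 ^ Suc m" by (rule order_less_le_trans) simp
  then have 1: "r < 2 ^ Suc k" unfolding k_def by (rule LeastI)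
  have 2: "2 ^ k \<le> r"
  proof (cases k)
    case (Suc j)
    then have "\<not> r < 2 ^ Suc j" using not_less_Least[of j "\<lambda>k. r < 2 ^ Suc k"] by (simp add: k_def)
    then show ?thesis using Suc by simp
  qed (use assms in simp)
  show ?thesis by (rule that[OF 2 1])
qed

text \<open>Dyadic decomposition: the kernel is at most \<open>a k\<close> on the annulus \<open>2\<^sup>k \<le> |h| < 2\<^sup>k\<^sup>+\<^sup>1\<close>
  and at most \<open>b k\<close> on the annulus \<open>2\<^sup>-\<^sup>k\<^sup>-\<^sup>1 < |h| \<le> 2\<^sup>-\<^sup>k\<close>.\<close>

lemma nn_integral_sq_cap_kernel:
  assumes "0 < s" "s < 1"
  shows "(\<integral>\<^sup>+h. sq_cap_kernel s (h::'a::euclidean_space) \<partial>lborel) < \<infinity>"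
proof -
  let ?n = "DIM('a)" and ?p = "real DIM('a) + 2 * s" and ?\<omega> = "unit_ball_vol (real DIM('a))"
  define a where "a = (\<lambda>k::nat. 2 powr (- (real k * ?p)))"
  define b where "b = (\<lambda>k::nat. 2 powr (- (2 * real k)) * 2 powr ((real k + 1) * ?p))"
  \<comment> \<open>Balls replace annuli, since overcounting is harmless in an upper bound. The
    radius of \<open>?B k\<close> is doubled so that the points with
    \<open>norm h = 2 powr (- real k)\<close> lie inside the open ball.\<close>
  let ?A = "\<lambda>k::nat. ball (0::'a) (2 ^ Suc k)" and ?B = "\<lambda>k::nat. ball (0::'a) (2 powr (1 - real k))"
  have pos: "0 \<le> a k" "0 \<le> b k" for k by (simp_all add: a_def b_def)
  have [measurable]: "?A k \<in> sets borel" "?B k \<in> sets borel" for k by auto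
  have ge_term: "x k \<le> suminf x" for x :: "nat \<Rightarrow> ennreal" and k
    using sum_le_suminf[of x "{k}"] by simp
  have pointwise: "ennreal (sq_cap_kernel s h) \<le>
      (\<Sum>k. ennreal (a k) * indicator (?A k) h) + (\<Sum>k. ennreal (b k) * indicator (?B k) h)" for h
  proof -
    consider "h = 0" | "1 \<le> norm h" | "h \<noteq> 0" "norm h < 1" by linarith
    then show ?thesis
    proof cases
      case 1
      then show ?thesis by (simp add: sq_cap_kernel_def)
    next
      case 2
      then obtain k :: nat where k: "2 ^ k \<le> norm h" "norm h < 2 ^ Suc k"
        by (rule exists_dyadic_ge_1)
      have "2 powr (real k * ?p) \<le> norm h powr ?p"
        using k(1) assms by (simp flip: powr_powr add: powr_realpow powr_mono2)
      then have "sq_cap_kernel s h \<le> a k"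
        using 2 assms by (auto simp: sq_cap_kernel_def a_def powr_minus divide_simps)
      then have "ennreal (sq_cap_kernel s h) \<le> ennreal (a k) * indicator (?A k) h"
        using k(2) by (simp add: ennreal_leI)
      also have "\<dots> \<le> (\<Sum>k. ennreal (a k) * indicator (?A k) h)"
        by (rule ge_term)
      finally show ?thesis by (simp add: add_increasing2)
    next
      case 3
      then have "1 \<le> 1 / norm h" by simp
      then obtain k :: nat where k: "2 ^ k \<le> 1 / norm h" "1 / norm h < 2 ^ Suc k"
        by (rule exists_dyadic_ge_1)
      define r where "r = norm h"
      have r: "0 < r" "r < 1" using 3 by (auto simp: r_def)
      have k1: "2 powr (real k + 1) = 2 ^ Suc k" using powr_realpow[of 2 "Suc k"] by (simp add: add.commute)
      have 1: "r \<le> 2 powr (- real k)"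
        using k(1) r by (simp add: r_def powr_minus powr_realpow field_simps)
      have 2: "2 powr (- (real k + 1)) < r"
        unfolding powr_minus k1 using k(2) r by (simp add: r_def field_simps)
      have "r\<^sup>2 \<le> (2 powr (- real k))\<^sup>2" using 1 r by (intro power_mono) auto
      also have "\<dots> = 2 powr (- (2 * real k))" by (simp add: power2_eq_square flip: powr_add)
      finally have n: "r\<^sup>2 \<le> 2 powr (- (2 * real k))" .
      have "(2 powr (- (real k + 1))) powr ?p \<le> r powr ?p"
        using 2 assms by (intro powr_mono2) auto
      then have "1 / r powr ?p \<le> 1 / (2 powr (- (real k + 1))) powr ?p"
        using r by (intro divide_left_mono) auto
      also have "\<dots> = 2 powr ((real k + 1) * ?p)"
        by (subst powr_powr) (simp only: mult_minus_left powr_minus divide_inverse inverse_inverse_eq mult_1)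
      finally have d: "1 / r powr ?p \<le> 2 powr ((real k + 1) * ?p)" .
      have "sq_cap_kernel s h = r\<^sup>2 * (1 / r powr ?p)"
        using r power_le_one[of r 2] by (simp add: sq_cap_kernel_def r_def[symmetric] min_def)
      also have "\<dots> \<le> b k" unfolding b_def using n d by (intro mult_mono) auto
      finally have le: "sq_cap_kernel s h \<le> b k" .
      have "2 powr (- real k) < 2 powr (1 - real k)" by simp
      then have "norm h < 2 powr (1 - real k)" using 1 unfolding r_def by linarith
      then have "ennreal (sq_cap_kernel s h) \<le> ennreal (b k) * indicator (?B k) h"
        using le by (simp add: ennreal_leI)
      also have "\<dots> \<le> (\<Sum>k. ennreal (b k) * indicator (?B k) h)"
        by (rule ge_term)
      finally show ?thesis by (simp add: add_increasing)
    qed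
  qed
  have geometric: "(\<Sum>k. ennreal (C * q ^ k)) < \<infinity>" if "0 \<le> C" "0 \<le> q" "q < 1" for C q :: real
    using that by (subst suminf_ennreal2) (auto intro!: summable_mult summable_geometric)
  have "(\<integral>\<^sup>+h. sq_cap_kernel s (h::'a) \<partial>lborel) \<le> (\<integral>\<^sup>+h.
      ((\<Sum>k. ennreal (a k) * indicator (?A k) h) + (\<Sum>k. ennreal (b k) * indicator (?B k) h)) \<partial>lborel)"
    by (intro nn_integral_mono pointwise)
  also have "\<dots> = (\<integral>\<^sup>+h. (\<Sum>k. ennreal (a k) * indicator (?A k) h) \<partial>lborel) +
      (\<integral>\<^sup>+h. (\<Sum>k. ennreal (b k) * indicator (?B k) h) \<partial>lborel)"
    by (rule nn_integral_add) measurable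
  also have "\<dots> = (\<Sum>k. ennreal (a k) * emeasure lborel (?A k)) + (\<Sum>k. ennreal (b k) * emeasure lborel (?B k))"
    by (subst (1 2) nn_integral_suminf)
      (auto simp: nn_integral_cmult_indicator simp del: power_Suc intro!: borel_measurable_times_ennreal)
  also have "(\<lambda>k. ennreal (a k) * emeasure lborel (?A k)) = (\<lambda>k. ennreal (?\<omega> * 2 ^ ?n * (2 powr (- (2 * s))) ^ k))"
  proof
    fix k
    have "a k * (?\<omega> * (2 ^ Suc k) ^ ?n) = ?\<omega> * 2 ^ ?n * (2 powr (- (2 * s))) ^ k"
      by (simp add: a_def powr_realpow[symmetric] powr_powr algebra_simps flip: powr_add)
    then show "ennreal (a k) * emeasure lborel (?A k) = ennreal (?\<omega> * 2 ^ ?n * (2 powr (- (2 * s))) ^ k)"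
      using pos by (simp add: emeasure_ball ennreal_mult'[symmetric])
  qed
  also have "(\<lambda>k. ennreal (b k) * emeasure lborel (?B k)) =
      (\<lambda>k. ennreal (?\<omega> * 2 ^ ?n * 2 powr ?p * (2 powr (2 * s - 2)) ^ k))"
  proof
    fix k
    have "b k * (?\<omega> * (2 powr (1 - real k)) ^ ?n) = ?\<omega> * 2 ^ ?n * 2 powr ?p * (2 powr (2 * s - 2)) ^ k"
      by (simp add: b_def powr_realpow[symmetric] powr_powr algebra_simps flip: powr_add)
    then show "ennreal (b k) * emeasure lborel (?B k) =
        ennreal (?\<omega> * 2 ^ ?n * 2 powr ?p * (2 powr (2 * s - 2)) ^ k)"
      using pos by (simp add: emeasure_ball ennreal_mult'[symmetric])
  qed
  also have "(\<Sum>k. ennreal (?\<omega> * 2 ^ ?n * (2 powr (- (2 * s))) ^ k)) +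
      (\<Sum>k. ennreal (?\<omega> * 2 ^ ?n * 2 powr ?p * (2 powr (2 * s - 2)) ^ k)) < \<infinity>"
  proof -
    \<comment> \<open>The first ratio, at infinity, is below 1 because \<open>s > 0\<close>; the
      second, at the origin, because \<open>s < 1\<close>.\<close>
    have q: "2 powr (- (2 * s)) < 2 powr 0" "2 powr (2 * s - 2) < 2 powr 0"
      using assms by (intro powr_less_mono; simp)+
    have 1: "(\<Sum>k. ennreal (?\<omega> * 2 ^ ?n * (2 powr (- (2 * s))) ^ k)) < \<infinity>"
      by (rule geometric) (use q(1) in auto)
    have 2: "(\<Sum>k. ennreal (?\<omega> * 2 ^ ?n * 2 powr ?p * (2 powr (2 * s - 2)) ^ k)) < \<infinity>"
      by (rule geometric) (use q(2) in auto)
    show ?thesis using 1 2 unfolding infinity_ennreal_def ennreal_add_less_top by (rule conjI)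
  qed
  finally show ?thesis .
qed

section \<open>Square-integrable functions\<close>

definition sq_integrable :: "'a measure \<Rightarrow> ('a \<Rightarrow> real) \<Rightarrow> bool" where
  "sq_integrable M f \<longleftrightarrow> f \<in> borel_measurable M \<and> integrable M (\<lambda>x. (f x)\<^sup>2)"

lemma sq_integrable_measurable: "sq_integrable M f \<Longrightarrow> f \<in> borel_measurable M"
  by (simp add: sq_integrable_def)

lemma sq_integrable_integrable: "sq_integrable M f \<Longrightarrow> integrable M (\<lambda>x. (f x)\<^sup>2)"
  by (simp add: sq_integrable_def)

lemma sq_integrableI_bounded:
  assumes "f \<in> borel_measurable M" "(\<integral>\<^sup>+x. ennreal ((f x)\<^sup>2) \<partial>M) < \<infinity>"
  shows "sq_integrable M f"
  using assms by (simp add: sq_integrable_def integrable_iff_bounded)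

lemma sq_integrable_nn_integral:
  "sq_integrable M f \<Longrightarrow> (\<integral>\<^sup>+x. ennreal ((f x)\<^sup>2) \<partial>M) = ennreal (\<integral>x. (f x)\<^sup>2 \<partial>M)"
  by (intro nn_integral_eq_integral) (auto simp: sq_integrable_def)

lemma sq_integrable_bound:
  assumes "sq_integrable M g" "f \<in> borel_measurable M" "\<And>x. \<bar>f x\<bar> \<le> \<bar>g x\<bar>"
  shows "sq_integrable M f"
  using assms unfolding sq_integrable_def
  by (auto intro!: Bochner_Integration.integrable_bound[of M "\<lambda>x. (g x)\<^sup>2" "\<lambda>x. (f x)\<^sup>2"]
      simp: power2_le_iff_abs_le abs_le_square_iff)

lemma sq_integrable_mult:
  assumes "sq_integrable M f" "sq_integrable M g"
  shows "integrable M (\<lambda>x. f x * g x)"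
proof (rule Bochner_Integration.integrable_bound)
  note [measurable] = assms[THEN sq_integrable_measurable]
  show "integrable M (\<lambda>x. (f x)\<^sup>2 + (g x)\<^sup>2)" using assms by (simp add: sq_integrable_def)
  show "(\<lambda>x. f x * g x) \<in> borel_measurable M" by measurable
  show "AE x in M. norm (f x * g x) \<le> norm ((f x)\<^sup>2 + (g x)\<^sup>2)"
  proof (rule AE_I2)
    fix x
    have "2 * (\<bar>f x\<bar> * \<bar>g x\<bar>) \<le> (f x)\<^sup>2 + (g x)\<^sup>2"
      using sum_squares_bound[of "\<bar>f x\<bar>" "\<bar>g x\<bar>"] by simp
    moreover have "0 \<le> \<bar>f x\<bar> * \<bar>g x\<bar>" by simp
    ultimately have "\<bar>f x\<bar> * \<bar>g x\<bar> \<le> (f x)\<^sup>2 + (g x)\<^sup>2" by linarith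
    then show "norm (f x * g x) \<le> norm ((f x)\<^sup>2 + (g x)\<^sup>2)" by (simp add: abs_mult)
  qed
qed

lemma sq_integrable_add:
  assumes "sq_integrable M f" "sq_integrable M g"
  shows "sq_integrable M (\<lambda>x. f x + g x)"
proof -
  note [measurable] = assms[THEN sq_integrable_measurable]
  show ?thesis using assms[THEN sq_integrable_integrable] sq_integrable_mult[OF assms]
    by (simp add: sq_integrable_def power2_sum mult.assoc)
qed

lemma sq_integrable_cmult: "sq_integrable M f \<Longrightarrow> sq_integrable M (\<lambda>x. c * f x)"
  unfolding sq_integrable_def by (auto simp: power_mult_distrib)

lemma sq_integrable_diff:
  assumes "sq_integrable M f" "sq_integrable M g"
  shows "sq_integrable M (\<lambda>x. f x - g x)"
  using sq_integrable_add[OF assms(1) sq_integrable_cmult[OF assms(2), of "-1"]] by simp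

lemma integral_sq_add_le:
  assumes "sq_integrable M f" "sq_integrable M g"
  shows "(\<integral>x. (f x + g x)\<^sup>2 \<partial>M) \<le> 2 * (\<integral>x. (f x)\<^sup>2 \<partial>M) + 2 * (\<integral>x. (g x)\<^sup>2 \<partial>M)"
proof -
  have "(\<integral>x. (f x + g x)\<^sup>2 \<partial>M) \<le> (\<integral>x. 2 * (f x)\<^sup>2 + 2 * (g x)\<^sup>2 \<partial>M)"
  proof (rule Bochner_Integration.integral_mono)
    show "integrable M (\<lambda>x. (f x + g x)\<^sup>2)" using sq_integrable_add[OF assms] by (simp add: sq_integrable_def)
    show "integrable M (\<lambda>x. 2 * (f x)\<^sup>2 + 2 * (g x)\<^sup>2)" using assms by (simp add: sq_integrable_def)
    show "(f x + g x)\<^sup>2 \<le> 2 * (f x)\<^sup>2 + 2 * (g x)\<^sup>2" for x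
      using sum_squares_bound[of "f x" "g x"] by (simp add: power2_sum)
  qed
  also have "\<dots> = 2 * (\<integral>x. (f x)\<^sup>2 \<partial>M) + 2 * (\<integral>x. (g x)\<^sup>2 \<partial>M)"
    using assms by (simp add: sq_integrable_def)
  finally show ?thesis .
qed

section \<open>Difference quotients on the product space and the global energy\<close>

lemma borel_measurable_fst_pair [measurable]: "fst \<in> borel_measurable (borel :: ('a::euclidean_space \<times> 'b::euclidean_space) measure)"
  by (intro borel_measurable_continuous_onI continuous_intros)

lemma borel_measurable_snd_pair [measurable]: "snd \<in> borel_measurable (borel :: ('a::euclidean_space \<times> 'b::euclidean_space) measure)"
  by (intro borel_measurable_continuous_onI continuous_intros)

lemma nn_integral_lborel_pair:
  fixes f :: "'a::euclidean_space \<times> 'b::euclidean_space \<Rightarrow> ennreal"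
  assumes "f \<in> borel_measurable borel"
  shows "(\<integral>\<^sup>+p. f p \<partial>lborel) = (\<integral>\<^sup>+x. \<integral>\<^sup>+y. f (x, y) \<partial>lborel \<partial>lborel)"
    and "(\<integral>\<^sup>+p. f p \<partial>lborel) = (\<integral>\<^sup>+y. \<integral>\<^sup>+x. f (x, y) \<partial>lborel \<partial>lborel)"
  using lborel.nn_integral_fst[of f "lborel :: 'a measure"]
    lborel_pair.nn_integral_snd[where 'a='a and 'b='b, of f] assms
  by (simp_all add: lborel_prod)

text \<open>The exponent is half of \<open>real DIM('a) + 2 * s\<close>, so that the seminorm is an
  \<open>L^2\<close> norm and the energy form an \<open>L^2\<close> inner product on the product
  space. The quotient is 0 on the diagonal, as \<open>0 / 0 = 0\<close>.\<close>

definition gagliardo :: "real \<Rightarrow> ('a::euclidean_space \<Rightarrow> real) \<Rightarrow> 'a \<times> 'a \<Rightarrow> real" where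
  "gagliardo s w p = (w (fst p) - w (snd p)) / norm (fst p - snd p) powr (real DIM('a) / 2 + s)"

lemma gagliardo_measurable [measurable]:
  assumes [measurable]: "w \<in> borel_measurable borel"
  shows "gagliardo s w \<in> borel_measurable borel"
  unfolding gagliardo_def[abs_def] by measurable

lemma gagliardo_add: "gagliardo s (\<lambda>x. v x + w x) p = gagliardo s v p + gagliardo s w p"
  by (simp add: gagliardo_def add_divide_distrib[symmetric])

lemma gagliardo_diff: "gagliardo s (\<lambda>x. v x - w x) p = gagliardo s v p - gagliardo s w p"
  by (simp add: gagliardo_def diff_divide_distrib[symmetric])

lemma gagliardo_mult_gagliardo:
  fixes v w :: "'a::euclidean_space \<Rightarrow> real"
  shows "gagliardo s v p * gagliardo s w p =
    (v (fst p) - v (snd p)) * (w (fst p) - w (snd p)) / norm (fst p - snd p) powr (real DIM('a) + 2 * s)"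
proof -
  have "real DIM('a) / 2 + s + (real DIM('a) / 2 + s) = real DIM('a) + 2 * s" by simp
  then show ?thesis by (simp add: gagliardo_def flip: powr_add)
qed

lemma gagliardo_sq:
  fixes w :: "'a::euclidean_space \<Rightarrow> real"
  shows "(gagliardo s w p)\<^sup>2 = (w (fst p) - w (snd p))\<^sup>2 / norm (fst p - snd p) powr (real DIM('a) + 2 * s)"
  using gagliardo_mult_gagliardo[of s w p w] by (simp add: power2_eq_square)

text \<open>The space \<open>H^s\<close> of the whole space, for Borel functions. For functions
  vanishing outside \<open>\<Omega>\<close> the pairs left out of \<open>Hs_seminorm_sq\<close>
  contribute nothing, so the double integrals agree.\<close>

definition finite_energy :: "real \<Rightarrow> ('a::euclidean_space \<Rightarrow> real) \<Rightarrow> bool" where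
  "finite_energy s w \<longleftrightarrow> sq_integrable lborel w \<and> sq_integrable lborel (gagliardo s w)"

text \<open>The squared \<open>H^s\<close> norm, without the factor \<open>c / 2\<close>.\<close>

definition energy :: "real \<Rightarrow> ('a::euclidean_space \<Rightarrow> real) \<Rightarrow> real" where
  "energy s w = (\<integral>x. (w x)\<^sup>2 \<partial>lborel) + (\<integral>p. (gagliardo s w p)\<^sup>2 \<partial>lborel)"

lemma finite_energy_measurable: "finite_energy s w \<Longrightarrow> w \<in> borel_measurable borel"
  using sq_integrable_measurable[of lborel w] by (auto simp: finite_energy_def)

lemma finite_energy_diff:
  "finite_energy s v \<Longrightarrow> finite_energy s w \<Longrightarrow> finite_energy s (\<lambda>x. v x - w x)"
  by (auto simp: finite_energy_def gagliardo_diff[abs_def] intro: sq_integrable_diff)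

lemma energy_nonneg: "0 \<le> energy s w"
  unfolding energy_def by (intro add_nonneg_nonneg Bochner_Integration.integral_nonneg) auto

lemma energy_add_le:
  assumes "finite_energy s v" "finite_energy s w"
  shows "energy s (\<lambda>x. v x + w x) \<le> 2 * energy s v + 2 * energy s w"
  using integral_sq_add_le[of lborel v w] integral_sq_add_le[of lborel "gagliardo s v" "gagliardo s w"] assms
  by (simp add: finite_energy_def energy_def gagliardo_add)

text \<open>The energy space is stable under normal contractions; the positive part is the case of
  interest.\<close>

lemma finite_energy_bound:
  fixes w :: "'a::euclidean_space \<Rightarrow> real"
  assumes "finite_energy s v" and [measurable]: "w \<in> borel_measurable borel"
    and le: "\<And>x. \<bar>w x\<bar> \<le> \<bar>v x\<bar>" "\<And>x y. \<bar>w x - w y\<bar> \<le> \<bar>v x - v y\<bar>"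
  shows "finite_energy s w"
  unfolding finite_energy_def
proof
  show "sq_integrable lborel w"
    by (rule sq_integrable_bound[of _ v]) (use assms in \<open>auto simp: finite_energy_def\<close>)
  show "sq_integrable lborel (gagliardo s w)"
    by (rule sq_integrable_bound[of _ "gagliardo s v"])
      (use assms in \<open>auto simp: finite_energy_def gagliardo_def divide_right_mono\<close>)
qed

text \<open>Tonelli: integrating out the variable that the weight does not see gives the finite
  total mass of the kernel, by translation and reflection invariance.\<close>

lemma integrable_weighted_sq_cap_kernel:
  fixes a :: "'a::euclidean_space \<Rightarrow> real"
  assumes s: "0 < s" "s < 1" and a: "integrable lborel a"
  shows "integrable lborel (\<lambda>p. a (fst p) * sq_cap_kernel s (fst p - snd p))"
    and "integrable lborel (\<lambda>p. a (snd p) * sq_cap_kernel s (fst p - snd p))"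
proof -
  have [measurable]: "a \<in> borel_measurable borel" using a by auto
  define I where "I = (\<integral>\<^sup>+h. sq_cap_kernel s (h::'a) \<partial>lborel)"
  have I: "I < \<infinity>" using nn_integral_sq_cap_kernel[OF s] by (simp add: I_def)
  have fin: "(\<integral>\<^sup>+x. ennreal \<bar>a x\<bar> * I \<partial>lborel) < \<infinity>"
    using a I by (simp add: nn_integral_multc integrable_iff_bounded ennreal_mult_less_top)
  show "integrable lborel (\<lambda>p. a (fst p) * sq_cap_kernel s (fst p - snd p))"
  proof (rule integrableI_bounded)
    have "(\<integral>\<^sup>+p. ennreal (norm (a (fst p) * sq_cap_kernel s (fst p - snd p))) \<partial>lborel) =
        (\<integral>\<^sup>+x. \<integral>\<^sup>+y. ennreal \<bar>a x\<bar> * ennreal (sq_cap_kernel s (x - y)) \<partial>lborel \<partial>lborel)"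
      by (subst nn_integral_lborel_pair(1)) (auto simp: abs_mult ennreal_mult' sq_cap_kernel_nonneg)
    also have "\<dots> = (\<integral>\<^sup>+x. ennreal \<bar>a x\<bar> * I \<partial>lborel)"
      using nn_integral_lborel_reflect[of "\<lambda>h. ennreal (sq_cap_kernel s (h::'a))"]
      by (simp add: nn_integral_cmult I_def del: sq_cap_kernel_minus)
    finally show "(\<integral>\<^sup>+p. ennreal (norm (a (fst p) * sq_cap_kernel s (fst p - snd p))) \<partial>lborel) < \<infinity>"
      using fin by simp
  qed measurable
  show "integrable lborel (\<lambda>p. a (snd p) * sq_cap_kernel s (fst p - snd p))"
  proof (rule integrableI_bounded)
    have "(\<integral>\<^sup>+p. ennreal (norm (a (snd p) * sq_cap_kernel s (fst p - snd p))) \<partial>lborel) =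
        (\<integral>\<^sup>+y. \<integral>\<^sup>+x. ennreal \<bar>a y\<bar> * ennreal (sq_cap_kernel s (x - y)) \<partial>lborel \<partial>lborel)"
      by (subst nn_integral_lborel_pair(2)) (auto simp: abs_mult ennreal_mult' sq_cap_kernel_nonneg)
    also have "\<dots> = (\<integral>\<^sup>+x. ennreal \<bar>a x\<bar> * I \<partial>lborel)"
      using nn_integral_lborel_translate_minus[of "\<lambda>h. ennreal (sq_cap_kernel s (h::'a))"]
      by (simp add: nn_integral_cmult I_def del: sq_cap_kernel_minus)
    finally show "(\<integral>\<^sup>+p. ennreal (norm (a (snd p) * sq_cap_kernel s (fst p - snd p))) \<partial>lborel) < \<infinity>"
      using fin by simp
  qed measurable
qed

lemma bounded_lipschitz_sq_diff_le:
  fixes x y :: "'a::real_normed_vector"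
  assumes "\<bar>a\<bar> \<le> B" "\<bar>b\<bar> \<le> B" "\<bar>a - b\<bar> \<le> L * norm (x - y)"
  shows "(a - b)\<^sup>2 \<le> ((2 * B)\<^sup>2 + L\<^sup>2) * min 1 ((norm (x - y))\<^sup>2)"
proof -
  have "\<bar>a - b\<bar> \<le> 2 * B" using assms by linarith
  then have 1: "(a - b)\<^sup>2 \<le> (2 * B)\<^sup>2" by (metis abs_ge_zero power2_abs power_mono)
  have "\<bar>a - b\<bar>\<^sup>2 \<le> (L * norm (x - y))\<^sup>2" by (rule power_mono) (use assms in auto)
  then have 2: "(a - b)\<^sup>2 \<le> L\<^sup>2 * (norm (x - y))\<^sup>2" by (simp add: power_mult_distrib)
  show ?thesis
  proof (cases "(norm (x - y))\<^sup>2 \<le> 1")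
    case True
    have "L\<^sup>2 * (norm (x - y))\<^sup>2 \<le> ((2 * B)\<^sup>2 + L\<^sup>2) * (norm (x - y))\<^sup>2"
      by (intro mult_right_mono) auto
    then show ?thesis using 2 True by (simp add: min_def)
  next
    case False
    have "(a - b)\<^sup>2 \<le> (2 * B)\<^sup>2 + L\<^sup>2" using 1 zero_le_power2[of L] by linarith
    then show ?thesis using False by (simp add: min_def)
  qed
qed

text \<open>The increment of the product is
  \<open>\<eta> x * (w x - w y) + w y * (\<eta> x - \<eta> y)\<close>. The first term is controlled
  by the quotient of \<open>w\<close>; the square of the second, after division, by
  \<open>(w y)\<^sup>2\<close> times the integrable kernel.\<close>

lemma finite_energy_lipschitz_mult:
  fixes w \<eta> :: "'a::euclidean_space \<Rightarrow> real"
  assumes s: "0 < s" "s < 1" and w: "finite_energy s w"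
    and [measurable]: "\<eta> \<in> borel_measurable borel"
    and \<eta>: "\<And>x. \<bar>\<eta> x\<bar> \<le> 1" "\<And>x y. \<bar>\<eta> x - \<eta> y\<bar> \<le> L * norm (x - y)"
  shows "finite_energy s (\<lambda>x. \<eta> x * w x)"
  unfolding finite_energy_def
proof
  have [measurable]: "w \<in> borel_measurable borel" by (rule finite_energy_measurable[OF w])
  have w2: "sq_integrable lborel w" "sq_integrable lborel (gagliardo s w)"
    using w by (auto simp: finite_energy_def)
  show "sq_integrable lborel (\<lambda>x. \<eta> x * w x)"
    by (rule sq_integrable_bound[OF w2(1)]) (use \<eta>(1) in \<open>auto simp: abs_mult mult_left_le_one_le\<close>)
  have 1: "sq_integrable lborel (\<lambda>p. \<eta> (fst p) * gagliardo s w p)"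
    by (rule sq_integrable_bound[OF w2(2)]) (use \<eta>(1) in \<open>auto simp: abs_mult mult_left_le_one_le\<close>)
  define C where "C = (2 * 1)\<^sup>2 + L\<^sup>2"
  have C: "0 \<le> C" by (simp add: C_def)
  have 2: "sq_integrable lborel (\<lambda>p. w (snd p) * gagliardo s \<eta> p)"
    unfolding sq_integrable_def
  proof
    show "integrable lborel (\<lambda>p. (w (snd p) * gagliardo s \<eta> p)\<^sup>2)"
    proof (rule Bochner_Integration.integrable_bound)
      show "integrable lborel (\<lambda>p. C * ((w (snd p))\<^sup>2 * sq_cap_kernel s (fst p - snd p)))"
        using integrable_weighted_sq_cap_kernel(2)[OF s sq_integrable_integrable[OF w2(1)]] by simp
      show "AE p in lborel. norm ((w (snd p) * gagliardo s \<eta> p)\<^sup>2) \<le>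
          norm (C * ((w (snd p))\<^sup>2 * sq_cap_kernel s (fst p - snd p)))"
      proof (rule AE_I2)
        fix p :: "'a \<times> 'a"
        have "(\<eta> (fst p) - \<eta> (snd p))\<^sup>2 \<le> C * min 1 ((norm (fst p - snd p))\<^sup>2)"
          unfolding C_def by (rule bounded_lipschitz_sq_diff_le) (use \<eta> in auto)
        then have "(gagliardo s \<eta> p)\<^sup>2 \<le> C * sq_cap_kernel s (fst p - snd p)"
          unfolding gagliardo_sq sq_cap_kernel_def times_divide_eq_right by (rule divide_right_mono) simp
        then have "(w (snd p))\<^sup>2 * (gagliardo s \<eta> p)\<^sup>2 \<le> (w (snd p))\<^sup>2 * (C * sq_cap_kernel s (fst p - snd p))"
          by (intro mult_left_mono) auto
        then show "norm ((w (snd p) * gagliardo s \<eta> p)\<^sup>2) \<le>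
          norm (C * ((w (snd p))\<^sup>2 * sq_cap_kernel s (fst p - snd p)))"
          using C by (simp add: power_mult_distrib mult_ac abs_mult sq_cap_kernel_nonneg)
      qed
    qed measurable
  qed measurable
  have "gagliardo s (\<lambda>x. \<eta> x * w x) = (\<lambda>p. \<eta> (fst p) * gagliardo s w p + w (snd p) * gagliardo s \<eta> p)"
    by (rule ext) (simp add: gagliardo_def add_divide_distrib[symmetric] algebra_simps)
  then show "sq_integrable lborel (gagliardo s (\<lambda>x. \<eta> x * w x))"
    using sq_integrable_add[OF 1 2] by simp
qed

lemma Cinf_compact_support_measurable:
  "Cinf_compact_support U \<xi> \<Longrightarrow> \<xi> \<in> borel_measurable borel"
  by (auto simp: Cinf_compact_support_def dest!: Cinf_on_continuous_on intro: borel_measurable_continuous_onI)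

text \<open>The squared quotient is at most a multiple of the kernel and vanishes unless one of the
  two points lies in \<open>K\<close>. The indicator of \<open>K\<close> in either variable then
  provides the integrable weight.\<close>

lemma Cinf_compact_support_finite_energy:
  fixes \<xi> :: "'a::euclidean_space \<Rightarrow> real"
  assumes s: "0 < s" "s < 1" and \<xi>: "Cinf_compact_support U \<xi>"
  shows "finite_energy s \<xi>"
  unfolding finite_energy_def
proof
  note [measurable] = Cinf_compact_support_measurable[OF \<xi>]
  obtain K where K: "compact K" "\<And>x. x \<notin> K \<Longrightarrow> \<xi> x = 0" using \<xi> by (rule Cinf_compact_supportE) blast
  obtain B where B: "0 \<le> B" "\<And>x. \<bar>\<xi> x\<bar> \<le> B" using Cinf_compact_support_bounded[OF \<xi>] by metis
  obtain L where L: "\<And>x y. \<bar>\<xi> x - \<xi> y\<bar> \<le> L * norm (x - y)"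
    using Cinf_compact_support_lipschitz[OF \<xi>] by metis
  have [measurable]: "K \<in> sets borel" using K(1) by (simp add: borel_compact)
  have iK: "integrable lborel (indicator K :: 'a \<Rightarrow> real)"
    by (intro integrable_real_indicator emeasure_bounded_finite compact_imp_bounded K(1)) simp
  show "sq_integrable lborel \<xi>" unfolding sq_integrable_def
  proof
    show "integrable lborel (\<lambda>x. (\<xi> x)\<^sup>2)"
    proof (rule Bochner_Integration.integrable_bound)
      show "integrable lborel (\<lambda>x. B\<^sup>2 * indicator K x)" using iK by simp
      show "AE x in lborel. norm ((\<xi> x)\<^sup>2) \<le> norm (B\<^sup>2 * indicator K x)"
      proof (rule AE_I2)
        fix x
        have "\<bar>\<xi> x\<bar>\<^sup>2 \<le> B\<^sup>2" by (rule power_mono) (use B in auto)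
        then show "norm ((\<xi> x)\<^sup>2) \<le> norm (B\<^sup>2 * indicator K x)" using K(2)[of x] by (cases "x \<in> K") auto
      qed
    qed measurable
  qed measurable
  define C where "C = (2 * B)\<^sup>2 + L\<^sup>2"
  have C: "0 \<le> C" by (simp add: C_def)
  show "sq_integrable lborel (gagliardo s \<xi>)" unfolding sq_integrable_def
  proof
    show "integrable lborel (\<lambda>p. (gagliardo s \<xi> p)\<^sup>2)"
    proof (rule Bochner_Integration.integrable_bound)
      show "integrable lborel (\<lambda>p. C * (indicator K (fst p) * sq_cap_kernel s (fst p - snd p) +
          indicator K (snd p) * sq_cap_kernel s (fst p - snd p)))"
        using integrable_weighted_sq_cap_kernel[OF s iK] by simp
      show "AE p in lborel. norm ((gagliardo s \<xi> p)\<^sup>2) \<le> norm (C * (indicator K (fst p) *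
          sq_cap_kernel s (fst p - snd p) + indicator K (snd p) * sq_cap_kernel s (fst p - snd p)))"
      proof (rule AE_I2)
        fix p :: "'a \<times> 'a"
        have "(\<xi> (fst p) - \<xi> (snd p))\<^sup>2 \<le> C * min 1 ((norm (fst p - snd p))\<^sup>2)"
          unfolding C_def by (rule bounded_lipschitz_sq_diff_le) (use B L in auto)
        then have le: "(gagliardo s \<xi> p)\<^sup>2 \<le> C * sq_cap_kernel s (fst p - snd p)"
          unfolding gagliardo_sq sq_cap_kernel_def times_divide_eq_right by (rule divide_right_mono) simp
        have nn: "0 \<le> C * sq_cap_kernel s (fst p - snd p)" using C by (simp add: sq_cap_kernel_nonneg)
        show "norm ((gagliardo s \<xi> p)\<^sup>2) \<le> norm (C * (indicator K (fst p) *
          sq_cap_kernel s (fst p - snd p) + indicator K (snd p) * sq_cap_kernel s (fst p - snd p)))"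
        proof (cases "fst p \<in> K \<or> snd p \<in> K")
          case True
          then have "C * sq_cap_kernel s (fst p - snd p) \<le> C * (indicator K (fst p) *
            sq_cap_kernel s (fst p - snd p) + indicator K (snd p) * sq_cap_kernel s (fst p - snd p))"
            using C sq_cap_kernel_nonneg[of s "fst p - snd p"]
            by (intro mult_left_mono) (auto simp: indicator_def)
          then show ?thesis using le nn by simp
        next
          case False
          then show ?thesis using K(2) by (simp add: gagliardo_def)
        qed
      qed
    qed measurable
  qed measurable
qed

section \<open>Density of test functions in the energy space\<close>

lemma integral_lborel_reflect:
  fixes f :: "'a::euclidean_space \<Rightarrow> real"
  shows "(\<integral>y. f (x - y) \<partial>lborel) = (\<integral>y. f y \<partial>lborel)"
    and "integrable lborel (\<lambda>y. f (x - y)) \<longleftrightarrow> integrable lborel f"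
proof -
  have L: "(lborel :: 'a measure) = distr lborel borel (\<lambda>y. x - y)"
    using lborel_affine[of "-1" x] by (simp add: density_1)
  have inv: "(\<lambda>y. x - (x - y)) = (\<lambda>y. y)" by simp
  have imp: "integrable lborel (\<lambda>y. g (x - y))" if "integrable lborel g" for g :: "'a \<Rightarrow> real"
  proof -
    have "integrable (distr lborel borel (\<lambda>y. x - y)) g" using that L by simp
    then show ?thesis by (intro integrable_distr[where T="\<lambda>y. x - y"]) simp_all
  qed
  show iff: "integrable lborel (\<lambda>y. f (x - y)) \<longleftrightarrow> integrable lborel f"
    using imp[of f] imp[of "\<lambda>y. f (x - y)"] by auto
  show "(\<integral>y. f (x - y) \<partial>lborel) = (\<integral>y. f y \<partial>lborel)"
  proof (cases "integrable lborel f")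
    case True
    then have "f \<in> borel_measurable borel" by auto
    then have "(\<integral>y. f y \<partial>distr lborel borel (\<lambda>y. x - y)) = (\<integral>y. f (x - y) \<partial>lborel)"
      by (intro integral_distr) auto
    then show ?thesis unfolding L[symmetric] by simp
  next
    case False
    then show ?thesis using iff by (simp add: not_integrable_integral_eq)
  qed
qed

lemma sq_integrable_bounded_support_integrable:
  fixes w :: "'a::euclidean_space \<Rightarrow> real"
  assumes w: "sq_integrable lborel w" and A: "bounded A" "\<And>x. x \<notin> A \<Longrightarrow> w x = 0"
  shows "integrable lborel w"
proof -
  \<comment> \<open>\<open>A\<close> may fail to be measurable, so a ball containing it carries the
    bound \<open>\<bar>w x\<bar> \<le> (w x)\<^sup>2 + 1\<close>.\<close>
  obtain R where "\<forall>x\<in>A. norm x \<le> R" using A(1) unfolding bounded_iff ..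
  then have R: "A \<subseteq> cball 0 R" by auto
  show ?thesis
  proof (rule Bochner_Integration.integrable_bound)
    have "integrable lborel (indicator (cball (0::'a) R) :: 'a \<Rightarrow> real)"
      by (intro integrable_real_indicator emeasure_bounded_finite bounded_cball) simp
    then show "integrable lborel (\<lambda>x. (w x)\<^sup>2 + indicator (cball 0 R) x)"
      using w by (simp add: sq_integrable_def)
    show "w \<in> borel_measurable lborel" by (rule sq_integrable_measurable[OF w])
    show "AE x in lborel. norm (w x) \<le> norm ((w x)\<^sup>2 + indicator (cball 0 R) x)"
    proof (rule AE_I2)
      fix x
      show "norm (w x) \<le> norm ((w x)\<^sup>2 + indicator (cball 0 R) x)"
      proof (cases "x \<in> A")
        case True
        have "2 * (\<bar>w x\<bar> * 1) \<le> (w x)\<^sup>2 + 1" using sum_squares_bound[of "\<bar>w x\<bar>" 1] by simp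
        then have "\<bar>w x\<bar> \<le> (w x)\<^sup>2 + 1" by linarith
        then show ?thesis using True R by auto
      qed (simp add: A(2))
    qed
  qed
qed

definition approximable :: "real \<Rightarrow> 'a::euclidean_space set \<Rightarrow> ('a \<Rightarrow> real) \<Rightarrow> bool" where
  "approximable s \<Omega> w \<longleftrightarrow>
     (\<forall>\<epsilon>>0. \<exists>\<xi>. Cinf_compact_support \<Omega> \<xi> \<and> energy s (\<lambda>x. w x - \<xi> x) < \<epsilon>)"

lemma approximable_add:
  assumes s: "0 < s" "s < 1" and fin: "finite_energy s v" "finite_energy s w"
    and v: "approximable s \<Omega> v" and w: "approximable s \<Omega> w"
  shows "approximable s \<Omega> (\<lambda>x. v x + w x)"
  unfolding approximable_def
proof (intro allI impI)
  fix \<epsilon> :: real assume "0 < \<epsilon>"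
  then have \<epsilon>: "0 < \<epsilon> / 4" by simp
  obtain \<xi> where \<xi>: "Cinf_compact_support \<Omega> \<xi>" "energy s (\<lambda>x. v x - \<xi> x) < \<epsilon> / 4"
    using v \<epsilon> unfolding approximable_def by blast
  obtain \<zeta> where \<zeta>: "Cinf_compact_support \<Omega> \<zeta>" "energy s (\<lambda>x. w x - \<zeta> x) < \<epsilon> / 4"
    using w \<epsilon> unfolding approximable_def by blast
  have "energy s (\<lambda>x. (v x - \<xi> x) + (w x - \<zeta> x)) \<le>
      2 * energy s (\<lambda>x. v x - \<xi> x) + 2 * energy s (\<lambda>x. w x - \<zeta> x)"
    by (intro energy_add_le finite_energy_diff fin Cinf_compact_support_finite_energy[OF s]) (fact \<xi>(1) \<zeta>(1))+
  also have "\<dots> < \<epsilon>" using \<xi>(2) \<zeta>(2) by linarith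
  also have "(\<lambda>x. (v x - \<xi> x) + (w x - \<zeta> x)) = (\<lambda>x. v x + w x - (\<xi> x + \<zeta> x))" by auto
  finally show "\<exists>\<xi>. Cinf_compact_support \<Omega> \<xi> \<and> energy s (\<lambda>x. v x + w x - \<xi> x) < \<epsilon>"
    using Cinf_compact_support_add[OF \<xi>(1) \<zeta>(1)] by blast
qed

text \<open>A uniform interior cone condition at the points of \<open>A\<close>, with axis
  \<open>e\<close> and opening \<open>\<kappa>\<close>. The margin grows linearly with the
  displacement, so a mollifier of radius proportional to \<open>t\<close> fits after a shift by
  \<open>t *\<^sub>R e\<close>.\<close>

definition inward_displaceable :: "'a::euclidean_space set \<Rightarrow> 'a set \<Rightarrow> bool" where
  "inward_displaceable \<Omega> A \<longleftrightarrow> (\<exists>e \<kappa> t\<^sub>0. 0 < \<kappa> \<and> 0 < t\<^sub>0 \<and>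
     (\<forall>t x h. 0 < t \<longrightarrow> t < t\<^sub>0 \<longrightarrow> x \<in> A \<longrightarrow> norm h \<le> \<kappa> * t \<longrightarrow> x + t *\<^sub>R e + h \<in> \<Omega>))"

text \<open>The mollifier is centred at \<open>t e\<close> instead of \<open>0\<close>, so that the convolution is pushed
  into the interior of \<open>\<Omega>\<close>.\<close>

lemma approximable_inward_displaceable:
  fixes w :: "'a::euclidean_space \<Rightarrow> real"
  assumes s: "0 < s" "s < 1" and w: "finite_energy s w" and A: "bounded A" "\<And>x. x \<notin> A \<Longrightarrow> w x = 0"
    and displ: "inward_displaceable \<Omega> A"
  shows "approximable s \<Omega> w"
  unfolding approximable_def
proof (intro allI impI)
  fix \<epsilon> :: real assume \<epsilon>: "0 < \<epsilon>"
  obtain e \<kappa> t\<^sub>0 where \<kappa>: "0 < \<kappa>" "0 < t\<^sub>0" and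
    displ: "\<And>t x h. 0 < t \<Longrightarrow> t < t\<^sub>0 \<Longrightarrow> x \<in> A \<Longrightarrow> norm h \<le> \<kappa> * t \<Longrightarrow> x + t *\<^sub>R e + h \<in> \<Omega>"
    using displ unfolding inward_displaceable_def by blast
  have [measurable]: "w \<in> borel_measurable borel" by (rule finite_energy_measurable[OF w])
  have w2: "sq_integrable lborel w" "sq_integrable lborel (gagliardo s w)"
    using w by (auto simp: finite_energy_def)
  have wint: "integrable lborel w" by (rule sq_integrable_bounded_support_integrable[OF w2(1) A])
  obtain d1 where d1: "0 < d1"
    "\<And>h. norm h < d1 \<Longrightarrow> (\<integral>\<^sup>+x. ennreal ((w (x - h) - w x)\<^sup>2) \<partial>lborel) \<le> ennreal (\<epsilon> / 3)"
    using square_integrable_translation_continuous[of w "\<epsilon> / 3"] w2(1) \<epsilon> by (auto simp: sq_integrable_def)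
  obtain d2 where d2: "0 < d2" "\<And>h. norm h < d2 \<Longrightarrow>
      (\<integral>\<^sup>+p. ennreal ((gagliardo s w (p - h) - gagliardo s w p)\<^sup>2) \<partial>lborel) \<le> ennreal (\<epsilon> / 3)"
    using square_integrable_translation_continuous[of "gagliardo s w" "\<epsilon> / 3"] w2(2) \<epsilon>
    by (auto simp: sq_integrable_def)
  \<comment> \<open>Each \<open>h\<close> in the support of the mollifier has norm at most
    \<open>t * (norm e + \<kappa>)\<close>. This must be below \<open>d1\<close>, and below
    \<open>d2 / 2\<close> because the diagonal shift \<open>(h, h)\<close> has norm at most
    \<open>2 * norm h\<close>.\<close>
  define t where "t = min (t\<^sub>0 / 2) (min d1 (d2 / 2) / (2 * (norm e + \<kappa>)))"
  have pos: "0 < norm e + \<kappa>" using \<kappa> by (simp add: add_nonneg_pos)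
  have t: "0 < t" "t < t\<^sub>0" using \<kappa> d1(1) d2(1) pos by (auto simp: t_def)
  have "t \<le> min d1 (d2 / 2) / (2 * (norm e + \<kappa>))" by (simp add: t_def)
  then have "t * (norm e + \<kappa>) * 2 \<le> min d1 (d2 / 2)" using pos by (simp add: pos_le_divide_eq mult_ac)
  moreover have "0 < t * (norm e + \<kappa>)" using t pos by simp
  ultimately have tsmall: "t * (norm e + \<kappa>) < d1" "t * (norm e + \<kappa>) < d2 / 2" by linarith+
  \<comment> \<open>The mollifier uses half of the margin \<open>\<kappa> * t\<close>; the other
    half keeps the closure of the support inside \<open>\<Omega>\<close>.\<close>
  have r: "0 < \<kappa> * t / 2" using \<kappa> t by simp
  obtain \<rho> where \<rho>: "Cinf_compact_support UNIV \<rho>" "\<And>x. 0 \<le> \<rho> x"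
    "\<And>x. x \<notin> cball (t *\<^sub>R e) (\<kappa> * t / 2) \<Longrightarrow> \<rho> x = 0" "integrable lborel \<rho>" "integral\<^sup>L lborel \<rho> = 1"
    using exists_smooth_mollifier[OF r, of "t *\<^sub>R e"] by blast
  note [measurable] = Cinf_compact_support_measurable[OF \<rho>(1)]
  have small: "norm h \<le> t * (norm e + \<kappa>)" if "\<rho> h \<noteq> 0" for h
  proof -
    have "h \<in> cball (t *\<^sub>R e) (\<kappa> * t / 2)" using \<rho>(3) that by blast
    then have "norm (h - t *\<^sub>R e) \<le> \<kappa> * t / 2" by (simp add: dist_norm norm_minus_commute)
    moreover have "norm h \<le> norm (t *\<^sub>R e) + norm (h - t *\<^sub>R e)" by (rule norm_triangle_sub)
    moreover have "norm (t *\<^sub>R e) = t * norm e" using t by simp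
    moreover have "0 < \<kappa> * t" using \<kappa> t by simp
    ultimately show ?thesis unfolding distrib_left mult.commute[of t \<kappa>] by linarith
  qed
  define \<xi> where "\<xi> = (\<lambda>x. \<integral>y. \<rho> (x - y) * w y \<partial>lborel)"
  obtain B where B: "\<And>x. \<bar>\<rho> x\<bar> \<le> B" using Cinf_compact_support_bounded[OF \<rho>(1)] by metis
  have int: "integrable lborel (\<lambda>h. \<rho> h * w (x - h))" for x
  proof (rule Bochner_Integration.integrable_bound)
    show "integrable lborel (\<lambda>h. B * w (x - h))" using wint by (simp add: integral_lborel_reflect(2))
    show "AE h in lborel. norm (\<rho> h * w (x - h)) \<le> norm (B * w (x - h))"
      using B order_trans[OF abs_ge_zero B] by (intro AE_I2) (auto simp: abs_mult intro: mult_right_mono)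
  qed measurable
  have \<xi>: "\<xi> x = (\<integral>h. \<rho> h * w (x - h) \<partial>lborel)" for x
    unfolding \<xi>_def using integral_lborel_reflect(1)[of "\<lambda>h. \<rho> h * w (x - h)" x] by simp
  define S where "S = {x + t *\<^sub>R e + h | x h. x \<in> A \<and> norm h \<le> \<kappa> * t / 2}"
  have "bounded S"
  proof -
    have "S \<subseteq> (\<lambda>(a, b). a + b) ` (A \<times> cball (t *\<^sub>R e) (\<kappa> * t / 2))"
    proof
      fix z assume "z \<in> S"
      then obtain x h where "z = x + (t *\<^sub>R e + h)" "x \<in> A" "norm h \<le> \<kappa> * t / 2"
        by (auto simp: S_def add.assoc)
      then show "z \<in> (\<lambda>(a, b). a + b) ` (A \<times> cball (t *\<^sub>R e) (\<kappa> * t / 2))"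
        by (auto intro!: image_eqI[of _ _ "(x, t *\<^sub>R e + h)"] simp: dist_norm)
    qed
    moreover have "bounded ((\<lambda>(a, b). a + b) ` (A \<times> cball (t *\<^sub>R e) (\<kappa> * t / 2)))"
      using bounded_plus[OF A(1) bounded_cball] .
    ultimately show ?thesis using bounded_subset by blast
  qed
  moreover have "closure S \<subseteq> \<Omega>"
  proof
    fix y assume "y \<in> closure S"
    then obtain z where z: "z \<in> S" "dist z y < \<kappa> * t / 2"
      using r unfolding closure_approachable by blast
    then obtain x h where x: "z = x + t *\<^sub>R e + h" "x \<in> A" "norm h \<le> \<kappa> * t / 2" by (auto simp: S_def)
    have "norm (h + (y - z)) \<le> \<kappa> * t"
      using norm_triangle_ineq[of h "y - z"] x(3) z(2) by (simp add: dist_norm norm_minus_commute)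
    from displ[OF t x(2) this] show "y \<in> \<Omega>" by (simp add: x(1) algebra_simps)
  qed
  moreover have "\<xi> x = 0" if "x \<notin> closure S" for x
  proof -
    have "\<rho> h * w (x - h) = 0" for h
    proof (rule ccontr)
      assume "\<not> \<rho> h * w (x - h) = 0"
      then have "x - h \<in> A" "h \<in> cball (t *\<^sub>R e) (\<kappa> * t / 2)" using A(2) \<rho>(3) by auto
      then have "x \<in> S"
        unfolding S_def by (intro CollectI exI[of _ "x - h"] exI[of _ "h - t *\<^sub>R e"])
          (auto simp: dist_norm norm_minus_commute)
      then show False using that closure_subset by blast
    qed
    then have "(\<lambda>h. \<rho> h * w (x - h)) = (\<lambda>_. 0)" by (rule ext)
    then show ?thesis unfolding \<xi> by simp
  qed
  moreover have "Cinf_on UNIV \<xi>" unfolding \<xi>_def by (rule Cinf_compact_support_convolution[OF \<rho>(1) wint])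
  ultimately have supp: "Cinf_compact_support \<Omega> \<xi>"
    by (intro Cinf_compact_supportI[where K="closure S"]) (auto simp: compact_closure)
  have "finite_energy s (\<lambda>x. \<xi> x - w x)"
    by (intro finite_energy_diff w Cinf_compact_support_finite_energy[OF s supp])
  then have fin: "sq_integrable lborel (\<lambda>x. \<xi> x - w x)" "sq_integrable lborel (\<lambda>p. gagliardo s \<xi> p - gagliardo s w p)"
    by (auto simp: finite_energy_def gagliardo_diff[abs_def])
  have 1: "(\<integral>\<^sup>+x. ennreal ((\<xi> x - w x)\<^sup>2) \<partial>lborel) \<le> ennreal (\<epsilon> / 3)"
    unfolding \<xi> using tsmall
    by (intro nn_integral_averaged_translates_le[where J="\<lambda>h. h"] \<rho> int d1(2)) (auto dest: small)
  \<comment> \<open>The denominator depends on \<open>fst p - snd p\<close> alone, which diagonal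
    translations preserve, so the quotient commutes with the averaging.\<close>
  have gag: "gagliardo s \<xi> p = (\<integral>h. \<rho> h * gagliardo s w (p - (h, h)) \<partial>lborel)"
    and gag_int: "integrable lborel (\<lambda>h. \<rho> h * gagliardo s w (p - (h, h)))" for p
  proof -
    have e: "(\<lambda>h. \<rho> h * gagliardo s w (p - (h, h))) = (\<lambda>h. (\<rho> h * w (fst p - h) - \<rho> h * w (snd p - h)) /
        norm (fst p - snd p) powr (real DIM('a) / 2 + s))"
      by (auto simp: gagliardo_def fun_eq_iff right_diff_distrib diff_divide_distrib)
    show "integrable lborel (\<lambda>h. \<rho> h * gagliardo s w (p - (h, h)))"
      unfolding e using int by (intro integrable_divide Bochner_Integration.integrable_diff)
    show "gagliardo s \<xi> p = (\<integral>h. \<rho> h * gagliardo s w (p - (h, h)) \<partial>lborel)"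
      unfolding e using int by (simp add: gagliardo_def \<xi>)
  qed
  have [measurable]: "(\<lambda>h::'a. (h, h)) \<in> borel_measurable borel"
    by (intro borel_measurable_continuous_onI continuous_intros)
  have 2: "(\<integral>\<^sup>+p. ennreal ((gagliardo s \<xi> p - gagliardo s w p)\<^sup>2) \<partial>lborel) \<le> ennreal (\<epsilon> / 3)"
    unfolding gag
  proof (intro nn_integral_averaged_translates_le[where J="\<lambda>h. (h, h)"] \<rho> gag_int d2(2))
    fix h assume "\<rho> h \<noteq> 0"
    have "norm (h, h) \<le> norm h + norm h" by (rule norm_Pair_le)
    also have "\<dots> < d2" using small[OF \<open>\<rho> h \<noteq> 0\<close>] tsmall by linarith
    finally show "norm (h, h) < d2" .
  qed measurable
  have "(\<integral>x. (\<xi> x - w x)\<^sup>2 \<partial>lborel) \<le> \<epsilon> / 3" "(\<integral>p. (gagliardo s \<xi> p - gagliardo s w p)\<^sup>2 \<partial>lborel) \<le> \<epsilon> / 3"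
    using 1 2 \<epsilon> by (simp_all add: sq_integrable_nn_integral[OF fin(1)] sq_integrable_nn_integral[OF fin(2)])
  then have "energy s (\<lambda>x. w x - \<xi> x) < \<epsilon>"
    using \<epsilon> by (simp add: energy_def gagliardo_diff power2_commute[of "w _"] power2_commute[of "gagliardo s w _"])
  with supp show "\<exists>\<xi>. Cinf_compact_support \<Omega> \<xi> \<and> energy s (\<lambda>x. w x - \<xi> x) < \<epsilon>" by blast
qed

lemma approximable_zero: "approximable s \<Omega> (\<lambda>_. 0)"
proof -
  have "Cinf_compact_support \<Omega> (\<lambda>_. 0)"
    by (rule Cinf_compact_supportI[where K="{}"]) (auto intro: smooth_alg_Cinf smooth_alg.const)
  moreover have "energy s (\<lambda>_::'a. 0 - 0) = 0" by (simp add: energy_def gagliardo_def)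
  ultimately show ?thesis unfolding approximable_def by (intro allI impI exI[of _ "\<lambda>_. 0"]) simp
qed

text \<open>A cutoff \<open>\<eta>\<close> peels off one ball of a finite cover at a time: \<open>\<eta> w\<close> lives in a single chart,
  while \<open>w - \<eta> w\<close> already vanishes on that ball.\<close>

lemma approximable_finite_cover:
  fixes w :: "'a::euclidean_space \<Rightarrow> real"
  assumes s: "0 < s" "s < 1" and "finite F"
    and F: "\<And>z. z \<in> F \<Longrightarrow> 0 < r z \<and> inward_displaceable \<Omega> (\<Omega> \<inter> ball z (r z))"
    and w: "finite_energy s w" "\<And>x. x \<notin> \<Omega> \<Longrightarrow> w x = 0" "\<And>x. x \<notin> (\<Union>z\<in>F. ball z (r z / 2)) \<Longrightarrow> w x = 0"
  shows "approximable s \<Omega> w"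
  using \<open>finite F\<close> F w
proof (induction F arbitrary: w rule: finite_induct)
  case empty
  have "w = (\<lambda>_. 0)" by (rule ext, rule empty.prems(4)) simp
  then show ?case using approximable_zero by simp
next
  case (insert z F)
  have r: "0 < r z" and displ: "inward_displaceable \<Omega> (\<Omega> \<inter> ball z (r z))" using insert.prems(1) by auto
  \<comment> \<open>Equal to 1 on the half ball, 0 outside the ball, and Lipschitz with constant
    \<open>2 / r z\<close>.\<close>
  define \<eta> where "\<eta> = (\<lambda>x. max 0 (min 1 (2 - 2 * dist z x / r z)))"
  have [measurable]: "\<eta> \<in> borel_measurable borel"
    unfolding \<eta>_def using r by (intro borel_measurable_continuous_onI continuous_intros) auto
  have \<eta>1: "\<bar>\<eta> x\<bar> \<le> 1" for x by (simp add: \<eta>_def)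
  have lip: "\<bar>\<eta> x - \<eta> y\<bar> \<le> (2 / r z) * norm (x - y)" for x y
  proof -
    have "\<bar>\<eta> x - \<eta> y\<bar> \<le> \<bar>2 * dist z x / r z - 2 * dist z y / r z\<bar>" unfolding \<eta>_def by linarith
    also have "\<dots> = \<bar>(2 / r z) * (dist z x - dist z y)\<bar>" by (simp add: algebra_simps)
    also have "\<dots> = (2 / r z) * \<bar>dist z x - dist z y\<bar>" unfolding abs_mult using r by simp
    also have "\<dots> \<le> (2 / r z) * norm (x - y)"
      using r abs_dist_diff_le[of x z y] by (intro mult_left_mono) (auto simp: dist_commute dist_norm[symmetric])
    finally show ?thesis .
  qed
  have f1: "finite_energy s (\<lambda>x. \<eta> x * w x)"
    using finite_energy_lipschitz_mult[OF s insert.prems(2) _ \<eta>1 lip] by simp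
  have "approximable s \<Omega> (\<lambda>x. \<eta> x * w x)"
  proof (rule approximable_inward_displaceable[OF s f1 _ _ displ])
    show "bounded (\<Omega> \<inter> ball z (r z))" by (simp add: bounded_Int)
    fix x assume x: "x \<notin> \<Omega> \<inter> ball z (r z)"
    have "\<eta> x = 0" if "x \<notin> ball z (r z)"
    proof -
      have "2 \<le> 2 * dist z x / r z" using that r by (simp add: pos_le_divide_eq)
      then show ?thesis by (simp add: \<eta>_def)
    qed
    then show "\<eta> x * w x = 0" using x insert.prems(3) by auto
  qed
  moreover have f2: "finite_energy s (\<lambda>x. w x - \<eta> x * w x)"
    by (intro finite_energy_diff insert.prems f1)
  moreover have "approximable s \<Omega> (\<lambda>x. w x - \<eta> x * w x)"
  proof (rule insert.IH[OF _ f2])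
    fix x
    show "w x - \<eta> x * w x = 0" if "x \<notin> \<Omega>" using insert.prems(3)[OF that] by simp
    show "w x - \<eta> x * w x = 0" if "x \<notin> (\<Union>z\<in>F. ball z (r z / 2))"
    proof (cases "x \<in> ball z (r z / 2)")
      case True
      then have "2 * dist z x / r z \<le> 1" using r by (simp add: pos_divide_le_eq)
      then show ?thesis by (simp add: \<eta>_def)
    next
      case False
      then show ?thesis using insert.prems(4)[of x] that by simp
    qed
  qed (use insert.prems in auto)
  ultimately have "approximable s \<Omega> (\<lambda>x. \<eta> x * w x + (w x - \<eta> x * w x))"
    by (intro approximable_add s f1)
  then show ?case by simp
qed

text \<open>At an interior point the direction 0 suffices. At a boundary point a smooth graph
  function is Lipschitz on a compact ball, and moving along \<open>e\<close> raises the point above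
  the graph faster than a perturbation \<open>h\<close> can bring it back.\<close>

lemma bounded_smooth_domain_inward_displaceable:
  fixes \<Omega> :: "'a::euclidean_space set"
  assumes \<Omega>: "bounded_smooth_domain \<Omega>" and z: "z \<in> closure \<Omega>"
  obtains r where "0 < r" "inward_displaceable \<Omega> (\<Omega> \<inter> ball z r)"
proof (cases "z \<in> \<Omega>")
  case True
  then obtain r where r: "0 < r" "ball z r \<subseteq> \<Omega>" using \<Omega> openE unfolding bounded_smooth_domain_def by blast
  have "x + t *\<^sub>R 0 + h \<in> \<Omega>" if "t < r / 2" "x \<in> \<Omega> \<inter> ball z (r / 2)" "norm h \<le> 1 * t" for t x h
  proof -
    have "dist z (x + h) \<le> dist z x + norm h" using dist_triangle[of z "x + h" x] by (simp add: dist_norm)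
    then have "x + h \<in> ball z r" using that by auto
    then show ?thesis using r by auto
  qed
  then have "inward_displaceable \<Omega> (\<Omega> \<inter> ball z (r / 2))"
    unfolding inward_displaceable_def using r(1)
    by (intro exI[of _ 0] exI[of _ 1] exI[of _ "r / 2"]) auto
  then show ?thesis using that[of "r / 2"] r by simp
next
  case False
  have "open \<Omega>" using \<Omega> by (simp add: bounded_smooth_domain_def)
  then have "z \<in> frontier \<Omega>" using False z by (simp add: frontier_def interior_open)
  then obtain r e \<gamma> where r: "0 < r" and e: "norm e = 1" and \<gamma>: "Cinf_on UNIV \<gamma>"
    and graph: "\<Omega> \<inter> ball z r = {x \<in> ball z r. \<gamma> (x - (x \<bullet> e) *\<^sub>R e) < x \<bullet> e}"
    using \<Omega> unfolding bounded_smooth_domain_def by blast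
  define P where "P = (\<lambda>x. x - (x \<bullet> e) *\<^sub>R e)"
  have Padd: "P (x + y) = P x + P y" for x y by (simp add: P_def inner_add_left scaleR_left_distrib)
  have Pe: "P (t *\<^sub>R e) = 0" for t using e by (simp add: P_def dot_square_norm)
  have Pnorm: "norm (P x) \<le> 2 * norm x" for x
  proof -
    have "norm (P x) \<le> norm x + norm ((x \<bullet> e) *\<^sub>R e)" unfolding P_def by (rule norm_triangle_ineq4)
    also have "\<dots> \<le> 2 * norm x" using Cauchy_Schwarz_ineq2[of x e] e by simp
    finally show ?thesis .
  qed
  \<comment> \<open>Compact and convex, and large enough to contain the projections of all points of
    \<open>ball z r\<close>, as \<open>norm (P x) \<le> 2 * norm x\<close>.\<close>
  define S where "S = cball (0::'a) (2 * (norm z + r))"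
  have "\<exists>B. \<forall>x\<in>S. \<bar>frechet_derivative \<gamma> (at x) b\<bar> \<le> B" for b
  proof -
    have "compact ((\<lambda>x. frechet_derivative \<gamma> (at x) b) ` S)"
      using Cinf_on_continuous_on[OF Cinf_on_frechet_derivative[OF \<gamma>]]
      by (intro compact_continuous_image) (auto simp: S_def intro: continuous_on_subset)
    then show ?thesis by (auto simp: bounded_iff dest!: compact_imp_bounded)
  qed
  moreover have "convex S" by (simp add: S_def)
  ultimately obtain L where L: "0 \<le> L" "\<And>x y. x \<in> S \<Longrightarrow> y \<in> S \<Longrightarrow> \<bar>\<gamma> x - \<gamma> y\<bar> \<le> L * norm (x - y)"
    using Cinf_lipschitz_on_convex[OF \<gamma>, of S] by metis
  have PS: "P x \<in> S" if "x \<in> ball z r" for x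
  proof -
    have "norm x \<le> norm z + r" using that norm_triangle_sub[of x z] by (simp add: dist_norm norm_minus_commute)
    then show ?thesis using Pnorm[of x] by (simp add: S_def)
  qed
  \<comment> \<open>A perturbation \<open>h\<close> changes the graph function by at most
    \<open>2 * L * norm h\<close> and the height by at most \<open>norm h\<close>; with this
    \<open>\<kappa>\<close> both together stay within the gain \<open>t\<close>.\<close>
  define \<kappa> where "\<kappa> = 1 / (2 * L + 2)"
  have \<kappa>: "0 < \<kappa>" "\<kappa> \<le> 1" "(2 * L + 2) * \<kappa> = 1" using L(1) by (auto simp: \<kappa>_def divide_simps)
  have "x + t *\<^sub>R e + h \<in> \<Omega>"
    \<comment> \<open>The displaced point moves by at most \<open>2 * t < r / 2\<close>, so it stays
      in \<open>ball z r\<close>, where the graph describes \<open>\<Omega>\<close>.\<close>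
    if t: "0 < t" "t < r / 4" and x: "x \<in> \<Omega> \<inter> ball z (r / 2)" and h: "norm h \<le> \<kappa> * t" for t x h
  proof -
    let ?y = "x + t *\<^sub>R e + h"
    have h1: "norm h \<le> t" using h \<kappa> t mult_right_mono[of \<kappa> 1 t] by linarith
    have "dist z ?y \<le> dist z x + norm (t *\<^sub>R e + h)"
      using dist_triangle[of z ?y x] norm_minus_cancel[of "t *\<^sub>R e + h"]
      by (simp add: dist_norm[of x] algebra_simps)
    also have "norm (t *\<^sub>R e + h) \<le> t + t" using norm_triangle_ineq[of "t *\<^sub>R e" h] h1 e t by simp
    finally have y: "?y \<in> ball z r" using x t by simp
    have xb: "x \<in> ball z r" using x r by auto
    have "x \<in> \<Omega> \<inter> ball z r" using x xb by auto
    then have gx: "\<gamma> (P x) < x \<bullet> e" unfolding graph by (simp add: P_def)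
    have "P ?y = P x + P h" by (simp add: Padd Pe)
    then have "\<bar>\<gamma> (P ?y) - \<gamma> (P x)\<bar> \<le> L * norm (P h)" using L(2)[OF PS[OF y] PS[OF xb]] by simp
    also have "\<dots> \<le> L * (2 * norm h)" using L(1) Pnorm by (intro mult_left_mono)
    finally have 1: "\<gamma> (P ?y) \<le> \<gamma> (P x) + 2 * L * norm h" by simp
    have "(2 * L + 2) * norm h \<le> (2 * L + 2) * (\<kappa> * t)" using h L(1) by (intro mult_left_mono) auto
    also have "\<dots> = t" using \<kappa>(3) by (simp flip: mult.assoc)
    finally have 2: "2 * L * norm h + 2 * norm h \<le> t" by (simp add: distrib_right)
    have "\<bar>h \<bullet> e\<bar> \<le> norm h" using Cauchy_Schwarz_ineq2[of h e] e by simp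
    moreover have "?y \<bullet> e = x \<bullet> e + t + h \<bullet> e" using e by (simp add: inner_add_left dot_square_norm)
    ultimately have "\<gamma> (P ?y) < ?y \<bullet> e" using 1 2 gx norm_ge_zero[of h] by linarith
    then have "?y \<in> {x \<in> ball z r. \<gamma> (x - (x \<bullet> e) *\<^sub>R e) < x \<bullet> e}" using y by (simp add: P_def)
    then show ?thesis using graph by blast
  qed
  then have "inward_displaceable \<Omega> (\<Omega> \<inter> ball z (r / 2))"
    unfolding inward_displaceable_def using r \<kappa>(1)
    by (intro exI[of _ e] exI[of _ \<kappa>] exI[of _ "r / 4"]) auto
  then show ?thesis using that[of "r / 2"] r by simp
qed

text \<open>Compactness of the closure of \<open>\<Omega>\<close> yields finitely many charts. The
  geometry of the boundary enters the density statement only through their displaceability.\<close>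

lemma Cinf_compact_support_dense:
  fixes w :: "'a::euclidean_space \<Rightarrow> real"
  assumes s: "0 < s" "s < 1" and \<Omega>: "bounded_smooth_domain \<Omega>"
    and w: "finite_energy s w" "\<And>x. x \<notin> \<Omega> \<Longrightarrow> w x = 0"
  shows "approximable s \<Omega> w"
proof -
  have bd: "bounded \<Omega>" using \<Omega> by (simp add: bounded_smooth_domain_def)
  have "\<forall>z\<in>closure \<Omega>. \<exists>r. 0 < r \<and> inward_displaceable \<Omega> (\<Omega> \<inter> ball z r)"
    using bounded_smooth_domain_inward_displaceable[OF \<Omega>] by metis
  then obtain r where r: "\<And>z. z \<in> closure \<Omega> \<Longrightarrow> 0 < r z \<and> inward_displaceable \<Omega> (\<Omega> \<inter> ball z (r z))"
    by metis
  obtain F where F: "F \<subseteq> closure \<Omega>" "finite F" "closure \<Omega> \<subseteq> (\<Union>z\<in>F. ball z (r z / 2))"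
  proof (rule compactE_image[of "closure \<Omega>" "closure \<Omega>" "\<lambda>z. ball z (r z / 2)"])
    show "compact (closure \<Omega>)" using bd by (simp add: compact_closure)
    show "closure \<Omega> \<subseteq> (\<Union>z\<in>closure \<Omega>. ball z (r z / 2))" using r by force
  qed auto
  show ?thesis
  proof (rule approximable_finite_cover[OF s F(2) _ w])
    show "w x = 0" if "x \<notin> (\<Union>z\<in>F. ball z (r z / 2))" for x
      using that F(3) closure_subset[of \<Omega>] w(2) by blast
  qed (use r F(1) in auto)
qed

section \<open>The fractional Laplacian of a test function\<close>

text \<open>The linear Taylor terms at \<open>h\<close> and \<open>- h\<close> cancel, which leaves
  a quadratic bound near 0; boundedness of \<open>\<phi>\<close> gives the constant one.\<close>

lemma second_difference_le:
  fixes \<phi> :: "'a::euclidean_space \<Rightarrow> real"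
  assumes \<phi>: "Cinf_compact_support U \<phi>"
  obtains C where "0 \<le> C" "\<And>x h. \<bar>2 * \<phi> x - \<phi> (x + h) - \<phi> (x - h)\<bar> \<le> C * min 1 ((norm h)\<^sup>2)"
proof -
  obtain B where B: "0 \<le> B" "\<And>x. \<bar>\<phi> x\<bar> \<le> B" using Cinf_compact_support_bounded[OF \<phi>] by metis
  obtain T where T: "0 \<le> T"
    "\<And>x h. \<bar>\<phi> (x + h) - \<phi> x - frechet_derivative \<phi> (at x) h\<bar> \<le> T * (norm h)\<^sup>2"
    using Cinf_compact_support_taylor[OF \<phi>] by metis
  define C where "C = 4 * B + 2 * T"
  have "\<bar>2 * \<phi> x - \<phi> (x + h) - \<phi> (x - h)\<bar> \<le> C * min 1 ((norm h)\<^sup>2)" for x h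
  proof -
    have "(\<phi> has_derivative frechet_derivative \<phi> (at x)) (at x)"
      using \<phi> Cinf_on_has_derivative by (auto simp: Cinf_compact_support_def)
    then have "frechet_derivative \<phi> (at x) (- h) = - frechet_derivative \<phi> (at x) h"
      using has_derivative_linear linear_neg by blast
    then have 1: "\<bar>2 * \<phi> x - \<phi> (x + h) - \<phi> (x - h)\<bar> \<le> 2 * T * (norm h)\<^sup>2"
      using T(2)[of x h] T(2)[of x "- h"] by simp
    have 2: "\<bar>2 * \<phi> x - \<phi> (x + h) - \<phi> (x - h)\<bar> \<le> 4 * B"
      using B(2)[of x] B(2)[of "x + h"] B(2)[of "x - h"] by linarith
    have "4 * B \<le> C * 1" using T(1) by (simp add: C_def)
    moreover have "2 * T * (norm h)\<^sup>2 \<le> C * (norm h)\<^sup>2" using B(1) by (intro mult_right_mono) (auto simp: C_def)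
    ultimately show ?thesis using 1 2 by (auto simp: min_def)
  qed
  moreover have "0 \<le> C" using B T by (simp add: C_def)
  ultimately show ?thesis using that by blast
qed

lemma integrable_sq_cap_kernel:
  "0 < s \<Longrightarrow> s < 1 \<Longrightarrow> integrable lborel (sq_cap_kernel s :: 'a::euclidean_space \<Rightarrow> real)"
  using nn_integral_sq_cap_kernel[of s, where 'a='a]
  by (simp add: integrable_iff_bounded sq_cap_kernel_nonneg)

text \<open>Away from the origin the minimum in \<open>sq_cap_kernel\<close> is bounded below, by 1
  or by \<open>\<epsilon>\<^sup>2\<close>; the factor covers both cases.\<close>

lemma truncated_kernel_le:
  fixes h :: "'a::euclidean_space"
  assumes "0 < \<epsilon>" "\<epsilon> < norm h"
  shows "1 / norm h powr (real DIM('a) + 2 * s) \<le> (1 + 1 / \<epsilon>\<^sup>2) * sq_cap_kernel s h"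
proof -
  have "1 \<le> (1 + 1 / \<epsilon>\<^sup>2) * min 1 ((norm h)\<^sup>2)"
  proof (cases "(norm h)\<^sup>2 \<le> 1")
    case True
    have "\<epsilon>\<^sup>2 \<le> (norm h)\<^sup>2" using assms by (intro power_mono) auto
    then have "1 \<le> 1 / \<epsilon>\<^sup>2 * (norm h)\<^sup>2" using assms by (simp add: field_simps)
    also have "\<dots> \<le> (1 + 1 / \<epsilon>\<^sup>2) * (norm h)\<^sup>2" by (intro mult_right_mono) auto
    finally show ?thesis using True by (simp add: min_def)
  qed (simp add: min_def)
  then show ?thesis
    unfolding sq_cap_kernel_def times_divide_eq_right by (rule divide_right_mono) simp
qed

text \<open>The second-difference form of the fractional Laplacian, without the factor
  \<open>c\<close>. For test functions it converges absolutely and so replaces the principal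
  value.\<close>

definition sym_laplacian :: "real \<Rightarrow> ('a::euclidean_space \<Rightarrow> real) \<Rightarrow> 'a \<Rightarrow> real" where
  "sym_laplacian s \<phi> x =
     (\<integral>h. (2 * \<phi> x - \<phi> (x + h) - \<phi> (x - h)) / (2 * norm h powr (real DIM('a) + 2 * s)) \<partial>lborel)"

definition truncated_laplacian :: "real \<Rightarrow> real \<Rightarrow> ('a::euclidean_space \<Rightarrow> real) \<Rightarrow> 'a \<Rightarrow> real" where
  "truncated_laplacian \<epsilon> s \<phi> x = (\<integral>y. indicator {y. \<epsilon> < dist x y} y * diff_quot s \<phi> x y \<partial>lborel)"

lemma diff_quot_measurable [measurable]:
  assumes [measurable]: "\<phi> \<in> borel_measurable borel"
  shows "diff_quot s \<phi> x \<in> borel_measurable borel"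
  unfolding diff_quot_def[abs_def] by measurable

lemma truncated_diff_quot_le:
  fixes \<phi> :: "'a::euclidean_space \<Rightarrow> real"
  assumes B: "\<And>x. \<bar>\<phi> x\<bar> \<le> B" and \<epsilon>: "0 < \<epsilon>"
  shows "\<bar>indicator {y. \<epsilon> < dist x y} y * diff_quot s \<phi> x y\<bar> \<le> 2 * B * (1 + 1 / \<epsilon>\<^sup>2) * sq_cap_kernel s (x - y)"
proof (cases "\<epsilon> < dist x y")
  case True
  have "\<bar>\<phi> x - \<phi> y\<bar> \<le> 2 * B" using B[of x] B[of y] by linarith
  then have "\<bar>diff_quot s \<phi> x y\<bar> \<le> 2 * B * (1 / norm (x - y) powr (real DIM('a) + 2 * s))"
    by (simp add: diff_quot_def divide_right_mono)
  also have "\<dots> \<le> 2 * B * ((1 + 1 / \<epsilon>\<^sup>2) * sq_cap_kernel s (x - y))"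
    using truncated_kernel_le[OF \<epsilon>, of "x - y" s] True order_trans[OF abs_ge_zero B]
    by (intro mult_left_mono) (auto simp: dist_norm)
  finally show ?thesis using True by (simp add: mult.assoc)
next
  case False
  have "0 \<le> B" using order_trans[OF abs_ge_zero B] .
  then show ?thesis using False \<epsilon> by (simp add: sq_cap_kernel_nonneg)
qed

lemma integrable_truncated_diff_quot:
  fixes \<phi> :: "'a::euclidean_space \<Rightarrow> real"
  assumes s: "0 < s" "s < 1" and [measurable]: "\<phi> \<in> borel_measurable borel"
    and B: "\<And>x. \<bar>\<phi> x\<bar> \<le> B" and \<epsilon>: "0 < \<epsilon>"
  shows "integrable lborel (\<lambda>y. indicator {y. \<epsilon> < dist x y} y * diff_quot s \<phi> x y)"
proof (rule Bochner_Integration.integrable_bound)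
  show "integrable lborel (\<lambda>y. 2 * B * (1 + 1 / \<epsilon>\<^sup>2) * sq_cap_kernel s (x - y))"
    using integrable_sq_cap_kernel[OF s, where 'a='a]
    by (simp add: integral_lborel_reflect(2) del: sq_cap_kernel_minus)
  show "AE y in lborel. norm (indicator {y. \<epsilon> < dist x y} y * diff_quot s \<phi> x y) \<le>
      norm (2 * B * (1 + 1 / \<epsilon>\<^sup>2) * sq_cap_kernel s (x - y))"
  proof (rule AE_I2)
    fix y
    show "norm (indicator {y. \<epsilon> < dist x y} y * diff_quot s \<phi> x y) \<le>
      norm (2 * B * (1 + 1 / \<epsilon>\<^sup>2) * sq_cap_kernel s (x - y))"
      unfolding real_norm_def by (rule order_trans[OF truncated_diff_quot_le[OF B \<epsilon>] abs_ge_self])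
  qed
qed measurable

text \<open>Average of the substitutions \<open>y = x - h\<close> and \<open>y = x + h\<close>; the
  truncated region is symmetric. This has to precede the limit in \<open>\<epsilon>\<close>, because
  the first differences have in general no integrable majorant uniform in
  \<open>\<epsilon>\<close>.\<close>

lemma truncated_laplacian_symmetrized:
  fixes \<phi> :: "'a::euclidean_space \<Rightarrow> real"
  assumes s: "0 < s" "s < 1" and [measurable]: "\<phi> \<in> borel_measurable borel"
    and B: "\<And>x. \<bar>\<phi> x\<bar> \<le> B" and \<epsilon>: "0 < \<epsilon>"
  shows "truncated_laplacian \<epsilon> s \<phi> x = (\<integral>h. indicator {h. \<epsilon> < norm h} h *
    ((2 * \<phi> x - \<phi> (x + h) - \<phi> (x - h)) / (2 * norm h powr (real DIM('a) + 2 * s))) \<partial>lborel)"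
proof -
  let ?p = "real DIM('a) + 2 * s"
  define F where "F = (\<lambda>y. indicator {y. \<epsilon> < dist x y} y * diff_quot s \<phi> x y)"
  define m where "m = (\<lambda>h::'a. indicator {h. \<epsilon> < norm h} h * ((\<phi> x - \<phi> (x - h)) / norm h powr ?p))"
  have F: "integrable lborel F" unfolding F_def by (rule integrable_truncated_diff_quot[OF s _ B \<epsilon>]) simp
  have mF: "F (x - h) = m h" for h
    by (simp add: F_def m_def diff_quot_def dist_norm indicator_def)
  have m: "integrable lborel m" "integral\<^sup>L lborel m = truncated_laplacian \<epsilon> s \<phi> x"
    using integral_lborel_reflect[of F x] F by (simp_all add: mF truncated_laplacian_def F_def[symmetric])
  have m': "integrable lborel (\<lambda>h. m (- h))" "(\<integral>h. m (- h) \<partial>lborel) = truncated_laplacian \<epsilon> s \<phi> x"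
    using integral_lborel_reflect[of m 0] m by simp_all
  have "truncated_laplacian \<epsilon> s \<phi> x = (\<integral>h. (m h + m (- h)) / 2 \<partial>lborel)"
    using m m' by simp
  also have "(\<lambda>h. (m h + m (- h)) / 2) = (\<lambda>h. indicator {h. \<epsilon> < norm h} h *
      ((2 * \<phi> x - \<phi> (x + h) - \<phi> (x - h)) / (2 * norm h powr ?p)))"
    by (auto simp: m_def fun_eq_iff indicator_def add_divide_distrib diff_divide_distrib)
  finally show ?thesis .
qed

lemma second_difference_quotient_le:
  fixes h :: "'a::euclidean_space"
  assumes "\<bar>d\<bar> \<le> C * min 1 ((norm h)\<^sup>2)" and "0 \<le> C"
  shows "\<bar>d / (2 * norm h powr (real DIM('a) + 2 * s))\<bar> \<le> C * sq_cap_kernel s h"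
proof -
  have "\<bar>d / (2 * norm h powr (real DIM('a) + 2 * s))\<bar> \<le> \<bar>d\<bar> / norm h powr (real DIM('a) + 2 * s)"
    by (cases "h = 0") (auto simp: abs_mult intro!: divide_left_mono)
  also have "\<dots> \<le> C * sq_cap_kernel s h"
    unfolding sq_cap_kernel_def times_divide_eq_right using assms(1) by (rule divide_right_mono) simp
  finally show ?thesis .
qed

lemma truncated_laplacian_tendsto:
  fixes \<phi> :: "'a::euclidean_space \<Rightarrow> real"
  assumes s: "0 < s" "s < 1" and \<phi>: "Cinf_compact_support U \<phi>"
    and \<epsilon>: "\<And>j. 0 < \<epsilon> j" "\<epsilon> \<longlonglongrightarrow> 0"
  shows "(\<lambda>j. truncated_laplacian (\<epsilon> j) s \<phi> x) \<longlonglongrightarrow> sym_laplacian s \<phi> x"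
proof -
  note [measurable] = Cinf_compact_support_measurable[OF \<phi>]
  obtain B where B: "\<And>x. \<bar>\<phi> x\<bar> \<le> B" using Cinf_compact_support_bounded[OF \<phi>] by metis
  obtain C where C: "0 \<le> C" "\<And>x h. \<bar>2 * \<phi> x - \<phi> (x + h) - \<phi> (x - h)\<bar> \<le> C * min 1 ((norm h)\<^sup>2)"
    using second_difference_le[OF \<phi>] by metis
  define S where "S = (\<lambda>h. (2 * \<phi> x - \<phi> (x + h) - \<phi> (x - h)) / (2 * norm h powr (real DIM('a) + 2 * s)))"
  have [measurable]: "S \<in> borel_measurable borel" unfolding S_def by measurable
  have S: "\<bar>S h\<bar> \<le> C * sq_cap_kernel s h" for h
    unfolding S_def by (rule second_difference_quotient_le[OF C(2,1)])
  have "(\<lambda>j. \<integral>h. indicator {h. \<epsilon> j < norm h} h * S h \<partial>lborel) \<longlonglongrightarrow> (\<integral>h. S h \<partial>lborel)"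
  proof (rule integral_dominated_convergence)
    show "integrable lborel (\<lambda>h::'a. C * sq_cap_kernel s h)" using integrable_sq_cap_kernel[OF s, where 'a='a] by simp
    show "AE h in lborel. (\<lambda>j. indicator {h. \<epsilon> j < norm h} h * S h) \<longlonglongrightarrow> S h"
    proof (rule AE_I2)
      fix h :: 'a
      show "(\<lambda>j. indicator {h. \<epsilon> j < norm h} h * S h) \<longlonglongrightarrow> S h"
      proof (cases "h = 0")
        case False
        then have "\<forall>\<^sub>F j in sequentially. \<epsilon> j < norm h" by (intro order_tendstoD(2)[OF \<epsilon>(2)]) simp
        then have "\<forall>\<^sub>F j in sequentially. indicator {h. \<epsilon> j < norm h} h * S h = S h"
          by eventually_elim simp
        then show ?thesis by (rule tendsto_eventually)
      qed (simp add: S_def)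
    qed
    show "AE h in lborel. norm (indicator {h. \<epsilon> j < norm h} h * S h) \<le> C * sq_cap_kernel s h" for j
    proof (rule AE_I2)
      fix h :: 'a
      show "norm (indicator {h. \<epsilon> j < norm h} h * S h) \<le> C * sq_cap_kernel s h"
        using S[of h] by (auto simp: indicator_def intro: order_trans[OF abs_ge_zero])
    qed
  qed measurable
  then show ?thesis
    by (simp add: truncated_laplacian_symmetrized[OF s _ B \<epsilon>(1)] S_def sym_laplacian_def)
qed

text \<open>The majorant \<open>C * sq_cap_kernel s h\<close> depends neither on \<open>x\<close>
  nor on \<open>\<epsilon>\<close>. The uniform bound makes test functions admissible and lets the
  truncation be removed under an integral against an integrable function.\<close>

lemma truncated_laplacian_bounded:
  fixes \<phi> :: "'a::euclidean_space \<Rightarrow> real"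
  assumes s: "0 < s" "s < 1" and \<phi>: "Cinf_compact_support U \<phi>"
  obtains C where "0 \<le> C" "\<And>\<epsilon> x. 0 < \<epsilon> \<Longrightarrow> \<bar>truncated_laplacian \<epsilon> s \<phi> x\<bar> \<le> C" "\<And>x. \<bar>sym_laplacian s \<phi> x\<bar> \<le> C"
proof -
  note [measurable] = Cinf_compact_support_measurable[OF \<phi>]
  obtain B where B: "\<And>x. \<bar>\<phi> x\<bar> \<le> B" using Cinf_compact_support_bounded[OF \<phi>] by metis
  obtain C where C: "0 \<le> C" "\<And>x h. \<bar>2 * \<phi> x - \<phi> (x + h) - \<phi> (x - h)\<bar> \<le> C * min 1 ((norm h)\<^sup>2)"
    using second_difference_le[OF \<phi>] by metis
  define S where "S x h = (2 * \<phi> x - \<phi> (x + h) - \<phi> (x - h)) / (2 * norm h powr (real DIM('a) + 2 * s))"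
    for x h
  have [measurable]: "S x \<in> borel_measurable borel" for x unfolding S_def[abs_def] by measurable
  have S: "\<bar>S x h\<bar> \<le> C * sq_cap_kernel s h" for x h
    unfolding S_def by (rule second_difference_quotient_le[OF C(2,1)])
  define M where "M = (\<integral>h. C * sq_cap_kernel s (h::'a) \<partial>lborel)"
  have iM: "integrable lborel (\<lambda>h::'a. C * sq_cap_kernel s h)" using integrable_sq_cap_kernel[OF s, where 'a='a] by simp
  have bound: "\<bar>\<integral>h. G h \<partial>lborel\<bar> \<le> M"
    if [measurable]: "G \<in> borel_measurable borel" and G: "\<And>h. \<bar>G h\<bar> \<le> C * sq_cap_kernel s h" for G :: "'a \<Rightarrow> real"
  proof -
    have "integrable lborel G"
      by (rule Bochner_Integration.integrable_bound[OF iM]) (use G in \<open>auto intro: order_trans[OF _ abs_ge_self]\<close>)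
    then have "(\<integral>h. \<bar>G h\<bar> \<partial>lborel) \<le> M"
      unfolding M_def by (intro Bochner_Integration.integral_mono iM G) auto
    then show ?thesis using integral_abs_bound[of lborel G] by linarith
  qed
  show ?thesis
  proof (rule that[of M])
    show "0 \<le> M" unfolding M_def
      by (rule Bochner_Integration.integral_nonneg) (simp add: C sq_cap_kernel_nonneg)
    show "\<bar>truncated_laplacian \<epsilon> s \<phi> x\<bar> \<le> M" if "0 < \<epsilon>" for \<epsilon> x
      unfolding truncated_laplacian_symmetrized[OF s Cinf_compact_support_measurable[OF \<phi>] B that] S_def[symmetric]
    proof (rule bound)
      show "\<bar>indicator {h. \<epsilon> < norm h} h * S x h\<bar> \<le> C * sq_cap_kernel s h" for h
        using S[of x h] by (auto simp: indicator_def intro: order_trans[OF abs_ge_zero])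
    qed measurable
    show "\<bar>sym_laplacian s \<phi> x\<bar> \<le> M" for x
      unfolding sym_laplacian_def S_def[symmetric] by (rule bound) (use S in auto)
  qed
qed

lemma has_frac_laplacian_Cinf_compact_support:
  fixes \<phi> :: "'a::euclidean_space \<Rightarrow> real"
  assumes s: "0 < s" "s < 1" and \<phi>: "Cinf_compact_support U \<phi>"
  shows "has_frac_laplacian c s \<phi> x (c * sym_laplacian s \<phi> x)"
proof -
  note [measurable] = Cinf_compact_support_measurable[OF \<phi>]
  obtain B where B: "\<And>x. \<bar>\<phi> x\<bar> \<le> B" using Cinf_compact_support_bounded[OF \<phi>] by metis
  have meas: "(\<lambda>y. indicator {y. \<epsilon> < dist x y} y *\<^sub>R diff_quot s \<phi> x y) \<in> borel_measurable lborel" for \<epsilon>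
    by measurable
  have "set_integrable lebesgue {y. \<epsilon> < dist x y} (diff_quot s \<phi> x)" if "0 < \<epsilon>" for \<epsilon>
    using integrable_truncated_diff_quot[OF s _ B that, where x=x] meas[of \<epsilon>]
    by (simp add: set_integrable_def integrable_completion)
  moreover have eq: "set_lebesgue_integral lebesgue {y. \<epsilon> < dist x y} (diff_quot s \<phi> x) =
      truncated_laplacian \<epsilon> s \<phi> x" for \<epsilon>
    using integral_completion[OF meas[of \<epsilon>]] by (simp add: set_lebesgue_integral_def truncated_laplacian_def)
  moreover have "((\<lambda>\<epsilon>. truncated_laplacian \<epsilon> s \<phi> x) \<longlongrightarrow> sym_laplacian s \<phi> x) (at_right 0)"
    by (rule tendsto_at_right_sequentially[of 0 1]) (auto intro: truncated_laplacian_tendsto[OF s \<phi>])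
  ultimately show ?thesis
    unfolding has_frac_laplacian_def by (auto intro: tendsto_mult_left)
qed

lemma frac_laplacian_Cinf_compact_support:
  assumes "0 < s" "s < 1" and "Cinf_compact_support U \<phi>"
  shows "frac_laplacian c s \<phi> x = c * sym_laplacian s \<phi> x"
  unfolding frac_laplacian_def
proof (rule the_equality)
  show h: "has_frac_laplacian c s \<phi> x (c * sym_laplacian s \<phi> x)"
    by (rule has_frac_laplacian_Cinf_compact_support[OF assms])
  show "l = c * sym_laplacian s \<phi> x" if "has_frac_laplacian c s \<phi> x l" for l
    using h that unfolding has_frac_laplacian_def
    by (blast intro: tendsto_unique[OF trivial_limit_at_right_real])
qed

lemma Cinf_compact_support_admissible:
  assumes s: "0 < s" "s < 1" and \<phi>: "Cinf_compact_support \<Omega> \<phi>"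
  shows "admissible_test c s \<Omega> \<phi>"
proof -
  obtain B where B: "\<And>x. \<bar>\<phi> x\<bar> \<le> B" using Cinf_compact_support_bounded[OF \<phi>] by metis
  obtain C where C: "\<And>x. \<bar>sym_laplacian s \<phi> x\<bar> \<le> C" using truncated_laplacian_bounded[OF s \<phi>] by metis
  obtain K where K: "K \<subseteq> \<Omega>" "\<And>x. x \<notin> K \<Longrightarrow> \<phi> x = 0" using \<phi> by (rule Cinf_compact_supportE) blast
  have "\<phi> \<in> borel_measurable lebesgue"
    using Cinf_compact_support_measurable[OF \<phi>] by (simp add: measurable_completion)
  moreover have "bounded (\<phi> ` \<Omega>)" using B by (auto simp: bounded_iff)
  moreover have "bounded (frac_laplacian c s \<phi> ` \<Omega>)"
    unfolding frac_laplacian_Cinf_compact_support[OF s \<phi>] bounded_iff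
    using mult_left_mono[OF C abs_ge_zero[of c]] by (auto simp: abs_mult)
  moreover have "\<forall>x\<in>\<Omega>. \<exists>l. has_frac_laplacian c s \<phi> x l"
    using has_frac_laplacian_Cinf_compact_support[OF s \<phi>] by blast
  moreover have "\<forall>x. x \<notin> \<Omega> \<longrightarrow> \<phi> x = 0" using K by blast
  ultimately show ?thesis by (simp add: admissible_test_def)
qed

lemma sym_laplacian_measurable [measurable]:
  fixes \<phi> :: "'a::euclidean_space \<Rightarrow> real"
  assumes [measurable]: "\<phi> \<in> borel_measurable borel"
  shows "sym_laplacian s \<phi> \<in> borel_measurable borel"
proof -
  have "(\<lambda>(x, h). (2 * \<phi> x - \<phi> (x + h) - \<phi> (x - h)) / (2 * norm h powr (real DIM('a) + 2 * s)))
      \<in> borel_measurable (borel \<Otimes>\<^sub>M lborel)"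
    by measurable
  then show ?thesis
    unfolding sym_laplacian_def[abs_def] by (rule lborel.borel_measurable_lebesgue_integral)
qed

text \<open>The principal value is truncated at \<open>dist x y > \<epsilon>\<close>, where Fubini applies, and then symmetrized
  by swapping \<open>x\<close> and \<open>y\<close>.\<close>

lemma integral_mult_sym_laplacian:
  fixes w \<phi> :: "'a::euclidean_space \<Rightarrow> real"
  assumes s: "0 < s" "s < 1" and w: "finite_energy s w" and wint: "integrable lborel w"
    and \<phi>: "Cinf_compact_support U \<phi>"
  shows "(\<integral>x. w x * sym_laplacian s \<phi> x \<partial>lborel) = (\<integral>p. gagliardo s w p * gagliardo s \<phi> p \<partial>lborel) / 2"
proof -
  note [measurable] = Cinf_compact_support_measurable[OF \<phi>] finite_energy_measurable[OF w]
  obtain B where B: "\<And>x. \<bar>\<phi> x\<bar> \<le> B" using Cinf_compact_support_bounded[OF \<phi>] by metis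
  have B0: "0 \<le> B" using order_trans[OF abs_ge_zero B] .
  define \<epsilon> where "\<epsilon> = (\<lambda>j. 1 / real (Suc j))"
  have \<epsilon>: "0 < \<epsilon> j" for j by (simp add: \<epsilon>_def)
  have \<epsilon>0: "\<epsilon> \<longlonglongrightarrow> 0" unfolding \<epsilon>_def using LIMSEQ_inverse_real_of_nat by (simp add: inverse_eq_divide)
  define A where "A = (\<lambda>j x y. w x * (indicator {y. \<epsilon> j < dist x y} y * diff_quot s \<phi> x y))"
  have [measurable]: "(\<lambda>p. A j (fst p) (snd p)) \<in> borel_measurable borel" for j
    unfolding A_def diff_quot_def by (simp add: indicator_def) 
  have A: "integrable lborel (\<lambda>p. A j (fst p) (snd p))" for j
  proof (rule Bochner_Integration.integrable_bound)
    let ?C = "2 * B * (1 + 1 / (\<epsilon> j)\<^sup>2)"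
    show "integrable lborel (\<lambda>p. ?C * (w (fst p) * sq_cap_kernel s (fst p - snd p)))"
      using integrable_weighted_sq_cap_kernel(1)[OF s wint] by simp
    show "AE p in lborel. norm (A j (fst p) (snd p)) \<le> norm (?C * (w (fst p) * sq_cap_kernel s (fst p - snd p)))"
    proof (rule AE_I2)
      fix p :: "'a \<times> 'a"
      have "\<bar>w (fst p)\<bar> * \<bar>indicator {y. \<epsilon> j < dist (fst p) y} (snd p) * diff_quot s \<phi> (fst p) (snd p)\<bar>
          \<le> \<bar>w (fst p)\<bar> * (?C * sq_cap_kernel s (fst p - snd p))"
        by (intro mult_left_mono truncated_diff_quot_le[OF B \<epsilon>]) simp
      moreover have "0 \<le> ?C" using B0 by simp
      ultimately show "norm (A j (fst p) (snd p)) \<le> norm (?C * (w (fst p) * sq_cap_kernel s (fst p - snd p)))"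
        using B0 by (simp add: A_def abs_mult sq_cap_kernel_nonneg mult_ac)
    qed
  qed measurable
  then have A': "integrable (lborel \<Otimes>\<^sub>M lborel) (\<lambda>(x, y). A j x y)" for j
    by (simp add: lborel_prod case_prod_beta')
  have 1: "(\<integral>p. A j (fst p) (snd p) \<partial>lborel) = (\<integral>x. w x * truncated_laplacian (\<epsilon> j) s \<phi> x \<partial>lborel)" for j
  proof -
    have "(\<integral>p. A j (fst p) (snd p) \<partial>lborel) = (\<integral>x. \<integral>y. A j x y \<partial>lborel \<partial>lborel)"
      using lborel_pair.integral_fst[OF A'[of j]] by (simp add: lborel_prod case_prod_beta')
    then show ?thesis by (simp add: A_def truncated_laplacian_def)
  qed
  have swap: "(\<integral>p. A j (snd p) (fst p) \<partial>lborel) = (\<integral>p. A j (fst p) (snd p) \<partial>lborel)"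
    and swap_int: "integrable lborel (\<lambda>p. A j (snd p) (fst p))" for j
  proof -
    show "(\<integral>p. A j (snd p) (fst p) \<partial>lborel) = (\<integral>p. A j (fst p) (snd p) \<partial>lborel)"
      using lborel_pair.integral_product_swap[of "\<lambda>(x, y). A j x y"] A'[of j]
      by (simp add: lborel_prod case_prod_beta')
    show "integrable lborel (\<lambda>p. A j (snd p) (fst p))"
      using lborel_pair.integrable_product_swap[OF A'[of j]] by (simp add: lborel_prod case_prod_beta')
  qed
  \<comment> \<open>Adding the swapped integrand turns \<open>w x * (\<phi> x - \<phi> y)\<close>
    into \<open>(w x - w y) * (\<phi> x - \<phi> y)\<close>. Both summands have the same integral,
    which is the origin of the factor 1/2.\<close>
  have sum: "A j (fst p) (snd p) + A j (snd p) (fst p) =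
      indicator {p. \<epsilon> j < dist (fst p) (snd p)} p * (gagliardo s w p * gagliardo s \<phi> p)" for j p
    by (simp add: A_def gagliardo_mult_gagliardo diff_quot_def indicator_def dist_commute norm_minus_commute
        add_divide_distrib[symmetric]) (simp add: algebra_simps)
  have gg: "integrable lborel (\<lambda>p. gagliardo s w p * gagliardo s \<phi> p)"
    using w Cinf_compact_support_finite_energy[OF s \<phi>] by (auto simp: finite_energy_def intro: sq_integrable_mult)
  have "(\<lambda>j. \<integral>p. indicator {p. \<epsilon> j < dist (fst p) (snd p)} p * (gagliardo s w p * gagliardo s \<phi> p) \<partial>lborel)
      \<longlonglongrightarrow> (\<integral>p. gagliardo s w p * gagliardo s \<phi> p \<partial>lborel)"
  proof (rule integral_dominated_convergence)
    show "integrable lborel (\<lambda>p. \<bar>gagliardo s w p * gagliardo s \<phi> p\<bar>)" using gg by simp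
    show "AE p in lborel. (\<lambda>j. indicator {p. \<epsilon> j < dist (fst p) (snd p)} p * (gagliardo s w p * gagliardo s \<phi> p))
        \<longlonglongrightarrow> gagliardo s w p * gagliardo s \<phi> p"
    proof (rule AE_I2)
      fix p :: "'a \<times> 'a"
      show "(\<lambda>j. indicator {p. \<epsilon> j < dist (fst p) (snd p)} p * (gagliardo s w p * gagliardo s \<phi> p))
        \<longlonglongrightarrow> gagliardo s w p * gagliardo s \<phi> p"
      proof (cases "fst p = snd p")
        case False
        then have "\<forall>\<^sub>F j in sequentially. \<epsilon> j < dist (fst p) (snd p)" by (intro order_tendstoD(2)[OF \<epsilon>0]) simp
        then have "\<forall>\<^sub>F j in sequentially. indicator {p. \<epsilon> j < dist (fst p) (snd p)} p *
            (gagliardo s w p * gagliardo s \<phi> p) = gagliardo s w p * gagliardo s \<phi> p"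
          by eventually_elim simp
        then show ?thesis by (rule tendsto_eventually)
      qed (simp add: gagliardo_def)
    qed
    show "AE p in lborel. norm (indicator {p. \<epsilon> j < dist (fst p) (snd p)} p * (gagliardo s w p * gagliardo s \<phi> p))
        \<le> \<bar>gagliardo s w p * gagliardo s \<phi> p\<bar>" for j
      by (rule AE_I2) (simp add: indicator_def)
  qed measurable
  moreover have "(\<integral>p. indicator {p. \<epsilon> j < dist (fst p) (snd p)} p * (gagliardo s w p * gagliardo s \<phi> p) \<partial>lborel) =
      2 * (\<integral>x. w x * truncated_laplacian (\<epsilon> j) s \<phi> x \<partial>lborel)" for j
    using A[of j] swap_int[of j] swap[of j] 1[of j] unfolding sum[symmetric] by simp
  ultimately have lim1: "(\<lambda>j. 2 * (\<integral>x. w x * truncated_laplacian (\<epsilon> j) s \<phi> x \<partial>lborel))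
      \<longlonglongrightarrow> (\<integral>p. gagliardo s w p * gagliardo s \<phi> p \<partial>lborel)" by simp
  obtain C where C: "\<And>\<epsilon> x. 0 < \<epsilon> \<Longrightarrow> \<bar>truncated_laplacian \<epsilon> s \<phi> x\<bar> \<le> C"
    using truncated_laplacian_bounded[OF s \<phi>] by metis
  have [measurable]: "truncated_laplacian (\<epsilon> j) s \<phi> \<in> borel_measurable borel" for j
  proof -
    have "(\<lambda>(x, y). indicator {y. \<epsilon> j < dist x y} y * diff_quot s \<phi> x y) \<in> borel_measurable (borel \<Otimes>\<^sub>M lborel)"
      unfolding diff_quot_def indicator_def by simp
    then show ?thesis
      unfolding truncated_laplacian_def[abs_def] by (rule lborel.borel_measurable_lebesgue_integral)
  qed
  have "(\<lambda>j. \<integral>x. w x * truncated_laplacian (\<epsilon> j) s \<phi> x \<partial>lborel) \<longlonglongrightarrow> (\<integral>x. w x * sym_laplacian s \<phi> x \<partial>lborel)"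
  proof (rule integral_dominated_convergence)
    show "integrable lborel (\<lambda>x. \<bar>w x\<bar> * C)" using wint by simp
    show "AE x in lborel. (\<lambda>j. w x * truncated_laplacian (\<epsilon> j) s \<phi> x) \<longlonglongrightarrow> w x * sym_laplacian s \<phi> x"
      by (intro AE_I2 tendsto_mult_left truncated_laplacian_tendsto[OF s \<phi> \<epsilon> \<epsilon>0])
    show "AE x in lborel. norm (w x * truncated_laplacian (\<epsilon> j) s \<phi> x) \<le> \<bar>w x\<bar> * C" for j
      by (intro AE_I2) (auto simp: abs_mult intro!: mult_left_mono C \<epsilon>)
  qed measurable
  from LIMSEQ_unique[OF tendsto_mult_left[OF this, of 2] lim1] show ?thesis by simp
qed

section \<open>Convexity and Borel representatives\<close>

lemma C1_differentiable_deriv: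
  fixes f :: "real \<Rightarrow> real"
  assumes "f C1_differentiable_on UNIV"
  shows "(f has_real_derivative deriv f x) (at x)" and "continuous_on UNIV (deriv f)"
proof -
  obtain D where D: "\<And>x. (f has_vector_derivative D x) (at x)" "continuous_on UNIV D"
    using assms unfolding C1_differentiable_on_def by auto
  have d: "(f has_real_derivative D x) (at x)" for x
    using D(1) by (simp add: has_real_derivative_iff_has_vector_derivative)
  then have "deriv f = D" using DERIV_imp_deriv by blast
  then show "(f has_real_derivative deriv f x) (at x)" "continuous_on UNIV (deriv f)" using d D by auto
qed

text \<open>The strict form comes from the midpoint: there the weak tangent inequality bounds
  \<open>f\<close> from below, while strict convexity bounds it strictly from above by the mean of
  the end values.\<close>

lemma strictly_convex_above_tangent:
  assumes f: "f C1_differentiable_on UNIV" and cvx: "strictly_convex f"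
  shows "f x + deriv f x * (y - x) \<le> f y"
    and "x \<noteq> y \<Longrightarrow> f x + deriv f x * (y - x) < f y"
proof -
  have "convex_on UNIV f"
  proof (rule convex_onI)
    fix t a b :: real assume t: "0 < t" "t < 1"
    show "f ((1 - t) *\<^sub>R a + t *\<^sub>R b) \<le> (1 - t) * f a + t * f b"
    proof (cases "a = b")
      case False
      then have "f ((1 - t) * a + t * b) < (1 - t) * f a + t * f b"
        using cvx t unfolding strictly_convex_def by blast
      then show ?thesis by simp
    qed (simp add: algebra_simps)
  qed simp
  then have tangent: "f x + deriv f x * (y - x) \<le> f y" for y
    using convex_on_imp_above_tangent[of UNIV f x y "deriv f x"] C1_differentiable_deriv(1)[OF f, of x]
    by simp
  then show "f x + deriv f x * (y - x) \<le> f y" .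
  assume "x \<noteq> y"
  then have "f ((1 - 1/2) * x + (1/2) * y) < (1 - 1/2) * f x + (1/2) * f y"
    using cvx[unfolded strictly_convex_def, rule_format, of x y "1/2"] by simp
  then have "f ((x + y) / 2) < f x / 2 + f y / 2" by (simp add: add_divide_distrib)
  moreover have "f x + deriv f x * ((x + y) / 2 - x) \<le> f ((x + y) / 2)" by (rule tangent)
  moreover have "deriv f x * ((x + y) / 2 - x) = deriv f x * (y - x) / 2" by (simp add: field_simps)
  ultimately show "f x + deriv f x * (y - x) < f y" by linarith
qed

lemma strictly_convex_deriv_mono:
  assumes f: "f C1_differentiable_on UNIV" and cvx: "strictly_convex f" and "x \<le> y"
  shows "deriv f x \<le> deriv f y"
proof (cases "x = y")
  case False
  have "f x + deriv f x * (y - x) \<le> f y" "f y + deriv f y * (x - y) \<le> f x"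
    by (rule strictly_convex_above_tangent(1)[OF f cvx])+
  then have "deriv f x * (y - x) \<le> deriv f y * (y - x)" by (simp add: algebra_simps)
  then show ?thesis using False \<open>x \<le> y\<close> by simp
qed simp

section \<open>Borel representatives and passage to the global energy\<close>

lemma AE_lborel_fst_snd:
  assumes "AE x in lborel. P (x :: 'a::euclidean_space)"
  shows "AE p in lborel. P (fst p) \<and> P (snd p)"
proof -
  obtain N where N: "{x. \<not> P x} \<subseteq> N" "N \<in> null_sets lborel"
    using assms by (auto elim!: AE_E simp: null_sets_def)
  then have [measurable]: "N \<in> sets borel" by auto
  have z: "emeasure lborel N = 0" using N(2) by auto
  have "N \<times> UNIV \<in> sets (borel \<Otimes>\<^sub>M (borel :: 'a measure))" "UNIV \<times> N \<in> sets ((borel :: 'a measure) \<Otimes>\<^sub>M borel)"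
    by (auto intro: pair_measureI)
  then have m: "N \<times> UNIV \<in> sets (borel :: ('a \<times> 'a) measure)" "UNIV \<times> N \<in> sets (borel :: ('a \<times> 'a) measure)"
    unfolding borel_prod .
  have "N \<times> UNIV \<in> null_sets (lborel :: ('a \<times> 'a) measure)"
    using lborel.emeasure_pair_measure_Times[of N lborel UNIV] z m(1)
    by (intro null_setsI) (simp_all add: lborel_prod)
  moreover have "UNIV \<times> N \<in> null_sets (lborel :: ('a \<times> 'a) measure)"
    using lborel.emeasure_pair_measure_Times[of UNIV lborel N] z m(2)
    by (intro null_setsI) (simp_all add: lborel_prod)
  ultimately have "N \<times> UNIV \<union> UNIV \<times> N \<in> null_sets (lborel :: ('a \<times> 'a) measure)" by (rule null_sets.Un)
  then show ?thesis by (rule AE_I') (use N(1) in auto)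
qed

lemma lebesgue_borel_version:
  fixes u :: "'a::euclidean_space \<Rightarrow> real"
  assumes "u \<in> borel_measurable lebesgue"
  obtains u' where "u' \<in> borel_measurable borel" "AE x in lborel. u x = u' x"
  using completion_ex_borel_measurable_real[OF assms] that by auto

lemma integral_lebesgue_borel_version:
  fixes h :: "'a::euclidean_space \<Rightarrow> real"
  assumes h: "h \<in> borel_measurable lebesgue" and h': "h' \<in> borel_measurable borel"
    and eq: "AE x in lborel. h x = h' x"
  shows "integral\<^sup>L lebesgue h = integral\<^sup>L lborel h'"
    and "integrable lebesgue h \<longleftrightarrow> integrable lborel h'"
proof -
  have m: "h' \<in> borel_measurable lebesgue" using h' by (simp add: measurable_completion)
  have ae: "AE x in lebesgue. h x = h' x" using eq by (simp add: AE_completion_iff)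
  show "integral\<^sup>L lebesgue h = integral\<^sup>L lborel h'"
    using integral_cong_AE[OF h m ae] integral_completion[of h' lborel] h' by simp
  show "integrable lebesgue h \<longleftrightarrow> integrable lborel h'"
    using integrable_cong_AE[OF h m ae] integrable_completion[of h' lborel] h' by simp
qed

lemma Hs_space_borel_version:
  fixes u :: "'a::euclidean_space \<Rightarrow> real"
  assumes u: "u \<in> Hs_space c s \<Omega>" and c: "0 < c" and [measurable]: "\<Omega> \<in> sets borel"
    and [measurable]: "u' \<in> borel_measurable borel" and eq: "AE x in lborel. u x = u' x"
  shows "integrable lborel (\<lambda>x. (indicator \<Omega> x * u' x)\<^sup>2)"
    and "(\<integral>\<^sup>+p. ennreal ((gagliardo s u' p)\<^sup>2) * indicator (- ((- \<Omega>) \<times> (- \<Omega>))) p \<partial>lborel) < \<infinity>"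
proof -
  have um: "u \<in> borel_measurable lebesgue" using u by (simp add: Hs_space_def)
  have [measurable]: "\<Omega> \<in> sets lebesgue" using \<open>\<Omega> \<in> sets borel\<close> by (simp add: sets_completionI_sets)
  note [measurable] = um
  have i: "integrable lebesgue (\<lambda>x. indicator \<Omega> x *\<^sub>R (u x)\<^sup>2)"
    using u by (simp add: Hs_space_def set_integrable_def)
  have ae: "AE x in lborel. indicator \<Omega> x *\<^sub>R (u x)\<^sup>2 = (indicator \<Omega> x * u' x)\<^sup>2"
    using eq by eventually_elim (simp add: power_mult_distrib indicator_def)
  show "integrable lborel (\<lambda>x. (indicator \<Omega> x * u' x)\<^sup>2)"
    using integral_lebesgue_borel_version(2)[OF borel_measurable_integrable[OF i] _ ae] i by simp
  let ?I = "\<lambda>w p. ennreal (\<bar>w (fst p) - w (snd p)\<bar>\<^sup>2 / norm (fst p - snd p) powr (real DIM('a) + 2 * s)) *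
      indicator (- ((- \<Omega>) \<times> (- \<Omega>))) p"
  have "ennreal (c / 2) * (\<integral>\<^sup>+p. ?I u p \<partial>lebesgue) < \<infinity>"
    using u by (simp add: Hs_space_def Hs_seminorm_sq_def)
  then have "(\<integral>\<^sup>+p. ?I u p \<partial>lborel) < \<infinity>"
    using c by (auto simp: nn_integral_completion ennreal_mult_less_top)
  moreover have "(\<integral>\<^sup>+p. ?I u p \<partial>lborel) =
      (\<integral>\<^sup>+p. ennreal ((gagliardo s u' p)\<^sup>2) * indicator (- ((- \<Omega>) \<times> (- \<Omega>))) p \<partial>lborel)"
  proof (rule nn_integral_cong_AE)
    show "AE p in lborel. ?I u p = ennreal ((gagliardo s u' p)\<^sup>2) * indicator (- ((- \<Omega>) \<times> (- \<Omega>))) p"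
      using AE_lborel_fst_snd[OF eq] by eventually_elim (simp add: gagliardo_sq)
  qed
  ultimately show "(\<integral>\<^sup>+p. ennreal ((gagliardo s u' p)\<^sup>2) * indicator (- ((- \<Omega>) \<times> (- \<Omega>))) p \<partial>lborel) < \<infinity>"
    by simp
qed

text \<open>Pairs with both points outside \<open>\<Omega>\<close> are missing from the seminorm,
  but there the difference vanishes and so does its quotient. On all other pairs the square of a
  difference is at most twice the sum of the squares.\<close>

lemma Hs_space_difference_finite_energy:
  fixes u v :: "'a::euclidean_space \<Rightarrow> real"
  assumes u: "u \<in> Hs_space c s \<Omega>" and v: "v \<in> Hs_space c s \<Omega>" and c: "0 < c"
    and \<Omega> [measurable]: "\<Omega> \<in> sets borel"
    and m [measurable]: "u' \<in> borel_measurable borel" "v' \<in> borel_measurable borel"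
    and eq: "AE x in lborel. u x = u' x" "AE x in lborel. v x = v' x"
    and out: "AE x in lborel. x \<notin> \<Omega> \<longrightarrow> u x = v x"
  shows "finite_energy s (\<lambda>x. indicator \<Omega> x * (u' x - v' x))"
  unfolding finite_energy_def
proof
  let ?w = "\<lambda>x. indicator \<Omega> x * (u' x - v' x)"
  have "sq_integrable lborel (\<lambda>x. indicator \<Omega> x * u' x)" "sq_integrable lborel (\<lambda>x. indicator \<Omega> x * v' x)"
    using Hs_space_borel_version(1)[OF u c \<Omega> m(1) eq(1)] Hs_space_borel_version(1)[OF v c \<Omega> m(2) eq(2)]
    by (auto simp: sq_integrable_def)
  from sq_integrable_diff[OF this] show "sq_integrable lborel ?w"
    by (simp add: right_diff_distrib)
  let ?I = "indicator (- ((- \<Omega>) \<times> (- \<Omega>))) :: 'a \<times> 'a \<Rightarrow> ennreal"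
  have "(- \<Omega>) \<times> (- \<Omega>) \<in> sets (borel \<Otimes>\<^sub>M borel)" by (rule pair_measureI) measurable
  then have [measurable]: "(- \<Omega>) \<times> (- \<Omega>) \<in> sets (borel :: ('a \<times> 'a) measure)"
    unfolding borel_prod .
  have [measurable]: "- ((- \<Omega>) \<times> (- \<Omega>)) \<in> sets (borel :: ('a \<times> 'a) measure)" by (intro borel_comp) measurable
  have "AE x in lborel. ?w x = u' x - v' x"
    using eq out by eventually_elim (auto simp: indicator_def)
  from AE_lborel_fst_snd[OF this] have ae: "AE p in lborel. ennreal ((gagliardo s ?w p)\<^sup>2) \<le>
      2 * (ennreal ((gagliardo s u' p)\<^sup>2) * ?I p) + 2 * (ennreal ((gagliardo s v' p)\<^sup>2) * ?I p)"
  proof eventually_elim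
    case (elim p)
    show ?case
    proof (cases "p \<in> (- \<Omega>) \<times> (- \<Omega>)")
      case True
      then show ?thesis by (auto simp: gagliardo_def)
    next
      case False
      have e: "gagliardo s ?w p = gagliardo s u' p - gagliardo s v' p"
        unfolding gagliardo_def elim[THEN conjunct1] elim[THEN conjunct2] by (simp add: diff_divide_distrib)
      have "(gagliardo s ?w p)\<^sup>2 \<le> 2 * (gagliardo s u' p)\<^sup>2 + 2 * (gagliardo s v' p)\<^sup>2"
        unfolding e using zero_le_power2[of "gagliardo s u' p + gagliardo s v' p"]
        by (simp add: power2_eq_square algebra_simps)
      then have "ennreal ((gagliardo s ?w p)\<^sup>2) \<le> ennreal (2 * (gagliardo s u' p)\<^sup>2 + 2 * (gagliardo s v' p)\<^sup>2)"
        by (rule ennreal_leI)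
      also have "\<dots> = 2 * ennreal ((gagliardo s u' p)\<^sup>2) + 2 * ennreal ((gagliardo s v' p)\<^sup>2)"
        by (simp add: ennreal_plus ennreal_mult')
      finally show ?thesis using False by simp
    qed
  qed
  have "(\<integral>\<^sup>+p. ennreal ((gagliardo s ?w p)\<^sup>2) \<partial>lborel) \<le>
      (\<integral>\<^sup>+p. 2 * (ennreal ((gagliardo s u' p)\<^sup>2) * ?I p) + 2 * (ennreal ((gagliardo s v' p)\<^sup>2) * ?I p) \<partial>lborel)"
    by (rule nn_integral_mono_AE[OF ae])
  also have "\<dots> = 2 * (\<integral>\<^sup>+p. ennreal ((gagliardo s u' p)\<^sup>2) * ?I p \<partial>lborel) +
      2 * (\<integral>\<^sup>+p. ennreal ((gagliardo s v' p)\<^sup>2) * ?I p \<partial>lborel)"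
    by (simp add: nn_integral_add nn_integral_cmult)
  also have "\<dots> < \<infinity>"
    using Hs_space_borel_version(2)[OF u c \<Omega> m(1) eq(1)] Hs_space_borel_version(2)[OF v c \<Omega> m(2) eq(2)]
    by (simp add: ennreal_mult_less_top)
  finally show "sq_integrable lborel (gagliardo s ?w)" by (intro sq_integrableI_bounded) measurable
qed

lemma Hs_seminorm_sq_Cinf_compact_support:
  fixes \<xi> :: "'a::euclidean_space \<Rightarrow> real"
  assumes s: "0 < s" "s < 1" and c: "0 < c" and \<xi>: "Cinf_compact_support \<Omega> \<xi>"
  shows "Hs_seminorm_sq c s \<Omega> \<xi> = ennreal (c / 2 * (\<integral>p. (gagliardo s \<xi> p)\<^sup>2 \<partial>lborel))"
proof -
  obtain K where K: "K \<subseteq> \<Omega>" "\<And>x. x \<notin> K \<Longrightarrow> \<xi> x = 0" using \<xi> by (rule Cinf_compact_supportE) blast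
  have z: "\<xi> x = 0" if "x \<notin> \<Omega>" for x using K that by blast
  have "Hs_seminorm_sq c s \<Omega> \<xi> = ennreal (c / 2) * (\<integral>\<^sup>+p. ennreal ((gagliardo s \<xi> p)\<^sup>2) \<partial>lborel)"
    unfolding Hs_seminorm_sq_def nn_integral_completion
    by (intro arg_cong2[where f="(*)"] refl nn_integral_cong) (auto simp: gagliardo_sq indicator_def z)
  also have "\<dots> = ennreal (c / 2) * ennreal (\<integral>p. (gagliardo s \<xi> p)\<^sup>2 \<partial>lborel)"
    using sq_integrable_nn_integral[of lborel "gagliardo s \<xi>"] Cinf_compact_support_finite_energy[OF s \<xi>]
    by (simp add: finite_energy_def)
  also have "\<dots> = ennreal (c / 2 * (\<integral>p. (gagliardo s \<xi> p)\<^sup>2 \<partial>lborel))"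
    by (rule ennreal_mult'[symmetric]) (use c in simp)
  finally show ?thesis .
qed

text \<open>Young's inequality with the factor of \<open>a\<^sup>2\<close> arbitrarily close to 1,
  as needed to carry the stability inequality to a limit without loss in its constant.\<close>

lemma sq_add_le_weighted:
  fixes a b \<delta> :: real
  assumes "0 < \<delta>"
  shows "(a + b)\<^sup>2 \<le> (1 + \<delta>) * a\<^sup>2 + (1 + 1 / \<delta>) * b\<^sup>2"
proof -
  have "0 \<le> (\<delta> * a - b)\<^sup>2 / \<delta>" using assms by simp
  also have "\<dots> = \<delta> * a\<^sup>2 - 2 * a * b + (1 / \<delta>) * b\<^sup>2"
    using assms by (simp add: power2_eq_square field_simps)
  finally show ?thesis by (simp add: power2_sum distrib_right)
qed

lemma abs_mult_le_weighted:
  fixes a b \<delta> :: real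
  assumes "0 < \<delta>"
  shows "\<bar>a * b\<bar> \<le> \<delta> * a\<^sup>2 + (1 / \<delta>) * b\<^sup>2"
proof -
  have "0 \<le> (\<delta> * \<bar>a\<bar> - \<bar>b\<bar>)\<^sup>2 / \<delta>" using assms by simp
  also have "\<dots> = \<delta> * a\<^sup>2 - 2 * \<bar>a * b\<bar> + (1 / \<delta>) * b\<^sup>2"
    using assms by (simp add: power2_eq_square field_simps abs_mult)
  finally show ?thesis by linarith
qed

lemma integral_sq_add_le_weighted:
  assumes f: "sq_integrable M f" and g: "sq_integrable M g" and "0 < \<delta>"
  shows "(\<integral>x. (f x + g x)\<^sup>2 \<partial>M) \<le> (1 + \<delta>) * (\<integral>x. (f x)\<^sup>2 \<partial>M) + (1 + 1 / \<delta>) * (\<integral>x. (g x)\<^sup>2 \<partial>M)"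
proof -
  have "(\<integral>x. (f x + g x)\<^sup>2 \<partial>M) \<le> (\<integral>x. (1 + \<delta>) * (f x)\<^sup>2 + (1 + 1 / \<delta>) * (g x)\<^sup>2 \<partial>M)"
    using sq_integrable_integrable[OF sq_integrable_add[OF f g]] sq_integrable_integrable[OF f]
      sq_integrable_integrable[OF g]
    by (intro Bochner_Integration.integral_mono sq_add_le_weighted \<open>0 < \<delta>\<close>) auto
  also have "\<dots> = (1 + \<delta>) * (\<integral>x. (f x)\<^sup>2 \<partial>M) + (1 + 1 / \<delta>) * (\<integral>x. (g x)\<^sup>2 \<partial>M)"
    using sq_integrable_integrable[OF f] sq_integrable_integrable[OF g] by simp
  finally show ?thesis .
qed

text \<open>Cauchy-Schwarz in additive form, with \<open>\<delta>\<close> left to be chosen later.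
  The integrand \<open>h\<close> is only dominated by the product, since the difference of nonlinear
  terms is merely bounded.\<close>

lemma abs_integral_mult_le_weighted:
  assumes f: "sq_integrable M f" and g: "sq_integrable M g" and "0 < \<delta>"
    and h: "integrable M h" "AE x in M. \<bar>h x\<bar> \<le> \<bar>f x * g x\<bar>"
  shows "\<bar>\<integral>x. h x \<partial>M\<bar> \<le> \<delta> * (\<integral>x. (f x)\<^sup>2 \<partial>M) + (1 / \<delta>) * (\<integral>x. (g x)\<^sup>2 \<partial>M)"
proof -
  have "\<bar>\<integral>x. h x \<partial>M\<bar> \<le> (\<integral>x. \<bar>h x\<bar> \<partial>M)" by (rule integral_abs_bound)
  also have "\<dots> \<le> (\<integral>x. \<delta> * (f x)\<^sup>2 + (1 / \<delta>) * (g x)\<^sup>2 \<partial>M)"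
  proof (rule integral_mono_AE)
    show "integrable M (\<lambda>x. \<bar>h x\<bar>)" using h by simp
    show "integrable M (\<lambda>x. \<delta> * (f x)\<^sup>2 + (1 / \<delta>) * (g x)\<^sup>2)"
      using sq_integrable_integrable[OF f] sq_integrable_integrable[OF g] by simp
    show "AE x in M. \<bar>h x\<bar> \<le> \<delta> * (f x)\<^sup>2 + (1 / \<delta>) * (g x)\<^sup>2"
      using h(2) by eventually_elim (rule order_trans[OF _ abs_mult_le_weighted[OF \<open>0 < \<delta>\<close>]])
  qed
  also have "\<dots> = \<delta> * (\<integral>x. (f x)\<^sup>2 \<partial>M) + (1 / \<delta>) * (\<integral>x. (g x)\<^sup>2 \<partial>M)"
    using sq_integrable_integrable[OF f] sq_integrable_integrable[OF g] by simp
  finally show ?thesis .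
qed

section \<open>Stability and the weak equation for energy functions\<close>

text \<open>\<open>M\<close> shifts the potential: \<open>f' \<circ> u\<close> is bounded below, so \<open>f' \<circ> u + M \<ge> 0\<close> for some \<open>M\<close>,
  and Fatou applies.\<close>

definition stability_form :: "real \<Rightarrow> real \<Rightarrow> real \<Rightarrow> ('a::euclidean_space \<Rightarrow> real) \<Rightarrow> real" where
  "stability_form c s M z = c / 2 * (\<integral>p. (gagliardo s z p)\<^sup>2 \<partial>lborel) + M * (\<integral>x. (z x)\<^sup>2 \<partial>lborel)"

lemma stability_form_le_energy:
  assumes "0 < c" "0 \<le> M"
  shows "stability_form c s M z \<le> (c + M) * energy s z"
proof -
  let ?a = "\<integral>p. (gagliardo s z p)\<^sup>2 \<partial>lborel" and ?b = "\<integral>x. (z x)\<^sup>2 \<partial>lborel"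
  have nn: "0 \<le> ?a" "0 \<le> ?b" by (auto intro: Bochner_Integration.integral_nonneg)
  have "c / 2 * ?a \<le> (c + M) * ?a" by (rule mult_right_mono[OF _ nn(1)]) (use assms in simp)
  moreover have "M * ?b \<le> (c + M) * ?b" by (rule mult_right_mono[OF _ nn(2)]) (use assms in simp)
  ultimately show ?thesis unfolding stability_form_def energy_def distrib_left by linarith
qed

lemma stability_form_nonneg: "0 < c \<Longrightarrow> 0 \<le> M \<Longrightarrow> 0 \<le> stability_form c s M z"
  unfolding stability_form_def
  by (intro add_nonneg_nonneg mult_nonneg_nonneg Bochner_Integration.integral_nonneg) auto

lemma stability_form_add_le:
  assumes c: "0 < c" "0 \<le> M" and f: "finite_energy s f" and g: "finite_energy s g" and \<delta>: "0 < \<delta>"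
  shows "stability_form c s M (\<lambda>x. f x + g x) \<le>
    (1 + \<delta>) * stability_form c s M f + (1 + 1 / \<delta>) * stability_form c s M g"
proof -
  have f2: "sq_integrable lborel f" "sq_integrable lborel (gagliardo s f)" using f by (auto simp: finite_energy_def)
  have g2: "sq_integrable lborel g" "sq_integrable lborel (gagliardo s g)" using g by (auto simp: finite_energy_def)
  have "c / 2 * (\<integral>p. (gagliardo s f p + gagliardo s g p)\<^sup>2 \<partial>lborel) \<le>
      c / 2 * ((1 + \<delta>) * (\<integral>p. (gagliardo s f p)\<^sup>2 \<partial>lborel) + (1 + 1 / \<delta>) * (\<integral>p. (gagliardo s g p)\<^sup>2 \<partial>lborel))"
    using c by (intro mult_left_mono integral_sq_add_le_weighted f2 g2 \<delta>) auto
  moreover have "M * (\<integral>x. (f x + g x)\<^sup>2 \<partial>lborel) \<le>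
      M * ((1 + \<delta>) * (\<integral>x. (f x)\<^sup>2 \<partial>lborel) + (1 + 1 / \<delta>) * (\<integral>x. (g x)\<^sup>2 \<partial>lborel))"
    using c by (intro mult_left_mono integral_sq_add_le_weighted f2 g2 \<delta>) auto
  moreover have "k * (p * X + q * Y) + M * (p * X' + q * Y') = p * (k * X + M * X') + q * (k * Y + M * Y')"
    for k p q X Y X' Y' :: real by (simp add: algebra_simps)
  ultimately show ?thesis unfolding stability_form_def gagliardo_add by (smt (verit, best))
qed

text \<open>Energy convergence contains \<open>L^2\<close> convergence, and a subsequence converges
  almost everywhere, as Fatou requires.\<close>

lemma approximable_sequence:
  assumes s: "0 < s" "s < 1" and z: "finite_energy s z" "approximable s \<Omega> z"
  obtains \<xi> where "\<And>j::nat. Cinf_compact_support \<Omega> (\<xi> j)" "(\<lambda>j. energy s (\<lambda>x. z x - \<xi> j x)) \<longlonglongrightarrow> 0"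
    "AE x in lborel. (\<lambda>j. \<xi> j x) \<longlonglongrightarrow> z x"
proof -
  have "\<exists>\<xi>. Cinf_compact_support \<Omega> \<xi> \<and> energy s (\<lambda>x. z x - \<xi> x) < 1 / real (Suc j)" for j
    using z(2) unfolding approximable_def by simp
  then obtain \<zeta> where \<zeta>: "\<And>j. Cinf_compact_support \<Omega> (\<zeta> j)"
    "\<And>j. energy s (\<lambda>x. z x - \<zeta> j x) < 1 / real (Suc j)" by metis
  have lim: "(\<lambda>j. energy s (\<lambda>x. z x - \<zeta> j x)) \<longlonglongrightarrow> 0"
  proof (rule tendsto_sandwich[where f="\<lambda>_. 0" and h="\<lambda>j. 1 / real (Suc j)"])
    show "(\<lambda>j. 1 / real (Suc j)) \<longlonglongrightarrow> 0" using LIMSEQ_inverse_real_of_nat by (simp add: inverse_eq_divide)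
    show "\<forall>\<^sub>F j in sequentially. 0 \<le> energy s (\<lambda>x. z x - \<zeta> j x)" by (simp add: energy_nonneg)
    show "\<forall>\<^sub>F j in sequentially. energy s (\<lambda>x. z x - \<zeta> j x) \<le> 1 / real (Suc j)"
      using \<zeta>(2) by (intro always_eventually allI less_imp_le)
  qed simp
  have i: "sq_integrable lborel (\<lambda>x. z x - \<zeta> j x)" for j
    using finite_energy_diff[OF z(1) Cinf_compact_support_finite_energy[OF s \<zeta>(1)[of j]]]
    by (simp add: finite_energy_def)
  have "(\<lambda>j. \<integral>x. (z x - \<zeta> j x)\<^sup>2 \<partial>lborel) \<longlonglongrightarrow> 0"
  proof (rule tendsto_sandwich[OF _ _ _ lim, where f="\<lambda>_. 0"])
    show "\<forall>\<^sub>F j in sequentially. (\<integral>x. (z x - \<zeta> j x)\<^sup>2 \<partial>lborel) \<le> energy s (\<lambda>x. z x - \<zeta> j x)"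
      by (rule always_eventually) (auto simp: energy_def intro: Bochner_Integration.integral_nonneg)
  qed (auto intro: always_eventually Bochner_Integration.integral_nonneg)
  then have "\<exists>r. strict_mono r \<and> (AE x in lborel. (\<lambda>j. (z x - \<zeta> (r j) x)\<^sup>2) \<longlonglongrightarrow> 0)"
    using tendsto_L1_AE_subseq[of lborel "\<lambda>j x. (z x - \<zeta> j x)\<^sup>2"] sq_integrable_integrable[OF i] by simp
  then obtain r :: "nat \<Rightarrow> nat" where r: "strict_mono r" "AE x in lborel. (\<lambda>j. (z x - \<zeta> (r j) x)\<^sup>2) \<longlonglongrightarrow> 0"
    by blast
  show ?thesis
  proof (rule that[of "\<lambda>j. \<zeta> (r j)"])
    show "Cinf_compact_support \<Omega> (\<zeta> (r j))" for j by (rule \<zeta>(1))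
    show "(\<lambda>j. energy s (\<lambda>x. z x - \<zeta> (r j) x)) \<longlonglongrightarrow> 0"
      using LIMSEQ_subseq_LIMSEQ[OF lim r(1)] by (simp add: o_def)
    show "AE x in lborel. (\<lambda>j. \<zeta> (r j) x) \<longlonglongrightarrow> z x"
      using r(2)
    proof eventually_elim
      case (elim x)
      have "(\<lambda>j. \<bar>z x - \<zeta> (r j) x\<bar>) \<longlonglongrightarrow> 0" using tendsto_real_sqrt[OF elim] by simp
      then have "(\<lambda>j. z x - \<zeta> (r j) x) \<longlonglongrightarrow> 0" by (rule tendsto_rabs_zero_cancel)
      from tendsto_diff[OF tendsto_const[of "z x"] this] show ?case by simp
    qed
  qed
qed

text \<open>Fatou bounds the left side by the forms of the approximants. Splitting these as
  \<open>z\<close> plus an error costs a factor \<open>1 + \<delta>\<close> on the form of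
  \<open>z\<close> and \<open>1 + 1 / \<delta>\<close> on an error that tends to 0; letting
  \<open>\<delta>\<close> tend to 0 afterwards recovers the exact constant.\<close>

lemma nn_integral_le_stability_form:
  fixes a z :: "'a::euclidean_space \<Rightarrow> real"
  assumes s: "0 < s" "s < 1" and c: "0 < c" "0 \<le> M"
    and a [measurable]: "a \<in> borel_measurable borel" and a0: "\<And>x. 0 \<le> a x"
    and test: "\<And>\<xi>. Cinf_compact_support \<Omega> \<xi> \<Longrightarrow>
      (\<integral>\<^sup>+x. ennreal (a x * (\<xi> x)\<^sup>2) \<partial>lborel) \<le> ennreal (stability_form c s M \<xi>)"
    and z: "finite_energy s z" "approximable s \<Omega> z"
  shows "(\<integral>\<^sup>+x. ennreal (a x * (z x)\<^sup>2) \<partial>lborel) \<le> ennreal (stability_form c s M z)"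
proof -
  let ?X = "\<integral>\<^sup>+x. ennreal (a x * (z x)\<^sup>2) \<partial>lborel" and ?Q = "stability_form c s M"
  obtain \<xi> where \<xi>: "\<And>j. Cinf_compact_support \<Omega> (\<xi> j)" "(\<lambda>j. energy s (\<lambda>x. z x - \<xi> j x)) \<longlonglongrightarrow> 0"
    "AE x in lborel. (\<lambda>j. \<xi> j x) \<longlonglongrightarrow> z x"
    by (rule approximable_sequence[OF s z], rule that)
  note [measurable] = Cinf_compact_support_measurable[OF \<xi>(1)]
  have "?X = (\<integral>\<^sup>+x. liminf (\<lambda>j. ennreal (a x * (\<xi> j x)\<^sup>2)) \<partial>lborel)"
  proof (rule nn_integral_cong_AE)
    show "AE x in lborel. ennreal (a x * (z x)\<^sup>2) = liminf (\<lambda>j. ennreal (a x * (\<xi> j x)\<^sup>2))"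
      using \<xi>(3)
    proof eventually_elim
      case (elim x)
      then have "(\<lambda>j. ennreal (a x * (\<xi> j x)\<^sup>2)) \<longlonglongrightarrow> ennreal (a x * (z x)\<^sup>2)"
        by (intro tendsto_ennrealI tendsto_intros)
      then show ?case by (simp add: lim_imp_Liminf)
    qed
  qed
  also have "\<dots> \<le> liminf (\<lambda>j. \<integral>\<^sup>+x. ennreal (a x * (\<xi> j x)\<^sup>2) \<partial>lborel)"
    by (rule nn_integral_liminf) measurable
  finally have fatou: "?X \<le> liminf (\<lambda>j. \<integral>\<^sup>+x. ennreal (a x * (\<xi> j x)\<^sup>2) \<partial>lborel)" .
  have bound: "?X \<le> ennreal ((1 + \<delta>) * ?Q z)" if \<delta>: "0 < \<delta>" for \<delta>
  proof -
    define R where "R = (\<lambda>j. (1 + \<delta>) * ?Q z + (1 + 1 / \<delta>) * ((c + M) * energy s (\<lambda>x. z x - \<xi> j x)))"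
    have "(\<integral>\<^sup>+x. ennreal (a x * (\<xi> j x)\<^sup>2) \<partial>lborel) \<le> ennreal (R j)" for j
    proof -
      have f: "finite_energy s (\<lambda>x. \<xi> j x - z x)"
        by (intro finite_energy_diff z Cinf_compact_support_finite_energy[OF s \<xi>(1)])
      have sym: "?Q (\<lambda>x. \<xi> j x - z x) = ?Q (\<lambda>x. z x - \<xi> j x)"
        by (simp add: stability_form_def gagliardo_diff power2_commute)
      have "?Q (\<lambda>x. z x + (\<xi> j x - z x)) \<le> (1 + \<delta>) * ?Q z + (1 + 1 / \<delta>) * ?Q (\<lambda>x. \<xi> j x - z x)"
        by (rule stability_form_add_le[OF c z(1) f \<delta>])
      also have "\<dots> \<le> R j"
        unfolding R_def sym using \<delta> by (intro add_left_mono mult_left_mono stability_form_le_energy c) auto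
      finally have "?Q (\<xi> j) \<le> R j" by simp
      then show ?thesis using test[OF \<xi>(1)[of j]] ennreal_leI order_trans by blast
    qed
    then have "liminf (\<lambda>j. \<integral>\<^sup>+x. ennreal (a x * (\<xi> j x)\<^sup>2) \<partial>lborel) \<le> liminf (\<lambda>j. ennreal (R j))"
      by (intro Liminf_mono) auto
    moreover have "R \<longlonglongrightarrow> (1 + \<delta>) * ?Q z + (1 + 1 / \<delta>) * ((c + M) * 0)"
      unfolding R_def by (intro tendsto_intros \<xi>(2))
    then have "(\<lambda>j. ennreal (R j)) \<longlonglongrightarrow> ennreal ((1 + \<delta>) * ?Q z)" by (intro tendsto_ennrealI) simp
    then have "liminf (\<lambda>j. ennreal (R j)) = ennreal ((1 + \<delta>) * ?Q z)" by (simp add: lim_imp_Liminf)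
    ultimately show ?thesis using fatou by simp
  qed
  have Q0: "0 \<le> ?Q z" by (rule stability_form_nonneg[OF c])
  \<comment> \<open>Here \<open>\<delta> = 1 / real (Suc j)\<close> tends to 0, after the limit over
    the approximants has been taken for each fixed \<open>\<delta>\<close>.\<close>
  have "(\<lambda>j. ennreal ((1 + 1 / real (Suc j)) * ?Q z)) \<longlonglongrightarrow> ennreal ((1 + 0) * ?Q z)"
    using LIMSEQ_inverse_real_of_nat
    by (intro tendsto_ennrealI tendsto_intros) (simp add: inverse_eq_divide)
  then have "?X \<le> ennreal ((1 + 0) * ?Q z)"
    by (rule LIMSEQ_le_const) (use bound in \<open>auto simp del: of_nat_Suc\<close>)
  then show ?thesis by simp
qed

text \<open>Stability rewritten for a nonnegative Borel weight. Adding
  \<open>M * (\<xi> x)\<^sup>2\<close> to both sides of the inequality turns the potential into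
  \<open>a\<close> and the energy into \<open>stability_form\<close>.\<close>

lemma stable_solution_test_inequality:
  fixes \<Omega> :: "'a::euclidean_space set"
  assumes s: "0 < s" "s < 1" and c: "0 < c" and \<Omega>: "open \<Omega>"
    and f: "f C1_differentiable_on UNIV" and cvx: "strictly_convex f"
    and u: "stable_L1_weak_solution c s \<Omega> f g u" and below: "essentially_bounded_below \<Omega> u"
    and um: "u \<in> borel_measurable lebesgue"
  obtains a M where "0 \<le> M" "a \<in> borel_measurable borel" "\<And>x. 0 \<le> a x"
    "AE x in lborel. x \<in> \<Omega> \<longrightarrow> a x = deriv f (u x) + M"
    "\<And>\<xi>. Cinf_compact_support \<Omega> \<xi> \<Longrightarrow>
      (\<integral>\<^sup>+x. ennreal (a x * (\<xi> x)\<^sup>2) \<partial>lborel) \<le> ennreal (stability_form c s M \<xi>)"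
proof -
  obtain u' where [measurable]: "u' \<in> borel_measurable borel" and eq: "AE x in lborel. u x = u' x"
    using lebesgue_borel_version[OF um] by blast
  have [measurable]: "deriv f \<in> borel_measurable borel"
    by (rule borel_measurable_continuous_onI[OF C1_differentiable_deriv(2)[OF f]])
  have [measurable]: "\<Omega> \<in> sets borel" using \<Omega> by simp
  have [measurable]: "\<Omega> \<in> sets lebesgue" by (simp add: sets_completionI_sets)
  note [measurable] = um
  obtain m where m: "AE x in lborel. x \<in> \<Omega> \<longrightarrow> m \<le> u x"
    using below unfolding essentially_bounded_below_def by (auto simp: AE_completion_iff)
  \<comment> \<open>As \<open>f'\<close> is increasing and \<open>m \<le> u\<close>, the potential
    is at least \<open>deriv f m\<close>, hence at least \<open>- M\<close>.\<close>
  define M where "M = \<bar>deriv f m\<bar>"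
  \<comment> \<open>The maximum changes the weight only on a null subset of \<open>\<Omega>\<close>;
    it gives nonnegativity at every point, not just almost everywhere.\<close>
  define a where "a = (\<lambda>x. indicator \<Omega> x * max 0 (deriv f (u' x) + M))"
  have nn: "AE x in lborel. x \<in> \<Omega> \<longrightarrow> 0 \<le> deriv f (u x) + M"
    using m
  proof eventually_elim
    case (elim x)
    then show ?case using strictly_convex_deriv_mono[OF f cvx, of m "u x"] by (auto simp: M_def)
  qed
  have a_eq: "AE x in lborel. x \<in> \<Omega> \<longrightarrow> a x = deriv f (u x) + M"
    using nn eq by eventually_elim (auto simp: a_def)
  show ?thesis
  proof (rule that[of M a])
    show "0 \<le> M" by (simp add: M_def)
    show "a \<in> borel_measurable borel" unfolding a_def by measurable
    show "0 \<le> a x" for x by (simp add: a_def)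
    show "AE x in lborel. x \<in> \<Omega> \<longrightarrow> a x = deriv f (u x) + M" by (rule a_eq)
    fix \<xi> assume \<xi>: "Cinf_compact_support \<Omega> \<xi>"
    note [measurable] = Cinf_compact_support_measurable[OF \<xi>]
    obtain K where K: "compact K" "K \<subseteq> \<Omega>" "\<And>x. x \<notin> K \<Longrightarrow> \<xi> x = 0"
      using \<xi> by (rule Cinf_compact_supportE) blast
    obtain B where B: "\<And>x. \<bar>\<xi> x\<bar> \<le> B" using Cinf_compact_support_bounded[OF \<xi>] by metis
    have \<xi>2: "integrable lborel (\<lambda>x. (\<xi> x)\<^sup>2)"
      using Cinf_compact_support_finite_energy[OF s \<xi>] by (simp add: finite_energy_def sq_integrable_def)
    define h where "h = (\<lambda>x. indicator \<Omega> x * (deriv f (u x) * (\<xi> x)\<^sup>2))"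
    define h' where "h' = (\<lambda>x. indicator \<Omega> x * (deriv f (u' x) * (\<xi> x)\<^sup>2))"
    have \<xi>leb [measurable]: "\<xi> \<in> borel_measurable lebesgue"
      by (simp add: measurable_completion)
    have hm [measurable]: "h \<in> borel_measurable lebesgue" unfolding h_def by measurable
    have h'm [measurable]: "h' \<in> borel_measurable borel" unfolding h'_def by measurable
    have hh': "AE x in lborel. h x = h' x" using eq by eventually_elim (simp add: h_def h'_def)
    have "integrable lebesgue (\<lambda>x. indicator K x *\<^sub>R deriv f (u x))"
      using u K unfolding stable_L1_weak_solution_def set_integrable_def by blast
    then have "integrable lebesgue (\<lambda>x. B\<^sup>2 * (indicator K x *\<^sub>R deriv f (u x)))" by simp
    then have "integrable lebesgue h"
    proof (rule Bochner_Integration.integrable_bound)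
      show "AE x in lebesgue. norm (h x) \<le> norm (B\<^sup>2 * (indicator K x *\<^sub>R deriv f (u x)))"
      proof (rule AE_I2)
        fix x
        have "\<bar>\<xi> x\<bar>\<^sup>2 \<le> B\<^sup>2" by (rule power_mono) (use B in auto)
        then have "\<bar>deriv f (u x)\<bar> * (\<xi> x)\<^sup>2 \<le> \<bar>deriv f (u x)\<bar> * B\<^sup>2" by (intro mult_left_mono) auto
        then show "norm (h x) \<le> norm (B\<^sup>2 * (indicator K x *\<^sub>R deriv f (u x)))"
          using K by (cases "x \<in> K") (auto simp: h_def abs_mult mult.commute)
      qed
    qed measurable
    then have h'i: "integrable lborel h'" using integral_lebesgue_borel_version(2)[OF hm h'm hh'] by simp
    have "ennreal (integral\<^sup>L lebesgue h) \<le> Hs_seminorm_sq c s \<Omega> \<xi>"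
      using u \<xi> unfolding stable_L1_weak_solution_def set_lebesgue_integral_def h_def by simp
    also have "\<dots> = ennreal (c / 2 * (\<integral>p. (gagliardo s \<xi> p)\<^sup>2 \<partial>lborel))"
      by (rule Hs_seminorm_sq_Cinf_compact_support[OF s c \<xi>])
    finally have "integral\<^sup>L lebesgue h \<le> c / 2 * (\<integral>p. (gagliardo s \<xi> p)\<^sup>2 \<partial>lborel)"
    \<comment> \<open>Only the right-hand side has to be nonnegative for \<open>ennreal\<close> to
      reflect the order, so a negative integral of the potential causes no loss.\<close>
    proof (rule ennreal_le_iff[THEN iffD1, rotated])
      show "0 \<le> c / 2 * (\<integral>p. (gagliardo s \<xi> p)\<^sup>2 \<partial>lborel)"
        using c by (intro mult_nonneg_nonneg Bochner_Integration.integral_nonneg) auto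
    qed
    then have le: "integral\<^sup>L lborel h' \<le> c / 2 * (\<integral>p. (gagliardo s \<xi> p)\<^sup>2 \<partial>lborel)"
      using integral_lebesgue_borel_version(1)[OF hm h'm hh'] by simp
    have ae: "AE x in lborel. a x * (\<xi> x)\<^sup>2 = h' x + M * (\<xi> x)\<^sup>2"
      using a_eq eq
    proof eventually_elim
      case (elim x)
      then show ?case using K by (cases "x \<in> \<Omega>") (auto simp: h'_def a_def algebra_simps)
    qed
    have "(\<integral>\<^sup>+x. ennreal (a x * (\<xi> x)\<^sup>2) \<partial>lborel) = (\<integral>\<^sup>+x. ennreal (h' x + M * (\<xi> x)\<^sup>2) \<partial>lborel)"
      using ae by (intro nn_integral_cong_AE) (auto elim!: eventually_mono)
    also have "\<dots> = ennreal (\<integral>x. h' x + M * (\<xi> x)\<^sup>2 \<partial>lborel)"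
    proof (rule nn_integral_eq_integral)
      show "integrable lborel (\<lambda>x. h' x + M * (\<xi> x)\<^sup>2)" using h'i \<xi>2 by simp
      show "AE x in lborel. 0 \<le> h' x + M * (\<xi> x)\<^sup>2"
        using ae by eventually_elim (metis \<open>\<And>x. 0 \<le> a x\<close> mult_nonneg_nonneg zero_le_power2)
    qed
    also have "\<dots> \<le> ennreal (stability_form c s M \<xi>)"
      using le h'i \<xi>2 by (intro ennreal_leI) (simp add: stability_form_def)
    finally show "(\<integral>\<^sup>+x. ennreal (a x * (\<xi> x)\<^sup>2) \<partial>lborel) \<le> ennreal (stability_form c s M \<xi>)" .
  qed
qed

lemma L1_weak_solutions_difference:
  fixes \<Omega> :: "'a::euclidean_space set"
  assumes s: "0 < s" "s < 1" and [measurable]: "\<Omega> \<in> sets borel"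
    and u: "L1_weak_solution c s \<Omega> f g u" and v: "L1_weak_solution c s \<Omega> f g v"
    and f: "continuous_on UNIV f"
    and m [measurable]: "u' \<in> borel_measurable borel" "v' \<in> borel_measurable borel"
    and eq: "AE x in lborel. u x = u' x" "AE x in lborel. v x = v' x"
    and um: "u \<in> borel_measurable lebesgue" "v \<in> borel_measurable lebesgue"
    and w: "finite_energy s (\<lambda>x. indicator \<Omega> x * (u' x - v' x))"
    and \<phi>: "Cinf_compact_support \<Omega> \<phi>"
  shows "c / 2 * (\<integral>p. gagliardo s (\<lambda>x. indicator \<Omega> x * (u' x - v' x)) p * gagliardo s \<phi> p \<partial>lborel) =
    (\<integral>x. indicator \<Omega> x * (f (u' x) - f (v' x)) * \<phi> x \<partial>lborel)"
proof -
  note [measurable] = Cinf_compact_support_measurable[OF \<phi>]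
  have [measurable]: "f \<in> borel_measurable borel" by (rule borel_measurable_continuous_onI[OF f])
  have \<Omega>leb [measurable]: "\<Omega> \<in> sets lebesgue" by (simp add: sets_completionI_sets)
  note [measurable] = um
  have adm: "admissible_test c s \<Omega> \<phi>" by (rule Cinf_compact_support_admissible[OF s \<phi>])
  have [measurable]: "\<phi> \<in> borel_measurable lebesgue" "sym_laplacian s \<phi> \<in> borel_measurable lebesgue"
    by (simp_all add: measurable_completion)
  obtain C where C: "\<And>x. \<bar>sym_laplacian s \<phi> x\<bar> \<le> C" using truncated_laplacian_bounded[OF s \<phi>] by metis
  let ?I = "LINT x:(- \<Omega>)|lebesgue. g x * nonlocal_normal_deriv c s \<Omega> \<phi> x"
  \<comment> \<open>One weak equation in Borel terms, instantiated for both solutions. The exterior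
    term \<open>?I\<close> stays opaque: it is the same number in both instances and drops out on
    subtraction.\<close>
  have key: "integrable lborel (\<lambda>x. indicator \<Omega> x * y' x * sym_laplacian s \<phi> x)
      \<and> integrable lborel (\<lambda>x. indicator \<Omega> x * y' x)
      \<and> integrable lborel (\<lambda>x. indicator \<Omega> x * f (y' x) * \<phi> x)
      \<and> c * (\<integral>x. indicator \<Omega> x * y' x * sym_laplacian s \<phi> x \<partial>lborel) + ?I =
        (\<integral>x. indicator \<Omega> x * f (y' x) * \<phi> x \<partial>lborel)"
    if y: "L1_weak_solution c s \<Omega> f g y" and [measurable]: "y' \<in> borel_measurable borel" "y \<in> borel_measurable lebesgue"
      and ey: "AE x in lborel. y x = y' x" for y y' :: "'a \<Rightarrow> real"
  proof -
    have i1: "integrable lebesgue (\<lambda>x. indicator \<Omega> x *\<^sub>R y x)"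
      and i2: "integrable lebesgue (\<lambda>x. indicator \<Omega> x *\<^sub>R (f (y x) * \<phi> x))"
      and e: "(LINT x:\<Omega>|lebesgue. y x * frac_laplacian c s \<phi> x) + ?I = (LINT x:\<Omega>|lebesgue. f (y x) * \<phi> x)"
      using y adm unfolding L1_weak_solution_def set_integrable_def by blast+
    have a1: "AE x in lborel. indicator \<Omega> x *\<^sub>R y x = indicator \<Omega> x * y' x"
      using ey by eventually_elim simp
    have a2: "AE x in lborel. indicator \<Omega> x *\<^sub>R (f (y x) * \<phi> x) = indicator \<Omega> x * f (y' x) * \<phi> x"
      using ey by eventually_elim simp
    have a3: "AE x in lborel. indicator \<Omega> x *\<^sub>R (y x * frac_laplacian c s \<phi> x) =
        c * (indicator \<Omega> x * y' x * sym_laplacian s \<phi> x)"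
      using ey by eventually_elim (simp add: frac_laplacian_Cinf_compact_support[OF s \<phi>])
    have j1: "integrable lborel (\<lambda>x. indicator \<Omega> x * y' x)"
      using integral_lebesgue_borel_version(2)[OF _ _ a1] i1 by simp
    have j2: "integrable lborel (\<lambda>x. indicator \<Omega> x * f (y' x) * \<phi> x)"
      using integral_lebesgue_borel_version(2)[OF _ _ a2] i2 by simp
    have j3: "integrable lborel (\<lambda>x. indicator \<Omega> x * y' x * sym_laplacian s \<phi> x)"
    proof (rule Bochner_Integration.integrable_bound)
      show "integrable lborel (\<lambda>x. C * (indicator \<Omega> x * y' x))" using j1 by simp
      show "AE x in lborel. norm (indicator \<Omega> x * y' x * sym_laplacian s \<phi> x) \<le> norm (C * (indicator \<Omega> x * y' x))"
      proof (rule AE_I2)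
        fix x
        have "\<bar>indicator \<Omega> x * y' x\<bar> * \<bar>sym_laplacian s \<phi> x\<bar> \<le> \<bar>indicator \<Omega> x * y' x\<bar> * \<bar>C\<bar>"
          using C[of x] by (intro mult_left_mono) auto
        then show "norm (indicator \<Omega> x * y' x * sym_laplacian s \<phi> x) \<le> norm (C * (indicator \<Omega> x * y' x))"
          by (simp add: abs_mult mult.commute)
      qed
    qed measurable
    have "(LINT x:\<Omega>|lebesgue. y x * frac_laplacian c s \<phi> x) =
        (\<integral>x. c * (indicator \<Omega> x * y' x * sym_laplacian s \<phi> x) \<partial>lborel)"
      unfolding set_lebesgue_integral_def
      by (rule integral_lebesgue_borel_version(1)[OF _ _ a3])
        (simp_all add: frac_laplacian_Cinf_compact_support[OF s \<phi>])
    moreover have "(LINT x:\<Omega>|lebesgue. f (y x) * \<phi> x) = (\<integral>x. indicator \<Omega> x * f (y' x) * \<phi> x \<partial>lborel)"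
      unfolding set_lebesgue_integral_def by (rule integral_lebesgue_borel_version(1)[OF _ _ a2]) simp_all
    ultimately show ?thesis using e j1 j2 j3 by simp
  qed
  note ku = key[OF u m(1) um(1) eq(1)] and kv = key[OF v m(2) um(2) eq(2)]
  let ?w = "\<lambda>x. indicator \<Omega> x * (u' x - v' x)"
  have wint: "integrable lborel ?w" using ku kv by (simp add: right_diff_distrib)
  have "c / 2 * (\<integral>p. gagliardo s ?w p * gagliardo s \<phi> p \<partial>lborel) = c * (\<integral>x. ?w x * sym_laplacian s \<phi> x \<partial>lborel)"
    using integral_mult_sym_laplacian[OF s w wint \<phi>] by simp
  also have "(\<lambda>x. ?w x * sym_laplacian s \<phi> x) = (\<lambda>x. indicator \<Omega> x * u' x * sym_laplacian s \<phi> x -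
      indicator \<Omega> x * v' x * sym_laplacian s \<phi> x)" by (simp add: fun_eq_iff algebra_simps)
  also have "c * integral\<^sup>L lborel \<dots> = c * (\<integral>x. indicator \<Omega> x * u' x * sym_laplacian s \<phi> x \<partial>lborel) -
      c * (\<integral>x. indicator \<Omega> x * v' x * sym_laplacian s \<phi> x \<partial>lborel)"
    using ku kv by (simp add: right_diff_distrib)
  also have "\<dots> = (\<integral>x. indicator \<Omega> x * f (u' x) * \<phi> x \<partial>lborel) - (\<integral>x. indicator \<Omega> x * f (v' x) * \<phi> x \<partial>lborel)"
    using ku kv by linarith
  also have "\<dots> = (\<integral>x. indicator \<Omega> x * f (u' x) * \<phi> x - indicator \<Omega> x * f (v' x) * \<phi> x \<partial>lborel)"
    using ku kv by simp
  also have "\<dots> = (\<integral>x. indicator \<Omega> x * (f (u' x) - f (v' x)) * \<phi> x \<partial>lborel)"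
    by (simp add: algebra_simps)
  finally show ?thesis .
qed

text \<open>Splitting the weight as \<open>sqrt (A x) * sqrt (A x)\<close> dominates
  \<open>d x * z x\<close> by a product of two square-integrable functions. It gives meaning to the
  nonlinear term for energy functions \<open>z\<close>.\<close>

lemma integrable_mult_of_weighted_bound:
  fixes A d w z :: "'a::euclidean_space \<Rightarrow> real"
  assumes [measurable]: "A \<in> borel_measurable borel" "d \<in> borel_measurable borel"
    and A: "\<And>x. 0 \<le> A x" and d: "AE x in lborel. \<bar>d x\<bar> \<le> A x * \<bar>w x\<bar>"
    and w: "sq_integrable lborel (\<lambda>x. sqrt (A x) * w x)" and z: "sq_integrable lborel (\<lambda>x. sqrt (A x) * z x)"
    and [measurable]: "z \<in> borel_measurable borel"
  shows "integrable lborel (\<lambda>x. d x * z x)"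
    and "AE x in lborel. \<bar>d x * z x\<bar> \<le> \<bar>(sqrt (A x) * w x) * (sqrt (A x) * z x)\<bar>"
proof -
  show ae: "AE x in lborel. \<bar>d x * z x\<bar> \<le> \<bar>(sqrt (A x) * w x) * (sqrt (A x) * z x)\<bar>"
    using d
  proof eventually_elim
    case (elim x)
    have "\<bar>d x\<bar> * \<bar>z x\<bar> \<le> A x * \<bar>w x\<bar> * \<bar>z x\<bar>" by (intro mult_right_mono elim) simp
    also have "\<dots> = (sqrt (A x) * sqrt (A x)) * \<bar>w x\<bar> * \<bar>z x\<bar>" using A[of x] by simp
    finally show ?case using A[of x] by (simp only: abs_mult real_sqrt_abs mult_ac) simp
  qed
  show "integrable lborel (\<lambda>x. d x * z x)"
    by (rule Bochner_Integration.integrable_bound[OF sq_integrable_mult[OF w z]]) (use ae in simp_all)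
qed

text \<open>The defect of the weak equation vanishes on test functions, and it is controlled by
  \<open>\<delta> energy w + energy (z - \<xi>) / \<delta>\<close> for every \<open>\<delta>\<close>, hence by density it vanishes at \<open>z\<close>.\<close>

lemma weak_equation_extends:
  fixes A d w z :: "'a::euclidean_space \<Rightarrow> real"
  assumes s: "0 < s" "s < 1" and k: "0 \<le> k" and C: "0 \<le> C"
    and [measurable]: "A \<in> borel_measurable borel" "d \<in> borel_measurable borel"
    and A: "\<And>x. 0 \<le> A x" and d: "AE x in lborel. \<bar>d x\<bar> \<le> A x * \<bar>w x\<bar>"
    and bound: "\<And>z. z \<in> X \<Longrightarrow> (\<integral>\<^sup>+x. ennreal (A x * (z x)\<^sup>2) \<partial>lborel) \<le> ennreal (C * energy s z)"
    and X: "\<And>z. z \<in> X \<Longrightarrow> finite_energy s z \<and> approximable s \<Omega> z"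
    and X_diff: "\<And>z \<xi>. z \<in> X \<Longrightarrow> Cinf_compact_support \<Omega> \<xi> \<Longrightarrow> (\<lambda>x. z x - \<xi> x) \<in> X"
    and w: "w \<in> X" and z: "z \<in> X"
    and eq: "\<And>\<phi>. Cinf_compact_support \<Omega> \<phi> \<Longrightarrow>
      k * (\<integral>p. gagliardo s w p * gagliardo s \<phi> p \<partial>lborel) = (\<integral>x. d x * \<phi> x \<partial>lborel)"
  shows "integrable lborel (\<lambda>x. d x * z x)"
    and "k * (\<integral>p. gagliardo s w p * gagliardo s z p \<partial>lborel) = (\<integral>x. d x * z x \<partial>lborel)"
proof -
  have meas: "z \<in> borel_measurable borel" if "z \<in> X" for z using X[OF that] finite_energy_measurable by blast
  have sq: "sq_integrable lborel (\<lambda>x. sqrt (A x) * z x)"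
    and sq_le: "(\<integral>x. (sqrt (A x) * z x)\<^sup>2 \<partial>lborel) \<le> C * energy s z" if z: "z \<in> X" for z
  proof -
    note [measurable] = meas[OF z]
    have "(\<integral>\<^sup>+x. ennreal ((sqrt (A x) * z x)\<^sup>2) \<partial>lborel) \<le> ennreal (C * energy s z)"
      using bound[OF z] A by (simp add: power_mult_distrib)
    moreover from this show i: "sq_integrable lborel (\<lambda>x. sqrt (A x) * z x)"
      by (intro sq_integrableI_bounded) (auto intro: le_less_trans)
    ultimately show "(\<integral>x. (sqrt (A x) * z x)\<^sup>2 \<partial>lborel) \<le> C * energy s z"
      using C energy_nonneg[of s z] by (simp add: sq_integrable_nn_integral[OF i])
  qed
  note int = integrable_mult_of_weighted_bound(1)[OF _ _ A d sq[OF w] sq meas]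
    and ae = integrable_mult_of_weighted_bound(2)[OF _ _ A d sq[OF w] sq meas]
  show "integrable lborel (\<lambda>x. d x * z x)" by (rule int[OF _ _ z z]) simp_all
  have gag: "sq_integrable lborel (gagliardo s z)"
    and gag_le: "(\<integral>p. (gagliardo s z p)\<^sup>2 \<partial>lborel) \<le> energy s z" if "z \<in> X" for z
    using X[OF that] by (auto simp: finite_energy_def energy_def intro: Bochner_Integration.integral_nonneg)
  define defect where "defect z = k * (\<integral>p. gagliardo s w p * gagliardo s z p \<partial>lborel) - (\<integral>x. d x * z x \<partial>lborel)" for z
  have small: "\<bar>defect y\<bar> \<le> (k + C) * (\<delta> * energy s w + (1 / \<delta>) * energy s y)" if y: "y \<in> X" and \<delta>: "0 < \<delta>" for y \<delta>
  proof -
    have "\<bar>\<integral>p. gagliardo s w p * gagliardo s y p \<partial>lborel\<bar> \<le>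
        \<delta> * (\<integral>p. (gagliardo s w p)\<^sup>2 \<partial>lborel) + (1 / \<delta>) * (\<integral>p. (gagliardo s y p)\<^sup>2 \<partial>lborel)"
      by (rule abs_integral_mult_le_weighted[OF gag[OF w] gag[OF y] \<delta> sq_integrable_mult[OF gag[OF w] gag[OF y]]]) simp
    also have "\<dots> \<le> \<delta> * energy s w + (1 / \<delta>) * energy s y"
      using \<delta> by (intro add_mono mult_left_mono gag_le w y) auto
    finally have 1: "k * \<bar>\<integral>p. gagliardo s w p * gagliardo s y p \<partial>lborel\<bar> \<le> k * (\<delta> * energy s w + (1 / \<delta>) * energy s y)"
      using k by (rule mult_left_mono)
    have "\<bar>\<integral>x. d x * y x \<partial>lborel\<bar> \<le>
        \<delta> * (\<integral>x. (sqrt (A x) * w x)\<^sup>2 \<partial>lborel) + (1 / \<delta>) * (\<integral>x. (sqrt (A x) * y x)\<^sup>2 \<partial>lborel)"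
      by (rule abs_integral_mult_le_weighted[OF sq[OF w] sq[OF y] \<delta> int[OF _ _ y y] ae[OF _ _ y y]]) simp_all
    also have "\<dots> \<le> \<delta> * (C * energy s w) + (1 / \<delta>) * (C * energy s y)"
      using \<delta> by (intro add_mono mult_left_mono sq_le w y) auto
    finally have 2: "\<bar>\<integral>x. d x * y x \<partial>lborel\<bar> \<le> C * (\<delta> * energy s w + (1 / \<delta>) * energy s y)"
      by (simp add: algebra_simps)
    have "\<bar>defect y\<bar> \<le> k * \<bar>\<integral>p. gagliardo s w p * gagliardo s y p \<partial>lborel\<bar> + \<bar>\<integral>x. d x * y x \<partial>lborel\<bar>"
      unfolding defect_def using k by (simp add: abs_mult order_trans[OF abs_triangle_ineq4])
    then show ?thesis using 1 2 unfolding distrib_right by linarith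
  qed
  have "\<bar>defect z\<bar> \<le> \<epsilon>" if \<epsilon>: "0 < \<epsilon>" for \<epsilon>
  proof -
    \<comment> \<open>The summand 1 here and in \<open>E\<close> makes the divisors positive. With
      the choices of \<open>\<delta>\<close> and \<open>\<xi>\<close> below, the two contributions
      are at most \<open>\<epsilon> / (2 * T)\<close> each, and the outer factor is at most
      \<open>T\<close>.\<close>
    define T where "T = k + C + 1"
    define E where "E = energy s w + 1"
    have T: "0 < T" "k + C \<le> T" using k C by (auto simp: T_def)
    have E: "0 < E" "energy s w \<le> E" using energy_nonneg[of s w] by (auto simp: E_def)
    define \<delta> where "\<delta> = \<epsilon> / (2 * T * E)"
    have \<delta>: "0 < \<delta>" using \<epsilon> T E by (simp add: \<delta>_def)
    then have "0 < \<delta> * \<epsilon> / (2 * T)" using \<epsilon> T by simp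
    then obtain \<xi> where \<xi>: "Cinf_compact_support \<Omega> \<xi>" "energy s (\<lambda>x. z x - \<xi> x) < \<delta> * \<epsilon> / (2 * T)"
      using X[OF z] unfolding approximable_def by blast
    let ?y = "\<lambda>x. z x - \<xi> x"
    have y: "?y \<in> X" by (rule X_diff[OF z \<xi>(1)])
    have "(\<integral>p. gagliardo s w p * gagliardo s \<xi> p \<partial>lborel) =
        (\<integral>p. gagliardo s w p * gagliardo s z p - gagliardo s w p * gagliardo s ?y p \<partial>lborel)"
      by (simp add: gagliardo_diff algebra_simps)
    also have "\<dots> = (\<integral>p. gagliardo s w p * gagliardo s z p \<partial>lborel) - (\<integral>p. gagliardo s w p * gagliardo s ?y p \<partial>lborel)"
      by (intro Bochner_Integration.integral_diff sq_integrable_mult gag w z y)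
    finally have g: "(\<integral>p. gagliardo s w p * gagliardo s \<xi> p \<partial>lborel) =
      (\<integral>p. gagliardo s w p * gagliardo s z p \<partial>lborel) - (\<integral>p. gagliardo s w p * gagliardo s ?y p \<partial>lborel)" .
    have "(\<integral>x. d x * \<xi> x \<partial>lborel) = (\<integral>x. d x * z x - d x * ?y x \<partial>lborel)" by (simp add: algebra_simps)
    also have "\<dots> = (\<integral>x. d x * z x \<partial>lborel) - (\<integral>x. d x * ?y x \<partial>lborel)"
      by (intro Bochner_Integration.integral_diff int[OF _ _ z z] int[OF _ _ y y]) simp_all
    finally have h: "(\<integral>x. d x * \<xi> x \<partial>lborel) = (\<integral>x. d x * z x \<partial>lborel) - (\<integral>x. d x * ?y x \<partial>lborel)" .
    have "defect z = defect ?y" using eq[OF \<xi>(1)] unfolding g h defect_def by (simp add: right_diff_distrib)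
    also have "\<bar>defect ?y\<bar> \<le> (k + C) * (\<delta> * energy s w + (1 / \<delta>) * energy s ?y)" by (rule small[OF y \<delta>])
    also have "\<dots> \<le> T * (\<delta> * E + (1 / \<delta>) * (\<delta> * \<epsilon> / (2 * T)))"
    proof (rule mult_mono[OF T(2)])
      have "\<delta> * energy s w \<le> \<delta> * E" by (rule mult_left_mono[OF E(2)]) (use \<delta> in simp)
      moreover have "(1 / \<delta>) * energy s ?y \<le> (1 / \<delta>) * (\<delta> * \<epsilon> / (2 * T))"
        by (rule mult_left_mono[OF less_imp_le[OF \<xi>(2)]]) (use \<delta> in simp)
      ultimately show "\<delta> * energy s w + (1 / \<delta>) * energy s ?y \<le> \<delta> * E + (1 / \<delta>) * (\<delta> * \<epsilon> / (2 * T))"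
        by (rule add_mono)
      show "0 \<le> \<delta> * energy s w + (1 / \<delta>) * energy s ?y"
        using \<delta> energy_nonneg[of s w] energy_nonneg[of s ?y] by simp
    qed (use T in simp)
    also have "\<dots> = \<epsilon>"
    proof -
      have "\<delta> * E = \<epsilon> / (2 * T)" using E(1) by (simp add: \<delta>_def)
      moreover have "(1 / \<delta>) * (\<delta> * \<epsilon> / (2 * T)) = \<epsilon> / (2 * T)" using \<delta> by simp
      ultimately have "T * (\<delta> * E + (1 / \<delta>) * (\<delta> * \<epsilon> / (2 * T))) = T * (\<epsilon> / (2 * T) + \<epsilon> / (2 * T))"
        by (simp only:)
      also have "\<dots> = \<epsilon>" using T(1) by simp
      finally show ?thesis .
    qed
    finally show ?thesis .
  qed
  then have "\<bar>defect z\<bar> \<le> 0 + \<epsilon>" if "0 < \<epsilon>" for \<epsilon> using that by simp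
  then have "\<bar>defect z\<bar> \<le> 0" by (rule field_le_epsilon)
  then show "k * (\<integral>p. gagliardo s w p * gagliardo s z p \<partial>lborel) = (\<integral>x. d x * z x \<partial>lborel)"
    by (simp add: defect_def)
qed

text \<open>With \<open>z = max 0 w\<close>, the weak equation and stability at \<open>u\<close> force the integral of
  \<open>G = (f' u (u - v) - (f u - f v)) z\<close> to be nonpositive, while \<open>G \<ge> 0\<close> by convexity.\<close>

lemma stable_solution_le:
  fixes \<Omega> :: "'a::euclidean_space set"
  assumes s: "0 < s" "s < 1" and c: "0 < c" and \<Omega>: "bounded_smooth_domain \<Omega>"
    and f: "f C1_differentiable_on UNIV" and cvx: "strictly_convex f"
    and u: "stable_L1_weak_solution c s \<Omega> f g u" "essentially_bounded_below \<Omega> u" "u \<in> Hs_space c s \<Omega>"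
    and v: "stable_L1_weak_solution c s \<Omega> f g v" "essentially_bounded_below \<Omega> v" "v \<in> Hs_space c s \<Omega>"
  shows "AE x in lborel. u x \<le> v x"
proof -
  have op: "open \<Omega>" using \<Omega> by (simp add: bounded_smooth_domain_def)
  then have \<Omega>m [measurable]: "\<Omega> \<in> sets borel" by simp
  have um: "u \<in> borel_measurable lebesgue" "v \<in> borel_measurable lebesgue"
    using u(3) v(3) by (auto simp: Hs_space_def)
  obtain u' where m1 [measurable]: "u' \<in> borel_measurable borel" and equ: "AE x in lborel. u x = u' x"
    using lebesgue_borel_version[OF um(1)] by blast
  obtain v' where m2 [measurable]: "v' \<in> borel_measurable borel" and eqv: "AE x in lborel. v x = v' x"
    using lebesgue_borel_version[OF um(2)] by blast
  have fc: "continuous_on UNIV f"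
    using C1_differentiable_deriv(1)[OF f] DERIV_isCont continuous_at_imp_continuous_on by blast
  have [measurable]: "f \<in> borel_measurable borel" by (rule borel_measurable_continuous_onI[OF fc])
  have wu: "L1_weak_solution c s \<Omega> f g u" and wv: "L1_weak_solution c s \<Omega> f g v"
    using u(1) v(1) by (auto simp: stable_L1_weak_solution_def)
  have "AE x in lborel. x \<notin> \<Omega> \<longrightarrow> u x = g x" "AE x in lborel. x \<notin> \<Omega> \<longrightarrow> v x = g x"
    using wu wv by (auto simp: L1_weak_solution_def AE_completion_iff)
  then have out: "AE x in lborel. x \<notin> \<Omega> \<longrightarrow> u x = v x" by eventually_elim auto
  define w where "w = (\<lambda>x. indicator \<Omega> x * (u' x - v' x))"
  define d where "d = (\<lambda>x. indicator \<Omega> x * (f (u' x) - f (v' x)))"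
  define z where "z = (\<lambda>x. max 0 (w x))"
  have [measurable]: "w \<in> borel_measurable borel" "d \<in> borel_measurable borel" "z \<in> borel_measurable borel"
    unfolding w_def d_def z_def by measurable
  have w: "finite_energy s w"
    unfolding w_def by (rule Hs_space_difference_finite_energy[OF u(3) v(3) c \<Omega>m m1 m2 equ eqv out])
  have z: "finite_energy s z" by (rule finite_energy_bound[OF w]) (auto simp: z_def)
  define X where "X = {y. finite_energy s y \<and> (\<forall>x. x \<notin> \<Omega> \<longrightarrow> y x = 0)}"
  have X: "finite_energy s y \<and> approximable s \<Omega> y" if "y \<in> X" for y
    using that Cinf_compact_support_dense[OF s \<Omega>] by (auto simp: X_def)
  have wX: "w \<in> X" and zX: "z \<in> X" using w z by (auto simp: X_def z_def w_def)
  have X_diff: "(\<lambda>x. y x - \<xi> x) \<in> X" if y: "y \<in> X" and \<xi>: "Cinf_compact_support \<Omega> \<xi>" for y \<xi>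
  proof -
    obtain K where K: "K \<subseteq> \<Omega>" "\<And>x. x \<notin> K \<Longrightarrow> \<xi> x = 0"
      using \<xi> by (rule Cinf_compact_supportE) blast
    have "\<xi> x = 0" if "x \<notin> \<Omega>" for x using that K by blast
    moreover have "finite_energy s (\<lambda>x. y x - \<xi> x)"
      using y by (intro finite_energy_diff Cinf_compact_support_finite_energy[OF s \<xi>]) (simp add: X_def)
    ultimately show ?thesis using y by (simp add: X_def)
  qed
  obtain a M where M: "0 \<le> M" and a [measurable]: "a \<in> borel_measurable borel" and a0: "\<And>x. 0 \<le> a x"
    and a_eq: "AE x in lborel. x \<in> \<Omega> \<longrightarrow> a x = deriv f (u x) + M"
    and a_test: "\<And>\<xi>. Cinf_compact_support \<Omega> \<xi> \<Longrightarrow>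
      (\<integral>\<^sup>+x. ennreal (a x * (\<xi> x)\<^sup>2) \<partial>lborel) \<le> ennreal (stability_form c s M \<xi>)"
    by (rule stable_solution_test_inequality[OF s c op f cvx u(1,2) um(1)], rule that)
  obtain b N where N: "0 \<le> N" and b [measurable]: "b \<in> borel_measurable borel" and b0: "\<And>x. 0 \<le> b x"
    and b_eq: "AE x in lborel. x \<in> \<Omega> \<longrightarrow> b x = deriv f (v x) + N"
    and b_test: "\<And>\<xi>. Cinf_compact_support \<Omega> \<xi> \<Longrightarrow>
      (\<integral>\<^sup>+x. ennreal (b x * (\<xi> x)\<^sup>2) \<partial>lborel) \<le> ennreal (stability_form c s N \<xi>)"
    by (rule stable_solution_test_inequality[OF s c op f cvx v(1,2) um(2)], rule that)
  have a_le: "(\<integral>\<^sup>+x. ennreal (a x * (y x)\<^sup>2) \<partial>lborel) \<le> ennreal (stability_form c s M y)" if "y \<in> X" for y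
    using X[OF that] nn_integral_le_stability_form[OF s c M a a0 a_test] by blast
  have b_le: "(\<integral>\<^sup>+x. ennreal (b x * (y x)\<^sup>2) \<partial>lborel) \<le> ennreal (stability_form c s N y)" if "y \<in> X" for y
    using X[OF that] nn_integral_le_stability_form[OF s c N b b0 b_test] by blast
  \<comment> \<open>On \<open>\<Omega>\<close>, \<open>a\<close> and \<open>b\<close> are the
    potentials shifted by \<open>M\<close> and \<open>N\<close>, so adding the shifts once more
    makes \<open>A\<close> dominate the absolute values of both potentials.\<close>
  define A where "A = (\<lambda>x. a x + b x + (M + N))"
  \<comment> \<open>One summand for each part of \<open>A\<close>: two from bounding the stability
    forms by the energy, one from the \<open>L^2\<close> part of the energy.\<close>
  define C where "C = (c + M) + (c + N) + (M + N)"
  have C0: "0 \<le> C" using c M N by (simp add: C_def)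
  have A0: "0 \<le> A x" for x using a0[of x] b0[of x] M N by (simp add: A_def)
  have [measurable]: "A \<in> borel_measurable borel" unfolding A_def by measurable
  have A_le: "(\<integral>\<^sup>+x. ennreal (A x * (y x)\<^sup>2) \<partial>lborel) \<le> ennreal (C * energy s y)" if y: "y \<in> X" for y
  proof -
    have [measurable]: "y \<in> borel_measurable borel" using X[OF y] finite_energy_measurable by blast
    have y2: "sq_integrable lborel y" using X[OF y] by (simp add: finite_energy_def)
    have g0: "0 \<le> (\<integral>p. (gagliardo s y p)\<^sup>2 \<partial>lborel)" by (rule Bochner_Integration.integral_nonneg) simp
    have "(\<integral>\<^sup>+x. ennreal (A x * (y x)\<^sup>2) \<partial>lborel) = (\<integral>\<^sup>+x. ennreal (a x * (y x)\<^sup>2) +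
        (ennreal (b x * (y x)\<^sup>2) + ennreal (M + N) * ennreal ((y x)\<^sup>2)) \<partial>lborel)"
      using a0 b0 M N by (intro nn_integral_cong) (simp add: A_def distrib_right add.assoc ennreal_plus ennreal_mult'[symmetric])
    also have "\<dots> = (\<integral>\<^sup>+x. ennreal (a x * (y x)\<^sup>2) \<partial>lborel) + ((\<integral>\<^sup>+x. ennreal (b x * (y x)\<^sup>2) \<partial>lborel) +
        ennreal (M + N) * (\<integral>\<^sup>+x. ennreal ((y x)\<^sup>2) \<partial>lborel))"
      by (simp add: nn_integral_add nn_integral_cmult)
    also have "\<dots> \<le> ennreal ((c + M) * energy s y) + (ennreal ((c + N) * energy s y) + ennreal (M + N) * ennreal (energy s y))"
    proof (intro add_mono mult_left_mono)
      show "(\<integral>\<^sup>+x. ennreal (a x * (y x)\<^sup>2) \<partial>lborel) \<le> ennreal ((c + M) * energy s y)"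
        using a_le[OF y] ennreal_leI[OF stability_form_le_energy[OF c M, of s y]] by (rule order_trans)
      show "(\<integral>\<^sup>+x. ennreal (b x * (y x)\<^sup>2) \<partial>lborel) \<le> ennreal ((c + N) * energy s y)"
        using b_le[OF y] ennreal_leI[OF stability_form_le_energy[OF c N, of s y]] by (rule order_trans)
      show "(\<integral>\<^sup>+x. ennreal ((y x)\<^sup>2) \<partial>lborel) \<le> ennreal (energy s y)"
        unfolding sq_integrable_nn_integral[OF y2] using g0 by (intro ennreal_leI) (simp add: energy_def)
    qed simp
    also have "ennreal (M + N) * ennreal (energy s y) = ennreal ((M + N) * energy s y)"
      by (rule ennreal_mult'[symmetric]) (use M N in simp)
    also have "ennreal ((c + M) * energy s y) + (ennreal ((c + N) * energy s y) + ennreal ((M + N) * energy s y)) =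
        ennreal ((c + M) * energy s y + ((c + N) * energy s y + (M + N) * energy s y))"
    proof -
      have "ennreal p + (ennreal q + ennreal r) = ennreal (p + (q + r))" if "0 \<le> p" "0 \<le> q" "0 \<le> r" for p q r
        using that by (simp add: ennreal_plus)
      then show ?thesis using c M N energy_nonneg[of s y] by simp
    qed
    also have "(c + M) * energy s y + ((c + N) * energy s y + (M + N) * energy s y) = C * energy s y"
      by (simp add: C_def distrib_right)
    finally show ?thesis .
  qed
  have d_le: "AE x in lborel. \<bar>d x\<bar> \<le> A x * \<bar>w x\<bar>"
    using equ eqv a_eq b_eq
  proof eventually_elim
    case (elim x)
    show ?case
    proof (cases "x \<in> \<Omega>")
      case True
      have ab: "a x = deriv f (u' x) + M" "b x = deriv f (v' x) + N" using elim True by auto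
      \<comment> \<open>The tangents at both points enclose the increment of \<open>f\<close>
        between two products, whatever the sign of \<open>u' x - v' x\<close>; this is why the
        weight must involve both potentials.\<close>
      have t: "f (u' x) - f (v' x) \<le> deriv f (u' x) * (u' x - v' x)"
        "deriv f (v' x) * (u' x - v' x) \<le> f (u' x) - f (v' x)"
        using strictly_convex_above_tangent(1)[OF f cvx, of "u' x" "v' x"]
          strictly_convex_above_tangent(1)[OF f cvx, of "v' x" "u' x"] by (simp_all add: algebra_simps)
      have "\<bar>deriv f (u' x)\<bar> \<le> A x" "\<bar>deriv f (v' x)\<bar> \<le> A x"
        using ab a0[of x] b0[of x] M N by (auto simp: A_def abs_le_iff)
      then have "\<bar>deriv f (u' x) * (u' x - v' x)\<bar> \<le> A x * \<bar>u' x - v' x\<bar>"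
        "\<bar>deriv f (v' x) * (u' x - v' x)\<bar> \<le> A x * \<bar>u' x - v' x\<bar>"
        by (simp_all add: abs_mult mult_right_mono)
      then have "\<bar>f (u' x) - f (v' x)\<bar> \<le> A x * \<bar>u' x - v' x\<bar>" using t by linarith
      then show ?thesis using True by (simp add: d_def w_def)
    qed (simp add: d_def w_def)
  qed
  have eqn: "c / 2 * (\<integral>p. gagliardo s w p * gagliardo s \<phi> p \<partial>lborel) = (\<integral>x. d x * \<phi> x \<partial>lborel)"
    if "Cinf_compact_support \<Omega> \<phi>" for \<phi>
    unfolding w_def d_def
    by (rule L1_weak_solutions_difference[OF s \<Omega>m wu wv fc m1 m2 equ eqv um w[unfolded w_def] that])
  have c2: "0 \<le> c / 2" using c by simp
  have dz: "integrable lborel (\<lambda>x. d x * z x)"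
    "c / 2 * (\<integral>p. gagliardo s w p * gagliardo s z p \<partial>lborel) = (\<integral>x. d x * z x \<partial>lborel)"
    using weak_equation_extends[OF s c2 C0 \<open>A \<in> borel_measurable borel\<close> \<open>d \<in> borel_measurable borel\<close>
        A0 d_le A_le X X_diff wX zX eqn] by simp_all
  have z2: "sq_integrable lborel z" "sq_integrable lborel (gagliardo s z)" "sq_integrable lborel (gagliardo s w)"
    using z w by (auto simp: finite_energy_def)
  have "c / 2 * (\<integral>p. (gagliardo s z p)\<^sup>2 \<partial>lborel) \<le> c / 2 * (\<integral>p. gagliardo s w p * gagliardo s z p \<partial>lborel)"
  proof (intro mult_left_mono Bochner_Integration.integral_mono c2)
    show "integrable lborel (\<lambda>p. (gagliardo s z p)\<^sup>2)" by (rule sq_integrable_integrable[OF z2(2)])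
    show "integrable lborel (\<lambda>p. gagliardo s w p * gagliardo s z p)" by (rule sq_integrable_mult[OF z2(3,2)])
    fix p :: "'a \<times> 'a"
    \<comment> \<open>The positive part is monotone with slope at most 1, so its increment has the
      sign of \<open>a - b\<close> and is no larger in absolute value.\<close>
    have pos_part: "(max 0 a - max 0 b)\<^sup>2 \<le> (a - b) * (max 0 a - max 0 b)" for a b :: real
    proof -
      have "0 \<le> ((a - b) - (max 0 a - max 0 b)) * (max 0 a - max 0 b)"
        by (cases "0 \<le> a"; cases "0 \<le> b") (auto simp: max_def mult_nonpos_nonneg)
      then show ?thesis by (simp add: power2_eq_square left_diff_distrib)
    qed
    show "(gagliardo s z p)\<^sup>2 \<le> gagliardo s w p * gagliardo s z p"
      unfolding gagliardo_sq gagliardo_mult_gagliardo z_def by (intro divide_right_mono pos_part) simp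
  qed
  then have lower: "c / 2 * (\<integral>p. (gagliardo s z p)\<^sup>2 \<partial>lborel) \<le> (\<integral>x. d x * z x \<partial>lborel)" using dz(2) by simp
  have az: "integrable lborel (\<lambda>x. a x * (z x)\<^sup>2)"
    by (rule integrableI_nonneg) (use a0 le_less_trans[OF a_le[OF zX]] in auto)
  have "ennreal (\<integral>x. a x * (z x)\<^sup>2 \<partial>lborel) = (\<integral>\<^sup>+x. ennreal (a x * (z x)\<^sup>2) \<partial>lborel)"
    by (rule nn_integral_eq_integral[symmetric, OF az]) (use a0 in auto)
  also have "\<dots> \<le> ennreal (stability_form c s M z)" by (rule a_le[OF zX])
  finally have "(\<integral>x. a x * (z x)\<^sup>2 \<partial>lborel) \<le> stability_form c s M z"
    using ennreal_le_iff[OF stability_form_nonneg[OF c M, of s z]] by blast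
  then have upper: "(\<integral>x. a x * (z x)\<^sup>2 \<partial>lborel) \<le> c / 2 * (\<integral>p. (gagliardo s z p)\<^sup>2 \<partial>lborel) + M * (\<integral>x. (z x)\<^sup>2 \<partial>lborel)"
    by (simp add: stability_form_def)
  \<comment> \<open>Written with the shifted potential, so that each of the three terms is known to
    be integrable; on \<open>\<Omega>\<close> the shift \<open>M\<close> cancels almost
    everywhere.\<close>
  define G where "G = (\<lambda>x. a x * (z x)\<^sup>2 - M * (z x)\<^sup>2 - d x * z x)"
  have G_int: "integrable lborel G"
    unfolding G_def using az dz(1) sq_integrable_integrable[OF z2(1)] by simp
  have "integral\<^sup>L lborel G = (\<integral>x. a x * (z x)\<^sup>2 \<partial>lborel) - M * (\<integral>x. (z x)\<^sup>2 \<partial>lborel) - (\<integral>x. d x * z x \<partial>lborel)"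
    unfolding G_def using az dz(1) sq_integrable_integrable[OF z2(1)] by simp
  \<comment> \<open>The energy of \<open>z\<close> occurs in \<open>upper\<close> and
    \<open>lower\<close> with the same coefficient \<open>c / 2\<close> and is eliminated; any loss
    in the stability constant would leave a positive remainder.\<close>
  then have G_le: "integral\<^sup>L lborel G \<le> 0" using upper lower by linarith
  have G_eq: "AE x in lborel. x \<in> \<Omega> \<longrightarrow>
      G x = z x * (deriv f (u' x) * (u' x - v' x) - (f (u' x) - f (v' x)))"
    using equ a_eq
  proof eventually_elim
    case (elim x)
    show ?case
    proof
      assume x: "x \<in> \<Omega>"
      then have "a x = deriv f (u' x) + M" using elim by simp
      then have "G x = deriv f (u' x) * (z x)\<^sup>2 - (f (u' x) - f (v' x)) * z x"
        using x by (simp add: G_def d_def distrib_right)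
      also have "(z x)\<^sup>2 = z x * (u' x - v' x)" using x by (simp add: z_def w_def max_def power2_eq_square)
      finally show "G x = z x * (deriv f (u' x) * (u' x - v' x) - (f (u' x) - f (v' x)))"
        by (simp add: algebra_simps)
    qed
  qed
  have z0: "z x = 0" if "x \<notin> \<Omega>" for x using that by (simp add: z_def w_def)
  have G_nonneg: "AE x in lborel. 0 \<le> G x"
    using G_eq
  proof eventually_elim
    case (elim x)
    show ?case
    proof (cases "x \<in> \<Omega>")
      case True
      have "0 \<le> deriv f (u' x) * (u' x - v' x) - (f (u' x) - f (v' x))"
        using strictly_convex_above_tangent(1)[OF f cvx, of "u' x" "v' x"] by (simp add: algebra_simps)
      then show ?thesis using elim True by (simp add: z_def)
    qed (simp add: G_def z0)
  qed
  have "integral\<^sup>L lborel G = 0" using G_le integral_nonneg_AE[OF G_nonneg] by simp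
  then have "AE x in lborel. G x = 0" using integral_nonneg_eq_0_iff_AE[OF G_int G_nonneg] by simp
  then show ?thesis
    using G_eq equ eqv out
  proof eventually_elim
    case (elim x)
    show ?case
    proof (cases "x \<in> \<Omega>")
      case True
      show ?thesis
      proof (rule ccontr)
        assume "\<not> u x \<le> v x"
        then have lt: "v' x < u' x" using elim by simp
        then have "0 < z x" using True by (simp add: z_def w_def)
        moreover have "0 < deriv f (u' x) * (u' x - v' x) - (f (u' x) - f (v' x))"
          using strictly_convex_above_tangent(2)[OF f cvx, of "u' x" "v' x"] lt by (simp add: algebra_simps)
        ultimately have "0 < G x" using elim True by simp
        then show False using elim by simp
      qed
    qed (use elim in simp)
  qed
qed

theorem theorem1p7:
  fixes \<Omega> :: "(real ^ 'n) set"
    and s c \<alpha>\<^sub>0 C\<^sub>0 :: real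
    and f :: "real \<Rightarrow> real"
    and g u v :: "real ^ 'n \<Rightarrow> real"
  assumes "0 < s" and "s < 1" and "0 < c"
    and "bounded_smooth_domain \<Omega>"
    and "f C1_differentiable_on UNIV" and "strictly_convex f"
    and "g \<in> borel_measurable (lebesgue_on (- \<Omega>))"
    and "max 0 (2 * s - 1) < \<alpha>\<^sub>0" and "\<alpha>\<^sub>0 < s" and "0 < C\<^sub>0"
    and "\<And>x z. x \<notin> \<Omega> \<Longrightarrow> z \<in> frontier \<Omega> \<Longrightarrow> \<bar>g x - g z\<bar> \<le> C\<^sub>0 * norm (x - z) powr \<alpha>\<^sub>0"
    and "stable_L1_weak_solution c s \<Omega> f g u"
    and "essentially_bounded_below \<Omega> u" and "u \<in> Hs_space c s \<Omega>"
    and "stable_L1_weak_solution c s \<Omega> f g v"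
    and "essentially_bounded_below \<Omega> v" and "v \<in> Hs_space c s \<Omega>"
  shows "AE x in lebesgue. u x = v x"
proof -
  have "AE x in lborel. u x \<le> v x"
    by (rule stable_solution_le) (fact assms)+
  moreover have "AE x in lborel. v x \<le> u x"
    by (rule stable_solution_le) (fact assms)+
  ultimately have "AE x in lborel. u x = v x" by eventually_elim simp
  then show ?thesis by (simp add: AE_completion_iff)
qed

end
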